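(* Let $p\in(1,\infty)$, $s\in(0,1)$, let $\Omega\subset\mathbb{R}^N$ be a smooth bounded domain with $N>sp$, let $\gamma>0$ and let $f\in L^1(\Omega)$ be non-negative. Let $u$ be a weak subsolution of $$(-\Delta)_p^s u=\frac{f(x)}{u^\gamma}\ \text{ in }\Omega,\qquad u>0\ \text{ in }\Omega,\qquad u=0\ \text{ in }\mathbb{R}^N\setminus\Omega \qquad (P)$$ such that $u\le 0$ on $\partial\Omega$, i.e. $(u-\varepsilon)^+\in W^{s,p}_0(\Omega)$ for every $\varepsilon>0$, and let $v$ be a weak supersolution of $(P)$. Then $u\le v$ a.e. in $\Omega$.
   Context: $W^{s,p}_0(\Omega):=\{u\in W^{s,p}(\mathbb{R}^N): u=0 \text{ in }\mathbb{R}^N\setminus\Omega\}$, where $W^{s,p}(\mathbb{R}^N)$ is the set of $u\in L^p(\mathbb{R}^N)$ with $\int_{\mathbb{R}^{2N}}\frac{|u(x)-u(y)|^p}{|x-y|^{N+sp}}\,dx\,dy<\infty$. $W^{s,p}_{\rm loc}(\Omega)$ is the set of functions $u$ with $u\in L^p(K)$ and $\int_{K\times K}\frac{|u(x)-u(y)|^p}{|x-y|^{N+sp}}\,dx\,dy<\infty$ for all $K\Subset\Omega$. $(-\Delta)^s_p$ denotes the fractional $p$-Laplacian. A function $z\in W^{s,p}_{\rm loc}(\Omega)\cap L^{p-1}(\Omega)$ with $z\ge0$, $z=0$ in $\mathbb{R}^N\setminus\Omega$ and $\frac{f}{z^\gamma}\in L^1_{\rm loc}(\Omega)$ is a weak supersolution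 (respectively subsolution) of $(P)$ if $$\int_{\mathbb{R}^{2N}}\frac{|z(x)-z(y)|^{p-2}(z(x)-z(y))(\varphi(x)-\varphi(y))}{|x-y|^{N+sp}}\,dx\,dy\ \ge\ (\text{resp. }\le)\ \int_\Omega\frac{f(x)}{z^\gamma}\varphi\,dx\qquad\text{for all }\varphi\in C^\infty_c(\Omega),\ \varphi\ge0.$$ At points where $z=0$, the quotient $f/z^\gamma$ is read as $+\infty$ if $f>0$ and as $0$ if $f=0$. *)

theory Defs
  imports "HOL-Analysis.Analysis"
begin

text \<open>
  Elements of \<open>L\<^sup>p\<close> are represented by Lebesgue measurable functions; accordingly, sign and
  vanishing conditions on them are required almost everywhere.
\<close>

primrec Ck :: "nat \<Rightarrow> ('a::euclidean_space \<Rightarrow> real) \<Rightarrow> bool" where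
  "Ck 0 g \<longleftrightarrow> continuous_on UNIV g"
| "Ck (Suc k) g \<longleftrightarrow>
     g differentiable_on UNIV \<and> (\<forall>d. Ck k (\<lambda>x. frechet_derivative g (at x) d))"

definition smooth :: "('a::euclidean_space \<Rightarrow> real) \<Rightarrow> bool" where
  "smooth g \<longleftrightarrow> (\<forall>k. Ck k g)"

definition test_function :: "'a::euclidean_space set \<Rightarrow> ('a \<Rightarrow> real) \<Rightarrow> bool" where
  "test_function \<Omega> \<phi> \<longleftrightarrow>
     smooth \<phi> \<and> compact (closure {x. \<phi> x \<noteq> 0}) \<and> closure {x. \<phi> x \<noteq> 0} \<subseteq> \<Omega>"

text \<open>
  Near each boundary point, after a rotation taking the last coordinate direction to \<open>e\<close>, the
  domain is the region above the graph of a smooth function of the remaining coordinates.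
  The vector \<open>x - (x \<bullet> e) *\<^sub>R e\<close> is the projection of \<open>x\<close> to the hyperplane orthogonal
  to \<open>e\<close>; any smooth function on that hyperplane extends to a smooth \<open>g\<close> on the whole space.
\<close>

definition smooth_bounded_domain :: "'a::euclidean_space set \<Rightarrow> bool" where
  "smooth_bounded_domain \<Omega> \<longleftrightarrow>
     open \<Omega> \<and> connected \<Omega> \<and> \<Omega> \<noteq> {} \<and> bounded \<Omega> \<and>
     (\<forall>x0 \<in> frontier \<Omega>. \<exists>r e g. r > 0 \<and> norm e = 1 \<and> smooth g \<and>
        \<Omega> \<inter> ball x0 r = {x \<in> ball x0 r. x \<bullet> e > g (x - (x \<bullet> e) *\<^sub>R e)})"

definition in_Lp :: "real \<Rightarrow> 'a::euclidean_space set \<Rightarrow> ('a \<Rightarrow> real) \<Rightarrow> bool" where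
  "in_Lp p A u \<longleftrightarrow>
     u \<in> borel_measurable (lebesgue_on A) \<and>
     (\<integral>\<^sup>+x. ennreal (\<bar>u x\<bar> powr p) \<partial>lebesgue_on A) < \<infinity>"

definition gagliardo :: "real \<Rightarrow> real \<Rightarrow> 'a::euclidean_space set \<Rightarrow> ('a \<Rightarrow> real) \<Rightarrow> ennreal" where
  "gagliardo s p A u =
     (\<integral>\<^sup>+(x, y). ennreal (\<bar>u x - u y\<bar> powr p / norm (x - y) powr (real DIM('a) + s * p))
        \<partial>lebesgue_on (A \<times> A))"

definition in_Wsp :: "real \<Rightarrow> real \<Rightarrow> ('a::euclidean_space \<Rightarrow> real) \<Rightarrow> bool" where
  "in_Wsp s p u \<longleftrightarrow> in_Lp p UNIV u \<and> gagliardo s p UNIV u < \<infinity>"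

definition in_Wsp0 :: "real \<Rightarrow> real \<Rightarrow> 'a::euclidean_space set \<Rightarrow> ('a \<Rightarrow> real) \<Rightarrow> bool" where
  "in_Wsp0 s p \<Omega> u \<longleftrightarrow> in_Wsp s p u \<and> (AE x in lebesgue. x \<notin> \<Omega> \<longrightarrow> u x = 0)"

definition in_Wsp_loc :: "real \<Rightarrow> real \<Rightarrow> 'a::euclidean_space set \<Rightarrow> ('a \<Rightarrow> real) \<Rightarrow> bool" where
  "in_Wsp_loc s p \<Omega> u \<longleftrightarrow>
     (\<forall>K. compact K \<and> K \<subseteq> \<Omega> \<longrightarrow> in_Lp p K u \<and> gagliardo s p K u < \<infinity>)"

text \<open>The quotient \<open>f / z\<^sup>\<gamma>\<close>, for \<open>f, z \<ge> 0\<close>, with its convention at the zeros of \<open>z\<close>.\<close>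

definition sing_quot :: "real \<Rightarrow> ('a \<Rightarrow> real) \<Rightarrow> ('a \<Rightarrow> real) \<Rightarrow> 'a \<Rightarrow> ennreal" where
  "sing_quot \<gamma> f z x =
     (if z x = 0 then (if f x > 0 then \<infinity> else 0) else ennreal (f x / z x powr \<gamma>))"

text \<open>
  The left-hand side of the weak formulation of the fractional \<open>p\<close>-Laplacian. If \<open>z\<close> lies in
  \<open>W\<^sup>s\<^sup>,\<^sup>p\<^sub>l\<^sub>o\<^sub>c(\<Omega>) \<inter> L\<^sup>p\<^sup>-\<^sup>1(\<Omega>)\<close> and vanishes outside
  a bounded \<open>\<Omega>\<close>, this integral converges absolutely for every test function \<open>\<phi>\<close>
  on \<open>\<Omega>\<close>, so the default value of the Bochner integral plays no role there. The factor
  \<open>\<bar>d\<bar>\<^sup>p\<^sup>-\<^sup>2 d\<close> is \<open>0\<close> for \<open>d = 0\<close>, also when \<open>p < 2\<close>.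
\<close>

definition frac_p_form ::
  "real \<Rightarrow> real \<Rightarrow> ('a::euclidean_space \<Rightarrow> real) \<Rightarrow> ('a \<Rightarrow> real) \<Rightarrow> real" where
  "frac_p_form s p z \<phi> =
     (\<integral>(x, y). \<bar>z x - z y\<bar> powr (p - 2) * (z x - z y) * (\<phi> x - \<phi> y)
          / norm (x - y) powr (real DIM('a) + s * p) \<partial>lebesgue)"

definition admissible ::
  "real \<Rightarrow> real \<Rightarrow> real \<Rightarrow> 'a::euclidean_space set \<Rightarrow> ('a \<Rightarrow> real) \<Rightarrow> ('a \<Rightarrow> real) \<Rightarrow> bool" where
  "admissible s p \<gamma> \<Omega> f z \<longleftrightarrow>
     in_Wsp_loc s p \<Omega> z \<and> in_Lp (p - 1) \<Omega> z \<and>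
     (AE x in lebesgue. z x \<ge> 0) \<and> (AE x in lebesgue. x \<notin> \<Omega> \<longrightarrow> z x = 0) \<and>
     (\<forall>K. compact K \<and> K \<subseteq> \<Omega> \<longrightarrow> (\<integral>\<^sup>+x. sing_quot \<gamma> f z x \<partial>lebesgue_on K) < \<infinity>)"

text \<open>The right-hand sides are integrals of nonnegative functions, finite for admissible \<open>z\<close>.\<close>

definition weak_supersolution ::
  "real \<Rightarrow> real \<Rightarrow> real \<Rightarrow> 'a::euclidean_space set \<Rightarrow> ('a \<Rightarrow> real) \<Rightarrow> ('a \<Rightarrow> real) \<Rightarrow> bool" where
  "weak_supersolution s p \<gamma> \<Omega> f z \<longleftrightarrow>
     admissible s p \<gamma> \<Omega> f z \<and>
     (\<forall>\<phi>. test_function \<Omega> \<phi> \<and> (\<forall>x. \<phi> x \<ge> 0) \<longrightarrow>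
        ereal (frac_p_form s p z \<phi>)
          \<ge> enn2ereal (\<integral>\<^sup>+x. sing_quot \<gamma> f z x * ennreal (\<phi> x) \<partial>lebesgue_on \<Omega>))"

definition weak_subsolution ::
  "real \<Rightarrow> real \<Rightarrow> real \<Rightarrow> 'a::euclidean_space set \<Rightarrow> ('a \<Rightarrow> real) \<Rightarrow> ('a \<Rightarrow> real) \<Rightarrow> bool" where
  "weak_subsolution s p \<gamma> \<Omega> f z \<longleftrightarrow>
     admissible s p \<gamma> \<Omega> f z \<and>
     (\<forall>\<phi>. test_function \<Omega> \<phi> \<and> (\<forall>x. \<phi> x \<ge> 0) \<longrightarrow>
        ereal (frac_p_form s p z \<phi>)
          \<le> enn2ereal (\<integral>\<^sup>+x. sing_quot \<gamma> f z x * ennreal (\<phi> x) \<partial>lebesgue_on \<Omega>))"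

definition nonpos_on_boundary ::
  "real \<Rightarrow> real \<Rightarrow> 'a::euclidean_space set \<Rightarrow> ('a \<Rightarrow> real) \<Rightarrow> bool" where
  "nonpos_on_boundary s p \<Omega> u \<longleftrightarrow> (\<forall>\<epsilon>>0. in_Wsp0 s p \<Omega> (\<lambda>x. max (u x - \<epsilon>) 0))"

end

theory Submission
  imports Defs
begin

text \<open>
  The difference \<open>u - v\<close> cannot be used as a test function near the boundary, because \<open>v\<close> has finite
  energy only locally. Therefore \<open>v\<close> is replaced by a smaller function \<open>w\<close> of finite energy. Let
  \<open>e = (u - \<epsilon>)\<^sup>+\<close> and let \<open>w\<close> minimize the energy minus the linear functional \<open>form e\<close> among all
  \<open>0 \<le> w \<le> min v e\<close>. For compactly supported \<open>0 \<le> \<psi> \<le> e - w\<close> the competitors \<open>min (w + t\<psi>) v\<close> give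
  \<open>form e \<psi> \<le> form w \<psi>\<close>: the excess \<open>(w + t\<psi> - v)\<^sup>+\<close> is supported where \<open>v < e < u\<close>, hence where
  \<open>f / u\<^sup>\<gamma> \<le> f / v\<^sup>\<gamma>\<close>, and there the inequalities for \<open>u\<close> and \<open>v\<close> may be compared. Letting \<open>\<psi>\<close>
  approach \<open>min (e - w) 1\<close> (the only use of the regularity of the boundary), the monotonicity of
  \<open>\<bar>d\<bar>\<^sup>p\<^sup>-\<^sup>2 d\<close> forces \<open>min (e - w) 1\<close> to be constant, hence zero, so that \<open>e = w \<le> v\<close>.

  All limits in the form need only energy bounds and convergence almost everywhere, by weak
  convergence.
\<close>

subsection \<open>The nonlinearity and its Bregman divergence\<close>

text \<open>The level \<open>\<epsilon>\<close> repairs \<open>u\<close>: its truncation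
  \<open>e\<close> has finite energy by the boundary condition, and truncation keeps the subsolution
  inequality for test functions living where \<open>u > \<epsilon>\<close>. Nothing similar is
  available for \<open>v\<close>, whose energy may blow up at the boundary; hence the detour through
  \<open>w\<close>. The minimized functional is \<open>breg_energy\<close>, normalized so that it is
  nonnegative and vanishes at \<open>e\<close>. Without the obstacle the minimizer would be
  \<open>e\<close> itself, and the claim amounts to saying that the obstacle is never felt.
  Integrating a nonnegative convex function of increments gives a functional that is defined for all
  Borel functions, lower semicontinuous by Fatou, and submodular, so that the order structure
  produces a minimizer. Between distant points only an L^(p-1) bound on \<open>v\<close> is at hand,
  so test functions paired with \<open>v\<close> must be bounded; hence the cut at 1 in
  \<open>min (e - w) 1\<close>. All double integrals are taken against the single measure
  \<open>mu\<close>, so that the form is a pairing of increments in L^p of one measure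
  space.\<close>

abbreviation borel_fun :: "('a::topological_space \<Rightarrow> 'b::topological_space) \<Rightarrow> bool" where
  "borel_fun f \<equiv> f \<in> borel_measurable borel"

definition pphi :: "real \<Rightarrow> real \<Rightarrow> real" where
  "pphi p d = \<bar>d\<bar> powr (p - 2) * d"

lemma abs_pphi: "\<bar>pphi p d\<bar> = \<bar>d\<bar> powr (p - 1)"
proof (cases "d = 0")
  case False
  then have "\<bar>d\<bar> powr (p - 1) = \<bar>d\<bar> powr (p - 2) * \<bar>d\<bar>"
    using powr_add[of "\<bar>d\<bar>" "p - 2" 1] by simp
  then show ?thesis by (simp add: pphi_def abs_mult)
qed (simp add: pphi_def)

lemma pphi_mult_self: "pphi p d * d = \<bar>d\<bar> powr p"
proof (cases "d = 0")
  case False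
  then have "\<bar>d\<bar> powr p = \<bar>d\<bar> powr (p - 2) * \<bar>d\<bar>\<^sup>2"
    using powr_add[of "\<bar>d\<bar>" "p - 2" 2] by simp
  then show ?thesis by (simp add: pphi_def power2_eq_square mult_ac)
qed (simp add: pphi_def)

lemma pphi_0 [simp]: "pphi p 0 = 0" by (simp add: pphi_def)
lemma pphi_minus: "pphi p (- d) = - pphi p d" by (simp add: pphi_def)

lemma pphi_measurable [measurable]: "borel_fun (pphi p)"
  unfolding pphi_def by measurable

lemma young_powr:
  fixes a b p :: real
  assumes "1 < p" "0 \<le> a" "0 \<le> b"
  shows "b powr (p - 1) * a \<le> a powr p / p + b powr p * (1 - 1 / p)"
proof -
  define q where "q = p / (p - 1)"
  have q: "q > 1" "1 / p + 1 / q = 1" "(p - 1) * q = p"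
    using assms by (auto simp: q_def field_simps)
  have "a * b powr (p - 1) \<le> a powr p / p + (b powr (p - 1)) powr q / q"
    using assms q by (intro Youngs_inequality) auto
  moreover have "(b powr (p - 1)) powr q = b powr p"
    using q by (simp add: powr_powr)
  moreover have "1 / q = 1 - 1 / p" using q by simp
  ultimately show ?thesis
    by (metis mult.commute times_divide_eq_right mult.right_neutral)
qed

text \<open>\<open>pphi p\<close> is the derivative of |d|^p / p, and this is the tangent inequality
  at \<open>b\<close>. It comes straight from Young's inequality, because
  \<open>pphi p b * b\<close> equals |b|^p; nothing is differentiated.\<close>

lemma pphi_tangent:
  assumes "1 < p"
  shows "\<bar>b\<bar> powr p / p + pphi p b * (a - b) \<le> \<bar>a\<bar> powr p / p"
proof -
  have "pphi p b * a \<le> \<bar>pphi p b\<bar> * \<bar>a\<bar>"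
    by (metis abs_ge_self abs_mult)
  also have "\<dots> \<le> \<bar>a\<bar> powr p / p + \<bar>b\<bar> powr p * (1 - 1 / p)"
    unfolding abs_pphi using assms by (intro young_powr) auto
  finally show ?thesis
    using pphi_mult_self[of p b] by (simp add: algebra_simps)
qed

lemma pphi_monotone: "1 < p \<Longrightarrow> 0 \<le> (pphi p a - pphi p b) * (a - b)"
  using pphi_tangent[of p a b] pphi_tangent[of p b a] by (simp add: algebra_simps)

lemma pphi_mono: "1 < p \<Longrightarrow> a \<le> b \<Longrightarrow> pphi p a \<le> pphi p b"
  using pphi_monotone[of p a b] by (cases "a = b") (auto simp: zero_le_mult_iff)

text \<open>Strictness of the monotonicity, which at the end turns a vanishing integral into
  vanishing increments. The modulus |d|^(p-1) determines |d| because p > 1, and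
  \<open>pphi p d\<close> has the sign of \<open>d\<close>.\<close>

lemma pphi_inj:
  assumes "1 < p" "pphi p a = pphi p b" shows "a = b"
proof -
  have "\<bar>a\<bar> powr (p - 1) = \<bar>b\<bar> powr (p - 1)"
    using assms abs_pphi by metis
  then have "\<bar>a\<bar> = \<bar>b\<bar>"
    using assms(1) powr_less_mono2[of "p - 1" "\<bar>a\<bar>" "\<bar>b\<bar>"] powr_less_mono2[of "p - 1" "\<bar>b\<bar>" "\<bar>a\<bar>"]
    by (cases "\<bar>a\<bar>" "\<bar>b\<bar>" rule: linorder_cases) auto
  then show ?thesis
    using assms(2) by (auto simp: pphi_minus abs_eq_iff pphi_def)
qed

lemma isCont_pphi:
  assumes "1 < p" shows "isCont (pphi p) d"
proof (cases "d = 0")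
  case True
  \<comment> \<open>At 0 the factor |d|^(p-2) is unbounded when p < 2, so continuity is read off the
    modulus |d|^(p-1).\<close>
  have "((\<lambda>x. \<bar>x\<bar> powr (p - 1)) \<longlongrightarrow> \<bar>0\<bar> powr (p - 1)) (at (0::real))"
    by (intro tendsto_powr' tendsto_intros) (use assms in auto)
  then have "((\<lambda>x. \<bar>pphi p x\<bar>) \<longlongrightarrow> 0) (at 0)"
    using assms by (simp add: abs_pphi)
  then show ?thesis
    using True by (simp add: isCont_def tendsto_rabs_zero_iff)
next
  case False
  then show ?thesis unfolding pphi_def by (intro continuous_intros) auto
qed

lemma tendsto_pphi: "1 < p \<Longrightarrow> (f \<longlongrightarrow> l) F \<Longrightarrow> ((\<lambda>x. pphi p (f x)) \<longlongrightarrow> pphi p l) F"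
  using isCont_tendsto_compose[OF isCont_pphi] by blast

text \<open>Young's inequality with an arbitrarily small weight on one term. Instead of optimizing,
  compare b^(p-1) with \<open>\<delta>\<close> a^(p-1): if it is at most that, the first term
  dominates; otherwise \<open>a\<close> is at most \<open>c\<close> times \<open>b\<close>, and
  \<open>c\<close> serves as the constant.\<close>

lemma powr_mult_le_eps:
  fixes p \<delta> :: real
  assumes "1 < p" "0 < \<delta>"
  obtains C where "0 \<le> C"
    "\<And>a b. 0 \<le> a \<Longrightarrow> 0 \<le> b \<Longrightarrow> b powr (p - 1) * a \<le> \<delta> * a powr p + C * b powr p"
proof
  define c where "c = \<delta> powr (- 1 / (p - 1))"
  show "0 \<le> c" by (simp add: c_def)
  fix a b :: real assume ab: "0 \<le> a" "0 \<le> b"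
  have split: "x powr p = x powr (p - 1) * x" if "0 \<le> x" for x
    using that powr_add[of x "p - 1" 1] by (cases "x = 0") auto
  show "b powr (p - 1) * a \<le> \<delta> * a powr p + c * b powr p"
  proof (cases "b powr (p - 1) \<le> \<delta> * a powr (p - 1)")
    case True
    then have "b powr (p - 1) * a \<le> \<delta> * a powr p"
      unfolding split[OF ab(1)] using ab by (metis mult.assoc mult_right_mono)
    then show ?thesis using \<open>0 \<le> c\<close> by (simp add: add_increasing2)
  next
    case False
    have "a = (a powr (p - 1)) powr (1 / (p - 1))"
      using assms ab by (simp add: powr_powr)
    also have "\<dots> \<le> (b powr (p - 1) / \<delta>) powr (1 / (p - 1))"
      using assms ab False by (intro powr_mono2) (auto simp: field_simps)
    also have "\<dots> = b * c"
      using assms ab by (simp add: powr_divide powr_powr c_def powr_minus_divide)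
    finally have "b powr (p - 1) * a \<le> c * b powr p"
      unfolding split[OF ab(2)] using mult_left_mono[of a "b * c" "b powr (p - 1)"] by (simp add: mult_ac)
    then show ?thesis using assms ab by (simp add: add_increasing)
  qed
qed

text \<open>Argued through the maximum rather than convexity, so as to cover every q > 0: it is also
  applied with q = p - 1, which may lie below 1.\<close>

lemma powr_add_le:
  fixes a b q :: real
  assumes "0 \<le> a" "0 \<le> b" "0 < q"
  shows "(a + b) powr q \<le> 2 powr q * (a powr q + b powr q)"
proof -
  have "(a + b) powr q \<le> (2 * max a b) powr q"
    using assms by (intro powr_mono2) auto
  also have "\<dots> = 2 powr q * (max a b) powr q"
    using assms by (simp add: powr_mult)
  also have "\<dots> \<le> 2 powr q * (a powr q + b powr q)"
    by (intro mult_left_mono) (auto simp: max_def)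
  finally show ?thesis .
qed

text \<open>
  The Bregman divergence of \<open>\<bar>a\<bar>\<^sup>p / p\<close>. Integrated over increments, \<open>breg p b a\<close> is the energy of
  \<open>a\<close> minus the linear term \<open>pphi p b * a\<close>, up to a constant that makes the integrand nonnegative.
\<close>

definition breg :: "real \<Rightarrow> real \<Rightarrow> real \<Rightarrow> real" where
  "breg p b a = \<bar>a\<bar> powr p / p - \<bar>b\<bar> powr p / p - pphi p b * (a - b)"

lemma breg_nonneg: "1 < p \<Longrightarrow> 0 \<le> breg p b a"
  using pphi_tangent[of p b a] by (simp add: breg_def)

text \<open>\<open>breg p b\<close> differs from |a|^p / p by an affine function of
  \<open>a\<close>, so it is convex with derivative \<open>pphi p a - pphi p b\<close>; this is its
  tangent inequality at \<open>a\<close>.\<close>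

lemma breg_tangent: "1 < p \<Longrightarrow> breg p b a + (pphi p a - pphi p b) * (c - a) \<le> breg p b c"
  using pphi_tangent[of p a c] by (simp add: breg_def algebra_simps)

lemma breg_measurable [measurable]: 
  "(\<lambda>x. breg p (f x) (g x)) \<in> borel_measurable M" 
  if [measurable]: "f \<in> borel_measurable M" "g \<in> borel_measurable M"
  unfolding breg_def by measurable

lemma tendsto_breg:
  assumes "1 < p" "(f \<longlongrightarrow> l) F"
  shows "((\<lambda>x. breg p b (f x)) \<longlongrightarrow> breg p b l) F"
  unfolding breg_def using assms by (intro tendsto_intros tendsto_powr') auto

text \<open>Coercivity, through which finite Bregman energy gives finite Gagliardo energy. The mixed
  term is absorbed with weight 1 / (2p), half of the coefficient of |a|^p in \<open>breg\<close>,
  which leaves the other half.\<close>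

lemma powr_le_breg:
  assumes "1 < p"
  obtains C where "0 \<le> C" "\<And>a b. \<bar>a\<bar> powr p \<le> C * (breg p b a + \<bar>b\<bar> powr p)"
proof -
  obtain C where C: "0 \<le> C"
    "\<And>a b. 0 \<le> a \<Longrightarrow> 0 \<le> b \<Longrightarrow> b powr (p - 1) * a \<le> 1 / (2 * p) * a powr p + C * b powr p"
    using powr_mult_le_eps[of p "1 / (2 * p)"] assms by auto
  show ?thesis
  proof
    show "0 \<le> 2 * p * (C + 1)" using C assms by auto
    fix a b :: real
    have "pphi p b * a \<le> \<bar>pphi p b\<bar> * \<bar>a\<bar>"
      by (metis abs_ge_self abs_mult)
    also have "\<dots> \<le> 1 / (2 * p) * \<bar>a\<bar> powr p + C * \<bar>b\<bar> powr p"
      unfolding abs_pphi by (intro C) auto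
    finally have 1: "pphi p b * a \<le> 1 / (2 * p) * \<bar>a\<bar> powr p + C * \<bar>b\<bar> powr p" .
    have "\<bar>b\<bar> powr p / p \<le> \<bar>b\<bar> powr p"
      using assms mult_left_mono[of 1 p "\<bar>b\<bar> powr p"] by (simp add: divide_le_eq)
    with 1 have "\<bar>a\<bar> powr p / (2 * p) \<le> breg p b a + C * \<bar>b\<bar> powr p"
      using pphi_mult_self[of p b] by (simp add: breg_def algebra_simps)
    also have "\<dots> \<le> (C + 1) * (breg p b a + \<bar>b\<bar> powr p)"
      using C(1) breg_nonneg[OF assms, of b a] by (simp add: algebra_simps)
    finally show "\<bar>a\<bar> powr p \<le> 2 * p * (C + 1) * (breg p b a + \<bar>b\<bar> powr p)"
      using assms by (simp add: field_simps)
  qed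
qed

text \<open>Of two pairs with equal sums the inner one has the smaller total under a convex
  function. The tangents at the inner points \<open>z1\<close>, \<open>z2\<close> are added; the
  displacements are opposite, so what remains is the difference of slopes times
  \<open>x2 - z2\<close>, which is nonnegative.\<close>

lemma breg_majorization:
  assumes "1 < p" "x1 \<le> y1" "x1 \<le> y2" "y1 + y2 = x1 + x2"
  shows "breg p b y1 + breg p b y2 \<le> breg p b x1 + breg p b x2"
proof -
  have *: "breg p b z1 + breg p b z2 \<le> breg p b x1 + breg p b x2"
    if "x1 \<le> z1" "z1 \<le> z2" "z1 + z2 = x1 + x2" for z1 z2
  proof -
    have "0 \<le> (pphi p z2 - pphi p z1) * (x2 - z2)"
      using that assms(1) by (intro mult_nonneg_nonneg) (auto intro: pphi_mono)
    moreover have "x1 - z1 = - (x2 - z2)" using that by simp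
    then have "(pphi p z1 - pphi p b) * (x1 - z1) + (pphi p z2 - pphi p b) * (x2 - z2)
        = (pphi p z2 - pphi p z1) * (x2 - z2)"
      by (simp only:) (simp add: algebra_simps)
    ultimately show ?thesis
      using breg_tangent[OF assms(1), of b z1 x1] breg_tangent[OF assms(1), of b z2 x2] by linarith
  qed
  show ?thesis using *[of y1 y2] *[of y2 y1] assms by (cases "y1 \<le> y2") auto
qed

text \<open>If \<open>a\<close> and \<open>c\<close> are ordered alike at both points, max and min
  merely permute the two increments. If the order is crossed, the new increments have the same sum
  and lie between the old ones, and majorization applies.\<close>

lemma breg_submodular:
  assumes "1 < p"
  shows "breg p b (max a1 c1 - max a2 c2) + breg p b (min a1 c1 - min a2 c2)
    \<le> breg p b (a1 - a2) + breg p b (c1 - c2)"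
proof -
  consider "a1 \<le> c1" "a2 \<le> c2" | "c1 \<le> a1" "c2 \<le> a2" | "c1 \<le> a1" "a2 \<le> c2" | "a1 \<le> c1" "c2 \<le> a2"
    by linarith
  then show ?thesis
  proof cases
    case 3
    then show ?thesis
      using breg_majorization[OF assms, of "c1 - c2" "a1 - c2" "c1 - a2" "a1 - a2" b] by simp
  next
    case 4
    then show ?thesis
      using breg_majorization[OF assms, of "a1 - a2" "c1 - a2" "a1 - c2" "c1 - c2" b] by simp
  qed auto
qed

subsection \<open>The singular kernel\<close>

lemma power_powr: "0 < x \<Longrightarrow> (x ^ n) powr e = (x powr e) ^ n" for x e :: real
  by (simp add: powr_power powr_powr mult.commute flip: powr_realpow)

text \<open>A substitute for polar coordinates: the ball of radius \<open>2 * \<rho> k\<close> has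
  volume a constant times \<open>\<rho> k ^ DIM('a)\<close>, so the k-th dyadic shell contributes at
  most a constant times \<open>q ^ k\<close>.\<close>

lemma nn_integral_shells_finite:
  fixes h :: "'a::euclidean_space \<Rightarrow> ennreal" and \<rho> :: "nat \<Rightarrow> real"
  assumes pos: "\<And>k. 0 < \<rho> k" and c: "0 \<le> c" and q: "0 < q" "q < 1"
    and cover: "\<And>z. h z \<noteq> 0 \<Longrightarrow> \<exists>k. \<rho> k \<le> norm z \<and> norm z < 2 * \<rho> k"
    and bound: "\<And>k z. \<rho> k \<le> norm z \<Longrightarrow> norm z < 2 * \<rho> k \<Longrightarrow> h z \<le> ennreal (c * q ^ k / \<rho> k ^ DIM('a))"
  shows "(\<integral>\<^sup>+z. h z \<partial>lborel) < \<infinity>"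
proof -
  define m where "m = unit_ball_vol (real DIM('a))"
  define d where "d k = c * q ^ k / \<rho> k ^ DIM('a)" for k
  have d: "0 \<le> d k" for k using c q pos[of k] by (simp add: d_def)
  have le_suminf: "f k \<le> (\<Sum>k. f k)" for f :: "nat \<Rightarrow> ennreal" and k
    using sum_le_suminf[OF summableI, of "{k}" f] by simp
  have [measurable]: "ball (0::'a) r \<in> sets borel" for r by simp
  have meas: "(\<lambda>z::'a. ennreal (d k) * indicator (ball 0 (2 * \<rho> k)) z) \<in> borel_measurable lborel" for k
    by measurable
  have "(\<integral>\<^sup>+z. h z \<partial>lborel) \<le> (\<integral>\<^sup>+z. (\<Sum>k. ennreal (d k) * indicator (ball (0::'a) (2 * \<rho> k)) z) \<partial>lborel)"
  proof (rule nn_integral_mono)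
    fix z
    show "h z \<le> (\<Sum>k. ennreal (d k) * indicator (ball (0::'a) (2 * \<rho> k)) z)"
    proof (cases "h z = 0")
      case False
      then obtain k where k: "\<rho> k \<le> norm z" "norm z < 2 * \<rho> k" using cover by blast
      have "h z \<le> ennreal (d k) * indicator (ball (0::'a) (2 * \<rho> k)) z"
        using bound[OF k] k by (simp add: d_def)
      also have "\<dots> \<le> (\<Sum>k. ennreal (d k) * indicator (ball (0::'a) (2 * \<rho> k)) z)"
        by (rule le_suminf)
      finally show ?thesis .
    qed simp
  qed
  also have "\<dots> = (\<Sum>k. ennreal (d k) * emeasure lborel (ball (0::'a) (2 * \<rho> k)))"
    by (subst nn_integral_suminf[OF meas]) (simp add: nn_integral_cmult_indicator)
  also have "\<dots> = (\<Sum>k. ennreal (c * 2 ^ DIM('a) * m * q ^ k))"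
  proof (rule suminf_cong)
    fix k
    have "ennreal (d k) * emeasure lborel (ball (0::'a) (2 * \<rho> k))
        = ennreal (d k) * ennreal (m * (2 * \<rho> k) ^ DIM('a))"
      using pos[of k] by (simp add: emeasure_ball m_def)
    also have "\<dots> = ennreal (d k * (m * (2 * \<rho> k) ^ DIM('a)))"
      using d by (simp add: ennreal_mult')
    also have "d k * (m * (2 * \<rho> k) ^ DIM('a)) = c * 2 ^ DIM('a) * m * q ^ k"
      using pos[of k] by (simp add: d_def power_mult_distrib)
    finally show "ennreal (d k) * emeasure lborel (ball (0::'a) (2 * \<rho> k)) = ennreal (c * 2 ^ DIM('a) * m * q ^ k)" .
  qed
  also have "\<dots> = ennreal (\<Sum>k. c * 2 ^ DIM('a) * m * q ^ k)"
    using c q by (intro suminf_ennreal2) (auto simp: m_def intro!: summable_mult summable_geometric)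
  also have "\<dots> < \<infinity>" by simp
  finally show ?thesis .
qed

text \<open>Write N for the dimension. On the shell of inner radius r =
  \<open>2 ^ k * \<delta>\<close> one has r^(-a) = r^(N-a) / r^N, and r^(N-a) is geometric in k with
  ratio 2^(N-a) < 1.\<close>

lemma nn_integral_kernel_tail:
  fixes a :: real
  assumes "0 < \<delta>" and "real DIM('a::euclidean_space) < a"
  shows "(\<integral>\<^sup>+z. (if \<delta> \<le> norm (z::'a) then ennreal (1 / norm z powr a) else 0) \<partial>lborel) < \<infinity>"
proof (rule nn_integral_shells_finite[where \<rho> = "\<lambda>k. 2 ^ k * \<delta>" and c = "\<delta> powr (real DIM('a) - a)"
      and q = "2 powr (real DIM('a) - a)"])
  show "2 powr (real DIM('a) - a) < 1"
    using assms powr_less_mono[of "real DIM('a) - a" 0 2] by simp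
  fix z :: 'a
  assume "(if \<delta> \<le> norm z then ennreal (1 / norm z powr a) else 0) \<noteq> 0"
  then have z: "\<delta> \<le> norm z" "0 < norm z" using assms by (auto split: if_splits)
  \<comment> \<open>The index of the dyadic shell containing \<open>z\<close>; \<open>nat\<close>
    loses nothing because the logarithm is nonnegative here.\<close>
  define k where "k = nat \<lfloor>log 2 (norm z / \<delta>)\<rfloor>"
  have pos: "0 < norm z / \<delta>" "1 \<le> norm z / \<delta>" using z assms by (auto intro: divide_pos_pos)
  then have "0 \<le> log 2 (norm z / \<delta>)" by (subst zero_le_log_cancel_iff) auto
  then have k: "real k \<le> log 2 (norm z / \<delta>)" "log 2 (norm z / \<delta>) < real k + 1"
    unfolding k_def by linarith+
  have "2 ^ k \<le> norm z / \<delta>" using k(1) pos by (simp add: le_log_iff powr_realpow)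
  moreover have "norm z / \<delta> < 2 powr (real k + 1)" using k(2) pos by (simp add: log_less_iff)
  then have "norm z / \<delta> < 2 ^ Suc k" by (simp add: powr_add powr_realpow mult.commute)
  ultimately show "\<exists>k. 2 ^ k * \<delta> \<le> norm z \<and> norm z < 2 * (2 ^ k * \<delta>)"
    using assms by (intro exI[of _ k]) (auto simp: field_simps)
next
  fix k and z :: 'a
  define r where "r = 2 ^ k * \<delta>"
  assume "2 ^ k * \<delta> \<le> norm z" "norm z < 2 * (2 ^ k * \<delta>)"
  moreover have "\<delta> \<le> 2 ^ k * \<delta>" using assms by simp
  ultimately have z: "r \<le> norm z" "0 < norm z" and r: "0 < r" "\<delta> \<le> r" "\<delta> \<le> norm z"
    using assms unfolding r_def by linarith+
  have "1 / norm z powr a \<le> 1 / r powr a"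
    using z r assms by (intro divide_left_mono powr_mono2 mult_pos_pos) auto
  also have "\<dots> = r powr (real DIM('a) - a) / r ^ DIM('a)"
    using r by (simp add: powr_diff powr_realpow)
  also have "r powr (real DIM('a) - a) = \<delta> powr (real DIM('a) - a) * (2 powr (real DIM('a) - a)) ^ k"
    using assms by (simp add: r_def powr_mult powr_powr flip: powr_realpow) (simp add: mult_ac)
  finally show "(if \<delta> \<le> norm z then ennreal (1 / norm z powr a) else 0)
      \<le> ennreal (\<delta> powr (real DIM('a) - a) * (2 powr (real DIM('a) - a)) ^ k / (2 ^ k * \<delta>) ^ DIM('a))"
    unfolding r_def by (auto intro: ennreal_leI)
qed (use assms in auto)

text \<open>Shells shrinking to the origin. With a = N + sp, where N is the dimension, the first
  hypothesis reads s < 1. In the constant \<open>c\<close>, 2^p comes from |z| < 2r, and the other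
  factor from the exponent \<open>Suc k\<close> in the radius.\<close>

lemma nn_integral_kernel_near:
  fixes a p :: real
  assumes "a < real DIM('a::euclidean_space) + p" "0 < p" "0 \<le> a"
  shows "(\<integral>\<^sup>+z. (if norm (z::'a) < 1 then ennreal (norm z powr p / norm z powr a) else 0) \<partial>lborel) < \<infinity>"
proof (rule nn_integral_shells_finite[where \<rho> = "\<lambda>k. (1/2) ^ Suc k" 
      and c = "2 powr p * (1/2) powr (real DIM('a) + p - a)"
      and q = "(1/2) powr (real DIM('a) + p - a)"])
  have "(1/2) powr (real DIM('a) + p - a) < (1/2) powr 0"
    using assms powr_less_mono'[of "1/2" 0 "real DIM('a) + p - a"] by simp
  then show "(1/2::real) powr (real DIM('a) + p - a) < 1" by simp
  fix z :: 'a
  assume "(if norm z < 1 then ennreal (norm z powr p / norm z powr a) else 0) \<noteq> 0"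
  then have z: "norm z < 1" "0 < norm z" by (auto split: if_splits)
  define k where "k = (LEAST k. (1/2) ^ Suc k \<le> norm z)"
  obtain n where "(1/2) ^ n < norm z" using z real_arch_pow_inv[of "norm z" "1/2"] by auto
  then have ex: "(1/2) ^ Suc n \<le> norm z" by (simp add: field_simps)
  have 1: "(1/2) ^ Suc k \<le> norm z" unfolding k_def using ex by (rule LeastI[where P = "\<lambda>k. (1/2) ^ Suc k \<le> norm z"])
  have 2: "norm z < 2 * (1/2) ^ Suc k"
  proof (cases k)
    case (Suc j)
    then have "\<not> (1/2) ^ Suc j \<le> norm z" 
      using not_less_Least[of j "\<lambda>k. (1/2) ^ Suc k \<le> norm z"] by (simp add: k_def)
    then show ?thesis using Suc by simp
  qed (use z in simp)
  show "\<exists>k. (1/2) ^ Suc k \<le> norm z \<and> norm z < 2 * (1/2) ^ Suc k" using 1 2 by blast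
next
  fix k and z :: 'a
  define r :: real where "r = (1/2) ^ Suc k"
  assume "(1/2) ^ Suc k \<le> norm z" "norm z < 2 * (1/2) ^ Suc k"
  then have z: "r \<le> norm z" "norm z \<le> 2 * r" and r: "0 < r" by (auto simp: r_def)
  have "norm z powr p / norm z powr a \<le> (2 * r) powr p / r powr a"
    using z r assms by (intro frac_le powr_mono2) auto
  also have "\<dots> = 2 powr p * r powr (real DIM('a) + p - a) / r ^ DIM('a)"
    using r by (simp add: powr_diff powr_add powr_realpow powr_mult)
  also have "r powr (real DIM('a) + p - a) = (1/2) powr (real DIM('a) + p - a) * ((1/2) powr (real DIM('a) + p - a)) ^ k"
    unfolding r_def by (subst power_powr) auto
  finally show "(if norm z < 1 then ennreal (norm z powr p / norm z powr a) else 0)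
      \<le> ennreal (2 powr p * (1/2) powr (real DIM('a) + p - a) * ((1/2) powr (real DIM('a) + p - a)) ^ k / ((1/2) ^ Suc k) ^ DIM('a))"
    unfolding r_def by (auto intro: ennreal_leI simp: mult_ac)
qed (use assms in auto)

section \<open>Increments, the kernel as a measure on pairs, and the Gagliardo energy\<close>

abbreviation df :: "('a \<Rightarrow> real) \<Rightarrow> 'a \<times> 'a \<Rightarrow> real" where
  "df h w \<equiv> h (fst w) - h (snd w)"

abbreviation Lp_int :: "real \<Rightarrow> 'a measure \<Rightarrow> ('a \<Rightarrow> real) \<Rightarrow> ennreal" where
  "Lp_int p M g \<equiv> (\<integral>\<^sup>+x. ennreal (\<bar>g x\<bar> powr p) \<partial>M)"

text \<open>Division by zero makes the kernel 0 on the diagonal, so that \<open>mu\<close> puts no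
  mass there.\<close>

definition kern :: "real \<Rightarrow> real \<Rightarrow> 'a::euclidean_space \<times> 'a \<Rightarrow> real" where
  "kern s p = (\<lambda>(x, y). 1 / norm (x - y) powr (real DIM('a) + s * p))"

definition mu :: "real \<Rightarrow> real \<Rightarrow> ('a::euclidean_space \<times> 'a) measure" where
  "mu s p = density lborel (\<lambda>z. ennreal (kern s p z))"

definition gag :: "real \<Rightarrow> real \<Rightarrow> ('a::euclidean_space \<Rightarrow> real) \<Rightarrow> ennreal" where
  "gag s p u = Lp_int p (mu s p) (df u)"

lemma borel_measurable_fst_snd [measurable]:
  "fst \<in> borel_measurable (borel :: ('a::euclidean_space \<times> 'a) measure)"
  "snd \<in> borel_measurable (borel :: ('a::euclidean_space \<times> 'a) measure)"
  by (simp_all add: borel_prod[symmetric])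

lemma kern_nonneg [simp]: "0 \<le> kern s p z" by (cases z) (simp add: kern_def)

lemma kern_measurable [measurable]: "borel_fun (kern s p)"
  unfolding kern_def case_prod_beta by measurable

lemma sets_mu [simp, measurable_cong]: "sets (mu s p) = sets borel"
  by (simp add: mu_def)

lemma space_mu [simp]: "space (mu s p) = UNIV"
  by (simp add: mu_def)

lemma borel_measurable_mu [simp]: "borel_measurable (mu s p) = borel_measurable borel"
  by (rule measurable_cong_sets) auto

lemma nn_integral_mu:
  assumes [measurable]: "borel_fun f"
  shows "(\<integral>\<^sup>+z. f z \<partial>mu s p) = (\<integral>\<^sup>+z. ennreal (kern s p z) * f z \<partial>lborel)"
  unfolding mu_def by (rule nn_integral_density) measurable

lemma nn_integral_lborel_pair:
  fixes f :: "'a::euclidean_space \<times> 'b::euclidean_space \<Rightarrow> ennreal"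
  assumes [measurable]: "borel_fun f"
  shows "(\<integral>\<^sup>+z. f z \<partial>lborel) = (\<integral>\<^sup>+x. \<integral>\<^sup>+y. f (x, y) \<partial>lborel \<partial>lborel)"
proof -
  have [measurable]: "f \<in> borel_measurable (lborel \<Otimes>\<^sub>M lborel)"
    by (simp add: lborel_prod)
  show ?thesis
    unfolding lborel_prod[symmetric] by (subst lborel.nn_integral_fst[symmetric]) auto
qed

lemma nn_integral_lborel_translate:
  fixes f :: "'a::euclidean_space \<Rightarrow> ennreal"
  assumes [measurable]: "borel_fun f"
  shows "(\<integral>\<^sup>+x. f (c + x) \<partial>lborel) = (\<integral>\<^sup>+x. f x \<partial>lborel)"
  by (subst (2) lborel_distr_plus[of c, symmetric], subst nn_integral_distr) auto

lemma lborel_distr_reflect: "distr lborel borel (\<lambda>y. x - y) = (lborel :: 'a::euclidean_space measure)"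
  using lborel_affine[of "-1" x] by (simp add: density_1)

lemma nn_integral_lborel_reflect:
  fixes f :: "'a::euclidean_space \<Rightarrow> ennreal"
  assumes [measurable]: "borel_fun f"
  shows "(\<integral>\<^sup>+y. f (x - y) \<partial>lborel) = (\<integral>\<^sup>+y. f y \<partial>lborel)"
  by (subst (2) lborel_distr_reflect[of x, symmetric], subst nn_integral_distr) auto

text \<open>Symmetry of the kernel and Tonelli. Later estimates treat only pairs whose first point
  lies in a given set and double the result.\<close>

lemma distr_mu_swap: "distr (mu s p) borel (\<lambda>z. (snd z, fst z)) = (mu s p :: ('a::euclidean_space \<times> 'a) measure)"
proof (rule measure_eqI)
  fix A assume A: "A \<in> sets (distr (mu s p :: ('a \<times> 'a) measure) borel (\<lambda>z. (snd z, fst z)))"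
  then have [measurable]: "A \<in> sets borel" by simp
  have "emeasure (distr (mu s p) borel (\<lambda>z. (snd z, fst z))) A
      = (\<integral>\<^sup>+z. indicator A (snd z, fst z) \<partial>mu s p)"
    by (subst nn_integral_indicator[symmetric, OF A], subst nn_integral_distr) (auto simp: A)
  also have "\<dots> = (\<integral>\<^sup>+x. \<integral>\<^sup>+y. ennreal (kern s p (x, y)) * indicator A (y, x) \<partial>lborel \<partial>lborel)"
    by (subst nn_integral_mu) (auto simp: nn_integral_lborel_pair)
  also have "\<dots> = (\<integral>\<^sup>+y. \<integral>\<^sup>+x. ennreal (kern s p (x, y)) * indicator A (y, x) \<partial>lborel \<partial>lborel)"
    by (rule lborel_pair.Fubini') (simp add: lborel_prod borel_prod case_prod_beta)
  also have "\<dots> = (\<integral>\<^sup>+x. \<integral>\<^sup>+y. ennreal (kern s p (x, y)) * indicator A (x, y) \<partial>lborel \<partial>lborel)"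
    by (simp add: kern_def norm_minus_commute)
  also have "\<dots> = (\<integral>\<^sup>+z. indicator A z \<partial>mu s p)"
    by (subst nn_integral_mu) (auto simp: nn_integral_lborel_pair)
  also have "\<dots> = emeasure (mu s p) A" by simp
  finally show "emeasure (distr (mu s p) borel (\<lambda>z. (snd z, fst z))) A = emeasure (mu s p) A" .
qed simp

lemma nn_integral_mu_swap:
  fixes f :: "'a::euclidean_space \<times> 'a \<Rightarrow> ennreal"
  assumes [measurable]: "borel_fun f"
  shows "(\<integral>\<^sup>+z. f (snd z, fst z) \<partial>mu s p) = (\<integral>\<^sup>+z. f z \<partial>mu s p)"
  by (subst (2) distr_mu_swap[symmetric], subst nn_integral_distr) auto

lemma nn_integral_mu_translate:
  fixes f :: "'a::euclidean_space \<times> 'a \<Rightarrow> ennreal"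
  assumes [measurable]: "borel_fun f"
  shows "(\<integral>\<^sup>+z. f (c + fst z, c + snd z) \<partial>mu s p) = (\<integral>\<^sup>+z. f z \<partial>mu s p)"
proof -
  have "(\<integral>\<^sup>+z. f (c + fst z, c + snd z) \<partial>mu s p)
      = (\<integral>\<^sup>+z. (\<lambda>w. ennreal (kern s p w) * f w) ((c, c) + z) \<partial>lborel)"
    by (subst nn_integral_mu) (auto simp: kern_def case_prod_beta plus_prod_def)
  also have "\<dots> = (\<integral>\<^sup>+z. f z \<partial>mu s p)"
    by (subst nn_integral_lborel_translate) (auto simp: nn_integral_mu)
  finally show ?thesis .
qed

lemma AE_mu_I: "AE z in lborel. P z \<Longrightarrow> AE z in mu s p. P z"
  unfolding mu_def by (subst AE_density) auto

text \<open>A null set in one factor gives a null cylinder in the product; this carries statements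
  about points to statements about increments.\<close>

lemma AE_lborel_fst_snd:
  assumes "AE x in lborel. P (x :: 'a::euclidean_space)"
  shows "AE z in lborel. P (fst z) \<and> P (snd z)"
proof -
  obtain N where N: "{x. \<not> P x} \<subseteq> N" "N \<in> null_sets lborel"
    using assms by (auto elim!: AE_E simp: null_sets_def)
  have "N \<times> UNIV \<in> null_sets (lborel \<Otimes>\<^sub>M lborel :: ('a \<times> 'a) measure)"
    "UNIV \<times> N \<in> null_sets (lborel \<Otimes>\<^sub>M lborel :: ('a \<times> 'a) measure)"
    using N(2) by (auto simp: null_sets_def lborel.emeasure_pair_measure_Times)
  then have "N \<times> UNIV \<union> UNIV \<times> N \<in> null_sets (lborel :: ('a \<times> 'a) measure)"
    unfolding lborel_prod by (rule null_sets.Un)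
  then show ?thesis
    by (rule AE_I') (use N(1) in force)
qed

lemma AE_mu_fst_snd:
  "AE x in lborel. P (x :: 'a::euclidean_space) \<Longrightarrow> AE z in mu s p. P (fst z) \<and> P (snd z)"
  by (intro AE_mu_I AE_lborel_fst_snd)

lemma nn_integral_fst_diff:
  fixes h g :: "'a::euclidean_space \<Rightarrow> ennreal"
  assumes [measurable]: "borel_fun h" "borel_fun g"
  shows "(\<integral>\<^sup>+z. h (fst z) * g (fst z - snd z) \<partial>lborel) = (\<integral>\<^sup>+x. h x \<partial>lborel) * (\<integral>\<^sup>+x. g x \<partial>lborel)"
  by (subst nn_integral_lborel_pair) (auto simp: nn_integral_cmult nn_integral_lborel_reflect nn_integral_multc)

text \<open>Away from the diagonal the kernel is integrable in the second point, with an integral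
  that does not depend on the first, so only \<open>h\<close> remains to be integrated.\<close>

lemma mu_far_finite:
  fixes h :: "'a::euclidean_space \<Rightarrow> ennreal"
  assumes "0 < \<delta>" "0 < s * p" and [measurable]: "borel_fun h" and h: "(\<integral>\<^sup>+x. h x \<partial>lborel) < \<infinity>"
  shows "(\<integral>\<^sup>+z. (if \<delta> \<le> norm (fst z - snd z) then h (fst z) else 0) \<partial>mu s p) < \<infinity>"
proof -
  define g where "g z = (if \<delta> \<le> norm (z::'a) then ennreal (1 / norm z powr (real DIM('a) + s * p)) else 0)" for z
  have [measurable]: "borel_fun g" unfolding g_def by measurable
  have "(\<integral>\<^sup>+z. g z \<partial>lborel) < \<infinity>"
    unfolding g_def using assms by (intro nn_integral_kernel_tail) auto
  moreover have "(\<integral>\<^sup>+z. (if \<delta> \<le> norm (fst z - snd z) then h (fst z) else 0) \<partial>mu s p)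
     = (\<integral>\<^sup>+z. h (fst z) * g (fst z - snd z) \<partial>lborel)"
    by (subst nn_integral_mu) (auto intro!: nn_integral_cong simp: kern_def g_def case_prod_beta mult_ac)
  ultimately show ?thesis using h by (simp add: nn_integral_fst_diff ennreal_mult_less_top)
qed

text \<open>Pairs at distance below 1 use the Lipschitz bound and the near part of the kernel, the
  others the bound \<open>M\<close> and its tail. Both majorants depend on x - y only, and the first
  point is confined to \<open>B\<close>; pairs with second point in \<open>B\<close> follow by the
  swap.\<close>

lemma gag_lipschitz_finite:
  fixes \<eta> :: "'a::euclidean_space \<Rightarrow> real"
  assumes p: "1 < p" "0 < s" "s < 1" and [measurable]: "borel_fun \<eta>"
    and L: "\<And>x y. \<bar>\<eta> x - \<eta> y\<bar> \<le> L * norm (x - y)" "0 \<le> L"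
    and M: "\<And>x. \<bar>\<eta> x\<bar> \<le> M"
    and R: "\<And>x. x \<notin> B \<Longrightarrow> \<eta> x = 0" and [measurable]: "B \<in> sets borel" and B: "emeasure lborel B < \<infinity>"
  shows "gag s p \<eta> < \<infinity>"
proof -
  let ?a = "real DIM('a) + s * p"
  define far near where "far z = (if 1 \<le> norm (z::'a) then ennreal (1 / norm z powr ?a) else 0)"
    and "near z = (if norm (z::'a) < 1 then ennreal (norm z powr p / norm z powr ?a) else 0)" for z
  define G where "G z = ennreal ((2 * M) powr p) * far z + ennreal (L powr p) * near z" for z
  have [measurable]: "borel_fun far" "borel_fun near" unfolding far_def near_def by measurable
  have [measurable]: "borel_fun G" unfolding G_def by measurable
  have "s * p < p" using p by simp
  then have "(\<integral>\<^sup>+z. near z \<partial>lborel) < \<infinity>"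
    unfolding near_def using p by (intro nn_integral_kernel_near) auto
  moreover have "(\<integral>\<^sup>+z. far z \<partial>lborel) < \<infinity>"
    unfolding far_def using p by (intro nn_integral_kernel_tail) auto
  ultimately have G: "(\<integral>\<^sup>+z. G z \<partial>lborel) < \<infinity>"
    unfolding G_def by (simp add: nn_integral_add nn_integral_cmult ennreal_mult_less_top)
  define I where "I z = (if fst z \<in> B then ennreal (\<bar>df \<eta> z\<bar> powr p) else 0)" for z
  have [measurable]: "borel_fun I" unfolding I_def by measurable
  have "ennreal (kern s p z) * I z \<le> indicator B (fst z) * G (fst z - snd z)" for z
  proof -
    have "\<bar>df \<eta> z\<bar> powr p \<le> (2 * M) powr p"
      using p M[of "fst z"] M[of "snd z"] by (intro powr_mono2) auto
    moreover have "\<bar>df \<eta> z\<bar> powr p \<le> L powr p * norm (fst z - snd z) powr p"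
      using p L by (subst powr_mult[symmetric]) (auto intro: powr_mono2)
    ultimately have "kern s p z * \<bar>df \<eta> z\<bar> powr p
      \<le> (if 1 \<le> norm (fst z - snd z) then (2 * M) powr p * (1 / norm (fst z - snd z) powr ?a)
          else L powr p * (norm (fst z - snd z) powr p / norm (fst z - snd z) powr ?a))"
      by (auto simp: kern_def case_prod_beta intro: divide_right_mono)
    then show ?thesis
      by (auto simp: I_def G_def far_def near_def simp flip: ennreal_mult' ennreal_mult'' split: if_splits intro: ennreal_leI)
  qed
  then have "(\<integral>\<^sup>+z. I z \<partial>mu s p) \<le> (\<integral>\<^sup>+z. indicator B (fst z) * G (fst z - snd z) \<partial>lborel)"
    by (subst nn_integral_mu) (auto intro: nn_integral_mono)
  also have "\<dots> < \<infinity>" using B G by (simp add: nn_integral_fst_diff ennreal_mult_less_top)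
  finally have I: "(\<integral>\<^sup>+z. I z \<partial>mu s p) < \<infinity>" .
  have "ennreal (\<bar>df \<eta> z\<bar> powr p) \<le> I z + I (snd z, fst z)" for z
    using R[of "fst z"] R[of "snd z"] p by (auto simp: I_def abs_minus_commute)
  then have "gag s p \<eta> \<le> (\<integral>\<^sup>+z. I z + I (snd z, fst z) \<partial>mu s p)"
    unfolding gag_def by (intro nn_integral_mono) auto
  also have "\<dots> = 2 * (\<integral>\<^sup>+z. I z \<partial>mu s p)"
    by (subst nn_integral_add) (auto simp: nn_integral_mu_swap mult_2)
  also have "\<dots> < \<infinity>" using I by (simp add: ennreal_mult_less_top)
  finally show ?thesis .
qed

subsection \<open>Weak convergence in the form\<close>

lemma integrable_dominated:
  fixes f g :: "'a \<Rightarrow> real"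
  assumes "integrable M g" "f \<in> borel_measurable M" "\<And>x. \<bar>f x\<bar> \<le> g x"
  shows "integrable M f"
proof (rule Bochner_Integration.integrable_bound[OF assms(1,2)], rule AE_I2)
  show "norm (f x) \<le> norm (g x)" for x using assms(3)[of x] by simp
qed

lemma integrable_nn_bound:
  fixes f :: "'a \<Rightarrow> real"
  assumes "f \<in> borel_measurable M" "\<And>x. 0 \<le> f x" "(\<integral>\<^sup>+x. ennreal (f x) \<partial>M) \<le> ennreal c" "0 \<le> c"
  shows "integrable M f" "(\<integral>x. f x \<partial>M) \<le> c"
proof -
  show i: "integrable M f"
    using assms by (intro integrableI_nonneg) (auto intro: le_less_trans)
  then have "ennreal (\<integral>x. f x \<partial>M) \<le> ennreal c"
    using assms by (simp add: nn_integral_eq_integral)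
  then show "(\<integral>x. f x \<partial>M) \<le> c" using assms(4) by simp
qed

lemma nn_integral_powr_add_le:
  fixes a b d :: "'a \<Rightarrow> real"
  assumes "0 < q" and [measurable]: "a \<in> borel_measurable M" "b \<in> borel_measurable M" "d \<in> borel_measurable M"
    and le: "\<And>x. \<bar>d x\<bar> \<le> \<bar>a x\<bar> + \<bar>b x\<bar>"
  shows "Lp_int q M d
    \<le> ennreal (2 powr q) * (Lp_int q M a + Lp_int q M b)"
proof -
  have "\<bar>d x\<bar> powr q \<le> 2 powr q * (\<bar>a x\<bar> powr q + \<bar>b x\<bar> powr q)" for x
  proof -
    have "\<bar>d x\<bar> powr q \<le> (\<bar>a x\<bar> + \<bar>b x\<bar>) powr q" using le assms(1) by (intro powr_mono2) auto
    also have "\<dots> \<le> 2 powr q * (\<bar>a x\<bar> powr q + \<bar>b x\<bar> powr q)" using assms(1) by (intro powr_add_le) auto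
    finally show ?thesis .
  qed
  then have "Lp_int q M d
      \<le> (\<integral>\<^sup>+x. ennreal (2 powr q) * (ennreal (\<bar>a x\<bar> powr q) + ennreal (\<bar>b x\<bar> powr q)) \<partial>M)"
    by (intro nn_integral_mono) (simp add: ennreal_leI flip: ennreal_plus ennreal_mult)
  also have "\<dots> = ennreal (2 powr q) * (Lp_int q M a + Lp_int q M b)"
    by (simp add: nn_integral_cmult nn_integral_add)
  finally show ?thesis .
qed

lemma integrable_pphi_mult:
  assumes p: "1 < p" and [measurable]: "d \<in> borel_measurable M" "g \<in> borel_measurable M"
    and d: "Lp_int p M d < \<infinity>"
    and g: "Lp_int p M g < \<infinity>"
  shows "integrable M (\<lambda>x. pphi p (d x) * g x)"
proof -
  obtain C where C: "0 \<le> C"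
    "\<And>a b. 0 \<le> a \<Longrightarrow> 0 \<le> b \<Longrightarrow> b powr (p - 1) * a \<le> 1 * a powr p + C * b powr p"
    using powr_mult_le_eps[of p 1] p by auto
  show ?thesis
  proof (rule Bochner_Integration.integrable_bound)
    show "integrable M (\<lambda>x. \<bar>g x\<bar> powr p + C * \<bar>d x\<bar> powr p)"
      using d g by (intro Bochner_Integration.integrable_add integrable_mult_right integrableI_nonneg) auto
    show "AE x in M. norm (pphi p (d x) * g x) \<le> norm (\<bar>g x\<bar> powr p + C * \<bar>d x\<bar> powr p)"
    proof (rule AE_I2)
      fix x
      have "norm (pphi p (d x) * g x) = \<bar>d x\<bar> powr (p - 1) * \<bar>g x\<bar>" by (simp add: abs_mult abs_pphi)
      also have "\<dots> \<le> \<bar>g x\<bar> powr p + C * \<bar>d x\<bar> powr p" using C(2)[of "\<bar>g x\<bar>" "\<bar>d x\<bar>"] by simp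
      finally show "norm (pphi p (d x) * g x) \<le> norm (\<bar>g x\<bar> powr p + C * \<bar>d x\<bar> powr p)" by simp
    qed
  qed measurable
qed

text \<open>
  By Young's inequality \<open>\<bar>d\<bar>\<^sup>p\<^sup>-\<^sup>1 h\<^sub>n - \<delta> h\<^sub>n\<^sup>p\<close>, where \<open>h\<^sub>n = \<bar>g\<^sub>n - g\<^sub>0\<bar>\<close>, is bounded above by a multiple
  of \<open>\<bar>d\<bar>\<^sup>p\<close>, so that dominated convergence applies to its positive part.
\<close>

lemma tendsto_integral_pphi_mult:
  assumes p: "1 < p" and dm [measurable]: "d \<in> borel_measurable M"
    and gm [measurable]: "\<And>n. g n \<in> borel_measurable M" "g0 \<in> borel_measurable M"
    and d: "Lp_int p M d < \<infinity>"
    and g: "\<And>n. Lp_int p M (g n) \<le> C" and C: "C < \<infinity>"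
    and ae: "AE x in M. (\<lambda>n. g n x) \<longlonglongrightarrow> g0 x"
  shows "Lp_int p M g0 \<le> C"
    and "(\<lambda>n. \<integral>x. pphi p (d x) * g n x \<partial>M) \<longlonglongrightarrow> (\<integral>x. pphi p (d x) * g0 x \<partial>M)"
proof -
  have "Lp_int p M g0 = (\<integral>\<^sup>+x. liminf (\<lambda>n. ennreal (\<bar>g n x\<bar> powr p)) \<partial>M)"
  proof (rule nn_integral_cong_AE, use ae in eventually_elim)
    fix x assume "(\<lambda>n. g n x) \<longlonglongrightarrow> g0 x"
    then have "(\<lambda>n. ennreal (\<bar>g n x\<bar> powr p)) \<longlonglongrightarrow> ennreal (\<bar>g0 x\<bar> powr p)"
      using p by (intro tendsto_ennrealI tendsto_powr' tendsto_intros) auto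
    from lim_imp_Liminf[OF trivial_limit_sequentially this]
    show "ennreal (\<bar>g0 x\<bar> powr p) = liminf (\<lambda>n. ennreal (\<bar>g n x\<bar> powr p))"
      by (rule sym)
  qed
  also have "\<dots> \<le> liminf (\<lambda>n. \<integral>\<^sup>+x. ennreal (\<bar>g n x\<bar> powr p) \<partial>M)"
    by (rule nn_integral_liminf) measurable
  also have "\<dots> \<le> C" by (rule Liminf_le) (auto intro: always_eventually g)
  finally show g0: "Lp_int p M g0 \<le> C" .
  obtain c where c: "0 \<le> c" "C = ennreal c" using C by (cases C) auto
  define c2 where "c2 = 2 powr p * (c + c)"
  define h where "h n x = \<bar>g n x - g0 x\<bar>" for n x
  have [measurable]: "h n \<in> borel_measurable M" for n unfolding h_def by measurable
  have hint: "integrable M (\<lambda>x. h n x powr p)" "(\<integral>x. h n x powr p \<partial>M) \<le> c2" for n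
  proof -
    have "Lp_int p M (\<lambda>x. g n x - g0 x) \<le> ennreal (2 powr p) * (C + C)"
      using p by (intro order_trans[OF nn_integral_powr_add_le[of p "g n" M g0]] mult_left_mono add_mono g g0) auto
    also have "\<dots> = ennreal c2" using c by (simp add: c2_def flip: ennreal_plus ennreal_mult)
    finally have *: "(\<integral>\<^sup>+x. ennreal (h n x powr p) \<partial>M) \<le> ennreal c2" by (simp add: h_def)
    show "integrable M (\<lambda>x. h n x powr p)" "(\<integral>x. h n x powr p \<partial>M) \<le> c2"
      using integrable_nn_bound[OF _ _ *] c by (auto simp: c2_def)
  qed
  have dint: "integrable M (\<lambda>x. \<bar>d x\<bar> powr p)" using d by (intro integrableI_nonneg) auto
  have gint: "integrable M (\<lambda>x. pphi p (d x) * g n x)" for n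
    using g[of n] C by (intro integrable_pphi_mult p d) (auto simp: less_top[symmetric] top_unique)
  have g0int: "integrable M (\<lambda>x. pphi p (d x) * g0 x)"
    using g0 C by (intro integrable_pphi_mult p d) (auto simp: less_top[symmetric] top_unique)
  have fint: "integrable M (\<lambda>x. \<bar>d x\<bar> powr (p - 1) * h n x)" for n
    using integrable_norm[OF Bochner_Integration.integrable_diff[OF gint[of n] g0int]]
    by (simp add: h_def abs_pphi abs_mult flip: right_diff_distrib)
  have "(\<lambda>n. \<integral>x. \<bar>d x\<bar> powr (p - 1) * h n x \<partial>M) \<longlonglongrightarrow> 0"
  proof (rule LIMSEQ_I)
    fix e :: real assume e: "0 < e"
    \<comment> \<open>\<open>c2\<close> bounds all integrals of \<open>h n x powr p\<close>, so this
      weight costs at most half of \<open>e\<close> and leaves the other half to the positive part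
      \<open>r\<close>. Adding 1 excludes division by 0.\<close>
    define \<delta> where "\<delta> = e / (2 * (c2 + 1))"
    have c2: "0 \<le> c2" using c by (simp add: c2_def)
    have \<delta>: "0 < \<delta>" "\<delta> * c2 \<le> e / 2"
      using e c2 by (auto simp: \<delta>_def field_simps)
    obtain K where K: "0 \<le> K"
      "\<And>a b. 0 \<le> a \<Longrightarrow> 0 \<le> b \<Longrightarrow> b powr (p - 1) * a \<le> \<delta> * a powr p + K * b powr p"
      using powr_mult_le_eps[OF p \<delta>(1)] by auto
    define r where "r n x = max 0 (\<bar>d x\<bar> powr (p - 1) * h n x - \<delta> * h n x powr p)" for n x
    have rm[measurable]: "r n \<in> borel_measurable M" for n unfolding r_def by measurable
    have rb: "norm (r n x) \<le> K * \<bar>d x\<bar> powr p" for n x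
      using K(2)[of "h n x" "\<bar>d x\<bar>"] K(1) by (simp add: r_def h_def)
    have "(\<lambda>n. \<integral>x. r n x \<partial>M) \<longlonglongrightarrow> (\<integral>x. 0 \<partial>M)"
    proof (rule integral_dominated_convergence)
      show "integrable M (\<lambda>x. K * \<bar>d x\<bar> powr p)" using dint by simp
      show "AE x in M. (\<lambda>n. r n x) \<longlonglongrightarrow> 0"
        using ae
      proof eventually_elim
        fix x assume "(\<lambda>n. g n x) \<longlonglongrightarrow> g0 x"
        then have h: "(\<lambda>n. h n x) \<longlonglongrightarrow> 0"
          unfolding h_def by (intro tendsto_rabs_zero) (simp add: LIM_zero)
        have "(\<lambda>n. h n x powr p) \<longlonglongrightarrow> 0 powr p"
          using p h by (intro tendsto_powr' h tendsto_const) (auto simp: h_def)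
        then have "(\<lambda>n. r n x) \<longlonglongrightarrow> max 0 (\<bar>d x\<bar> powr (p - 1) * 0 - \<delta> * 0)"
          unfolding r_def using p by (intro tendsto_max tendsto_diff tendsto_mult tendsto_const h) auto
        then show "(\<lambda>n. r n x) \<longlonglongrightarrow> 0" by simp
      qed
    qed (use rb in auto)
    then have "\<forall>\<^sub>F n in sequentially. (\<integral>x. r n x \<partial>M) < e / 2"
      using e by (intro order_tendstoD) auto
    then have "\<forall>\<^sub>F n in sequentially. norm ((\<integral>x. \<bar>d x\<bar> powr (p - 1) * h n x \<partial>M) - 0) < e"
    proof eventually_elim
      fix n assume n: "(\<integral>x. r n x \<partial>M) < e / 2"
      have ri: "integrable M (r n)"
        by (rule integrable_dominated[OF integrable_mult_right[OF dint, of K]]) (use rb in auto)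
      have "(\<integral>x. \<bar>d x\<bar> powr (p - 1) * h n x \<partial>M) \<le> (\<integral>x. r n x + \<delta> * h n x powr p \<partial>M)"
        using ri hint fint by (intro integral_mono) (auto simp: r_def)
      also have "\<dots> = (\<integral>x. r n x \<partial>M) + \<delta> * (\<integral>x. h n x powr p \<partial>M)"
        using ri hint by simp
      also have "\<dots> < e / 2 + \<delta> * c2"
        using n hint(2)[of n] \<delta>(1) by (intro add_less_le_mono mult_left_mono) auto
      finally have "(\<integral>x. \<bar>d x\<bar> powr (p - 1) * h n x \<partial>M) < e" using \<delta>(2) by linarith
      moreover have "0 \<le> (\<integral>x. \<bar>d x\<bar> powr (p - 1) * h n x \<partial>M)"
        by (intro Bochner_Integration.integral_nonneg) (auto simp: h_def)
      ultimately show "norm ((\<integral>x. \<bar>d x\<bar> powr (p - 1) * h n x \<partial>M) - 0) < e" by simp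
    qed
    then show "\<exists>n0. \<forall>n\<ge>n0. norm ((\<integral>x. \<bar>d x\<bar> powr (p - 1) * h n x \<partial>M) - 0) < e"
      by (simp add: eventually_sequentially)
  qed
  moreover have "norm ((\<integral>x. pphi p (d x) * g n x \<partial>M) - (\<integral>x. pphi p (d x) * g0 x \<partial>M))
      \<le> (\<integral>x. \<bar>d x\<bar> powr (p - 1) * h n x \<partial>M)" for n
  proof -
    have "(\<integral>x. pphi p (d x) * g n x \<partial>M) - (\<integral>x. pphi p (d x) * g0 x \<partial>M)
        = (\<integral>x. pphi p (d x) * (g n x - g0 x) \<partial>M)"
      using gint g0int by (simp add: right_diff_distrib)
    also have "norm \<dots> \<le> (\<integral>x. norm (pphi p (d x) * (g n x - g0 x)) \<partial>M)"
      by (rule integral_norm_bound)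
    finally show ?thesis by (simp add: h_def abs_mult abs_pphi)
  qed
  ultimately have "(\<lambda>n. (\<integral>x. pphi p (d x) * g n x \<partial>M) - (\<integral>x. pphi p (d x) * g0 x \<partial>M)) \<longlonglongrightarrow> 0"
    by (rule Lim_null_comparison[OF always_eventually, rotated, OF _ allI])
  then show "(\<lambda>n. \<integral>x. pphi p (d x) * g n x \<partial>M) \<longlonglongrightarrow> (\<integral>x. pphi p (d x) * g0 x \<partial>M)"
    by (rule LIM_zero_cancel)
qed

text \<open>The two finiteness conditions are matched to testing with bounded functions of compact
  support: energy on \<open>K \<times> K\<close> controls close pairs, the global L^(p-1) integral
  controls distant ones.\<close>

definition loc_energy :: "real \<Rightarrow> real \<Rightarrow> 'a::euclidean_space set \<Rightarrow> ('a \<Rightarrow> real) \<Rightarrow> bool" where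
  "loc_energy s p \<Omega> z \<longleftrightarrow> z \<in> borel_measurable borel \<and>
     (\<forall>K. compact K \<and> K \<subseteq> \<Omega> \<longrightarrow>
        (\<integral>\<^sup>+w. indicator (K \<times> K) w * ennreal (\<bar>df z w\<bar> powr p) \<partial>mu s p) < \<infinity>) \<and>
     Lp_int (p - 1) lborel z < \<infinity>"

definition form :: "real \<Rightarrow> real \<Rightarrow> ('a::euclidean_space \<Rightarrow> real) \<Rightarrow> ('a \<Rightarrow> real) \<Rightarrow> real" where
  "form s p z \<phi> = (\<integral>w. pphi p (df z w) * df \<phi> w \<partial>mu s p)"

text \<open>A pair with one point in \<open>K\<close> either lies in \<open>K' \<times> K'\<close>
  or has distance greater than \<open>\<delta>\<close>. All splittings into close and distant pairs
  rest on this.\<close>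

lemma compact_neighbourhood:
  fixes K :: "'a::euclidean_space set"
  assumes "compact K" "open \<Omega>" "K \<subseteq> \<Omega>"
  obtains \<delta> K' where "0 < \<delta>" "compact K'" "K' \<subseteq> \<Omega>" "K \<subseteq> K'" "\<And>x y. x \<in> K \<Longrightarrow> norm (x - y) \<le> \<delta> \<Longrightarrow> y \<in> K'"
proof -
  obtain \<delta> where \<delta>: "0 < \<delta>" "(\<Union>x\<in>K. cball x \<delta>) \<subseteq> \<Omega>"
    using compact_subset_open_imp_cball_epsilon_subset[OF assms] by auto
  define K' where "K' = {x + y |x y. x \<in> K \<and> y \<in> cball 0 \<delta>}"
  have in_K': "y \<in> K'" if "x \<in> K" "norm (x - y) \<le> \<delta>" for x y
  proof -
    have "y = x + (y - x) \<and> x \<in> K \<and> y - x \<in> cball 0 \<delta>"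
      using that by (simp add: norm_minus_commute)
    then show ?thesis unfolding K'_def by blast
  qed
  show ?thesis
  proof (rule that[of \<delta> K'])
    show "compact K'" unfolding K'_def using assms by (intro compact_sums) auto
    show "K' \<subseteq> \<Omega>"
    proof
      fix z assume "z \<in> K'"
      then obtain x y where "z = x + y" "x \<in> K" "y \<in> cball 0 \<delta>" by (auto simp: K'_def)
      then have "z \<in> cball x \<delta>" by (simp add: dist_norm)
      then show "z \<in> \<Omega>" using \<delta>(2) \<open>x \<in> K\<close> by blast
    qed
    show "K \<subseteq> K'" using in_K'[of x x for x] \<delta> by auto
  qed (use in_K' \<delta> in auto)
qed

text \<open>The power of the increment is split into its two endpoint terms, which the swap
  identifies; each is an integrable function of one point, taken against the kernel away from the
  diagonal.\<close>

lemma far_energy_finite: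
  fixes z :: "'a::euclidean_space \<Rightarrow> real"
  assumes p: "1 < p" "0 < s" and [measurable]: "borel_fun z"
    and z: "Lp_int (p - 1) lborel z < \<infinity>" and \<delta>: "0 < \<delta>"
  shows "(\<integral>\<^sup>+w. (if \<delta> \<le> norm (fst w - snd w) then ennreal (\<bar>df z w\<bar> powr (p - 1)) else 0) \<partial>mu s p) < \<infinity>"
proof -
  define I where "I w = (if \<delta> \<le> norm (fst w - snd w) then ennreal (\<bar>z (fst w)\<bar> powr (p - 1)) else 0)" for w :: "'a \<times> 'a"
  have [measurable]: "borel_fun I" unfolding I_def by measurable
  have I: "(\<integral>\<^sup>+w. I w \<partial>mu s p) < \<infinity>"
    unfolding I_def using z p \<delta> by (intro mu_far_finite) auto
  have "(if \<delta> \<le> norm (fst w - snd w) then ennreal (\<bar>df z w\<bar> powr (p - 1)) else 0)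
      \<le> ennreal (2 powr (p - 1)) * (I w + I (snd w, fst w))" for w
  proof (cases "\<delta> \<le> norm (fst w - snd w)")
    case True
    have "\<bar>df z w\<bar> powr (p - 1) \<le> (\<bar>z (fst w)\<bar> + \<bar>z (snd w)\<bar>) powr (p - 1)"
      using p by (intro powr_mono2) auto
    also have "\<dots> \<le> 2 powr (p - 1) * (\<bar>z (fst w)\<bar> powr (p - 1) + \<bar>z (snd w)\<bar> powr (p - 1))"
      using p by (intro powr_add_le) auto
    finally show ?thesis
      using True by (simp add: I_def norm_minus_commute flip: ennreal_mult ennreal_plus)
  qed simp
  then have "(\<integral>\<^sup>+w. (if \<delta> \<le> norm (fst w - snd w) then ennreal (\<bar>df z w\<bar> powr (p - 1)) else 0) \<partial>mu s p)
     \<le> (\<integral>\<^sup>+w. ennreal (2 powr (p - 1)) * (I w + I (snd w, fst w)) \<partial>mu s p)"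
    by (rule nn_integral_mono)
  also have "\<dots> = ennreal (2 powr (p - 1)) * ((\<integral>\<^sup>+w. I w \<partial>mu s p) + (\<integral>\<^sup>+w. I w \<partial>mu s p))"
    by (simp add: nn_integral_cmult nn_integral_add nn_integral_mu_swap)
  also have "\<dots> < \<infinity>" using I by (simp add: ennreal_mult_less_top)
  finally show ?thesis .
qed

text \<open>As \<open>z\<close> lacks global energy, \<open>pphi p (df z)\<close> is split. On
  \<open>K' \<times> K'\<close> the increments \<open>d\<close> lie in L^p(\<open>mu\<close>), where
  bounded energy of \<open>g n\<close> gives weak convergence. The remainder \<open>F\<close> lies
  in L^1(\<open>mu\<close>) and meets increments bounded by \<open>2 * M\<close>, so dominated
  convergence applies.\<close>

lemma form_tendsto:
  fixes z \<omega> :: "'a::euclidean_space \<Rightarrow> real"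
  assumes p: "1 < p" "0 < s" and \<Omega>: "open \<Omega>" and z: "loc_energy s p \<Omega> z"
    and K: "compact K" "K \<subseteq> \<Omega>"
    and gm [measurable]: "\<And>n. g n \<in> borel_measurable borel" "borel_fun \<omega>"
    and M: "\<And>n x. \<bar>g n x\<bar> \<le> M" "\<And>x. \<bar>\<omega> x\<bar> \<le> M"
    and supp: "\<And>n x. x \<notin> K \<Longrightarrow> g n x = 0" "\<And>x. x \<notin> K \<Longrightarrow> \<omega> x = 0"
    and C: "\<And>n. gag s p (g n) \<le> C" "C < \<infinity>"
    and ae: "AE x in lborel. (\<lambda>n. g n x) \<longlonglongrightarrow> \<omega> x"
  shows "integrable (mu s p) (\<lambda>w. pphi p (df z w) * df \<omega> w)"
    and "(\<lambda>n. form s p z (g n)) \<longlonglongrightarrow> form s p z \<omega>"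
proof -
  have zm [measurable]: "borel_fun z" using z by (simp add: loc_energy_def)
  obtain \<delta> K' where K': "0 < \<delta>" "compact K'" "K' \<subseteq> \<Omega>" "K \<subseteq> K'"
      "\<And>x y. x \<in> K \<Longrightarrow> norm (x - y) \<le> \<delta> \<Longrightarrow> y \<in> K'"
    using compact_neighbourhood[OF K(1) \<Omega> K(2)] by metis
  have Km [measurable]: "K' \<in> sets borel" using K' by (simp add: compact_imp_closed)
  have KKm [measurable]: "K' \<times> K' \<in> sets borel"
    using K' by (intro borel_closed closed_Times compact_imp_closed) auto
  define A where "A = (indicator (K' \<times> K') :: 'a \<times> 'a \<Rightarrow> real)"
  \<comment> \<open>Pairs outside \<open>K' \<times> K'\<close> at distance below
    \<open>\<delta>\<close> may be dropped: both points then avoid \<open>K\<close>, so the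
    increments of the test functions vanish.\<close>
  define B where "B w = (if \<delta> \<le> norm (fst w - snd w) then 1 - A w else 0)" for w
  have [measurable]: "borel_fun A" "borel_fun B"
    unfolding A_def B_def by measurable
  define d where "d w = A w * df z w" for w
  define G where "G = (\<lambda>n w. df (g n) w)"
  define G0 where "G0 = (\<lambda>w. df \<omega> w)"
  define F where "F w = B w * pphi p (df z w)" for w
  have Gm [measurable]: "borel_fun (G n)" "borel_fun G0"
     "borel_fun d" "borel_fun F" for n
    unfolding G_def G0_def d_def F_def by measurable
  have split: "pphi p (df z w) * df h w
      = pphi p (d w) * df h w + F w * df h w"
    if h: "\<And>x. x \<notin> K \<Longrightarrow> h x = 0" for h :: "'a \<Rightarrow> real" and w
  proof (cases "w \<in> K' \<times> K'")
    case False
    have "df h w = 0" if "\<not> \<delta> \<le> norm (fst w - snd w)"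
    proof -
      have "fst w \<notin> K \<or> snd w \<in> K'" "snd w \<notin> K \<or> fst w \<in> K'"
        using K'(5)[of "fst w" "snd w"] K'(5)[of "snd w" "fst w"] that by (auto simp: norm_minus_commute)
      then have "fst w \<notin> K" "snd w \<notin> K" using False K'(4) by (auto simp: mem_Times_iff)
      then show ?thesis using h by simp
    qed
    then show ?thesis using False by (cases "\<delta> \<le> norm (fst w - snd w)") (auto simp: d_def F_def B_def A_def)
  qed (auto simp: d_def F_def B_def A_def)
  have dfin: "Lp_int p (mu s p) d < \<infinity>"
  proof -
    have "Lp_int p (mu s p) d
        = (\<integral>\<^sup>+w. indicator (K' \<times> K') w * ennreal (\<bar>df z w\<bar> powr p) \<partial>mu s p)"
      by (intro nn_integral_cong) (auto simp: d_def A_def split: split_indicator)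
    then show ?thesis using z K' unfolding loc_energy_def by auto
  qed
  have Gfin: "Lp_int p (mu s p) (G n) \<le> C" for n
    using C(1)[of n] by (simp add: gag_def G_def)
  have Gae: "AE w in mu s p. (\<lambda>n. G n w) \<longlonglongrightarrow> G0 w"
    using AE_mu_fst_snd[OF ae] unfolding G_def G0_def by eventually_elim (auto intro: tendsto_diff)
  have G0fin: "Lp_int p (mu s p) G0 \<le> C"
    by (rule tendsto_integral_pphi_mult(1)[where d = d and g = G])
       (use p Gfin Gae C dfin in auto)
  have lim1: "(\<lambda>n. \<integral>w. pphi p (d w) * G n w \<partial>mu s p) \<longlonglongrightarrow> (\<integral>w. pphi p (d w) * G0 w \<partial>mu s p)"
    by (rule tendsto_integral_pphi_mult(2)[where C = C])
       (use p Gfin Gae C dfin in auto)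
  have int1: "integrable (mu s p) (\<lambda>w. pphi p (d w) * G n w)" for n
    using Gfin[of n] C dfin p by (intro integrable_pphi_mult) auto
  have int10: "integrable (mu s p) (\<lambda>w. pphi p (d w) * G0 w)"
    using G0fin C dfin p by (intro integrable_pphi_mult) auto
  have Fint: "integrable (mu s p) (\<lambda>w. 2 * M * \<bar>F w\<bar>)"
  proof -
    have "(\<integral>\<^sup>+w. ennreal \<bar>F w\<bar> \<partial>mu s p) \<le> (\<integral>\<^sup>+w. (if \<delta> \<le> norm (fst w - snd w)
        then ennreal (\<bar>df z w\<bar> powr (p - 1)) else 0) \<partial>mu s p)"
      by (intro nn_integral_mono) (auto simp: F_def B_def A_def abs_mult abs_pphi split: split_indicator)
    also have "\<dots> < \<infinity>"
      using z K' p by (intro far_energy_finite) (auto simp: loc_energy_def)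
    finally show ?thesis
      by (intro integrable_mult_right integrableI_nonneg) auto
  qed
  have Gb: "\<bar>G n w\<bar> \<le> 2 * M" "\<bar>G0 w\<bar> \<le> 2 * M" for n w
    unfolding G_def G0_def using M(1)[of n "fst w"] M(1)[of n "snd w"] M(2)[of "fst w"] M(2)[of "snd w"] by linarith+
  have bnd: "norm (F w * x) \<le> 2 * M * \<bar>F w\<bar>" if "\<bar>x\<bar> \<le> 2 * M" for w x
    using mult_right_mono[OF that, of "\<bar>F w\<bar>"] by (simp add: abs_mult mult_ac)
  have lim2: "(\<lambda>n. \<integral>w. F w * G n w \<partial>mu s p) \<longlonglongrightarrow> (\<integral>w. F w * G0 w \<partial>mu s p)"
  proof (rule integral_dominated_convergence[OF _ _ Fint])
    show "AE w in mu s p. (\<lambda>n. F w * G n w) \<longlonglongrightarrow> F w * G0 w"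
      using Gae by eventually_elim (auto intro: tendsto_mult)
    show "AE w in mu s p. norm (F w * G n w) \<le> 2 * M * \<bar>F w\<bar>" for n
      using bnd Gb by auto
  qed auto
  have int2: "integrable (mu s p) (\<lambda>w. F w * G n w)" for n
    by (rule integrable_dominated[OF Fint]) (use bnd[OF Gb(1)] in auto)
  have int20: "integrable (mu s p) (\<lambda>w. F w * G0 w)"
    by (rule integrable_dominated[OF Fint]) (use bnd[OF Gb(2)] in auto)
  have split_g: "pphi p (df z w) * df (g n) w
      = pphi p (d w) * df (g n) w + F w * df (g n) w" for n w
    by (rule split) (rule supp(1))
  have split_0: "pphi p (df z w) * df \<omega> w
      = pphi p (d w) * df \<omega> w + F w * df \<omega> w" for w
    by (rule split) (rule supp(2))
  show "integrable (mu s p) (\<lambda>w. pphi p (df z w) * df \<omega> w)"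
    unfolding split_0 using Bochner_Integration.integrable_add[OF int10 int20] by (simp add: G0_def)
  have "form s p z (g n) = (\<integral>w. pphi p (d w) * G n w \<partial>mu s p) + (\<integral>w. F w * G n w \<partial>mu s p)" for n
    unfolding form_def split_g using int1[of n] int2[of n] by (simp add: G_def)
  moreover have "form s p z \<omega> = (\<integral>w. pphi p (d w) * G0 w \<partial>mu s p) + (\<integral>w. F w * G0 w \<partial>mu s p)"
    unfolding form_def split_0 using int10 int20 by (simp add: G0_def)
  ultimately show "(\<lambda>n. form s p z (g n)) \<longlonglongrightarrow> form s p z \<omega>"
    using tendsto_add[OF lim1 lim2] by simp
qed

subsection \<open>Mollification\<close>

lemma integrable_lborel_translate:
  fixes f :: "'a::euclidean_space \<Rightarrow> real"
  assumes "integrable lborel f"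
  shows "integrable lborel (\<lambda>x. f (x + c))"
  using assms by (subst (asm) lborel_distr_plus[of c, symmetric], subst (asm) integrable_distr_eq)
    (auto simp: add.commute dest: borel_measurable_integrable)

lemma integral_lborel_translate:
  fixes f :: "'a::euclidean_space \<Rightarrow> real"
  assumes "borel_fun f"
  shows "(\<integral>x. f (x + c) \<partial>lborel) = (\<integral>x. f x \<partial>lborel)"
  using assms by (subst (2) lborel_distr_plus[of c, symmetric], subst integral_distr) (auto simp: add.commute)

definition translation_continuous :: "('a::euclidean_space \<Rightarrow> real) \<Rightarrow> bool" where
  "translation_continuous f \<longleftrightarrow>
     (\<forall>z. z \<longlonglongrightarrow> 0 \<longrightarrow> (\<lambda>n::nat. \<integral>x. \<bar>f (x + z n) - f x\<bar> \<partial>lborel) \<longlonglongrightarrow> 0)"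

text \<open>The error \<open>f - g\<close> has the same L^1 norm before and after the shift, so two
  of the three thirds of \<open>e\<close> are independent of the shift.\<close>

lemma translation_continuous_approx:
  fixes f :: "'a::euclidean_space \<Rightarrow> real"
  assumes f: "integrable lborel f"
    and approx: "\<And>e. 0 < e \<Longrightarrow> \<exists>g. integrable lborel g \<and> translation_continuous g \<and> (\<integral>x. \<bar>f x - g x\<bar> \<partial>lborel) \<le> e"
  shows "translation_continuous f"
  unfolding translation_continuous_def
proof (intro allI impI LIMSEQ_I)
  fix z :: "nat \<Rightarrow> 'a" and e :: real
  assume z: "z \<longlonglongrightarrow> 0" and e: "0 < e"
  obtain g where g: "integrable lborel g" "translation_continuous g" "(\<integral>x. \<bar>f x - g x\<bar> \<partial>lborel) \<le> e / 3"
    using approx[of "e / 3"] e by auto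
  have [measurable]: "borel_fun f" "borel_fun g"
    using f g(1) borel_measurable_integrable by auto
  have *: "(\<integral>x. \<bar>f (x + c) - f x\<bar> \<partial>lborel) \<le> 2 * (e / 3) + (\<integral>x. \<bar>g (x + c) - g x\<bar> \<partial>lborel)" for c
  proof -
    have i: "integrable lborel (\<lambda>x. f (x + c))" "integrable lborel (\<lambda>x. g (x + c))"
      using f g integrable_lborel_translate by auto
    have "(\<integral>x. \<bar>f (x + c) - f x\<bar> \<partial>lborel)
        \<le> (\<integral>x. \<bar>f (x + c) - g (x + c)\<bar> + \<bar>f x - g x\<bar> + \<bar>g (x + c) - g x\<bar> \<partial>lborel)"
      using i f g by (intro integral_mono) auto
    also have "\<dots> = (\<integral>x. \<bar>f (x + c) - g (x + c)\<bar> \<partial>lborel) + (\<integral>x. \<bar>f x - g x\<bar> \<partial>lborel)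
        + (\<integral>x. \<bar>g (x + c) - g x\<bar> \<partial>lborel)"
      using i f g by simp
    also have "(\<integral>x. \<bar>f (x + c) - g (x + c)\<bar> \<partial>lborel) = (\<integral>x. \<bar>f x - g x\<bar> \<partial>lborel)"
      by (rule integral_lborel_translate[where f = "\<lambda>x. \<bar>f x - g x\<bar>"]) measurable
    finally show ?thesis using g(3) by linarith
  qed
  have "\<forall>\<^sub>F n in sequentially. (\<integral>x. \<bar>g (x + z n) - g x\<bar> \<partial>lborel) < e / 3"
    using g(2) z e unfolding translation_continuous_def by (intro order_tendstoD) auto
  then obtain N where N: "(\<integral>x. \<bar>g (x + z n) - g x\<bar> \<partial>lborel) < e / 3" if "n \<ge> N" for n
    by (auto simp: eventually_sequentially)
  show "\<exists>n0. \<forall>n\<ge>n0. norm ((\<integral>x. \<bar>f (x + z n) - f x\<bar> \<partial>lborel) - 0) < e"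
  proof (intro exI allI impI)
    fix n assume "N \<le> n"
    moreover have "0 \<le> (\<integral>x. \<bar>f (x + z n) - f x\<bar> \<partial>lborel)" by simp
    ultimately show "norm ((\<integral>x. \<bar>f (x + z n) - f x\<bar> \<partial>lborel) - 0) < e"
      using *[of "z n"] N[of n] by simp
  qed
qed

text \<open>A Scheffe argument: by openness the positive part of \<open>I x - I (x + z n)\<close>
  tends to 0 pointwise, and \<open>I\<close> dominates it. Translation preserves the integral of
  \<open>I\<close>, so the negative part has the same integral.\<close>

lemma translation_continuous_open:
  fixes G :: "'a::euclidean_space set"
  assumes G: "open G" "emeasure lborel G < \<infinity>"
  shows "translation_continuous (indicator G :: 'a \<Rightarrow> real)"
  unfolding translation_continuous_def
proof (intro allI impI)
  fix z :: "nat \<Rightarrow> 'a" assume z: "z \<longlonglongrightarrow> 0"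
  have [measurable]: "G \<in> sets borel" using G by simp
  define I where "I = (indicator G :: 'a \<Rightarrow> real)"
  have I: "integrable lborel I" unfolding I_def using G by simp
  have [measurable]: "borel_fun I" unfolding I_def by measurable
  define r where "r n x = max 0 (I x - I (x + z n))" for n x
  have "(\<lambda>n. \<integral>x. r n x \<partial>lborel) \<longlonglongrightarrow> (\<integral>x. (0::real) \<partial>(lborel :: 'a measure))"
  proof (rule integral_dominated_convergence[OF _ _ I])
    show "AE x in lborel. (\<lambda>n. r n x) \<longlonglongrightarrow> 0"
    proof (rule AE_I2)
      fix x
      show "(\<lambda>n. r n x) \<longlonglongrightarrow> 0"
      proof (cases "x \<in> G")
        case True
        have "(\<lambda>n. x + z n) \<longlonglongrightarrow> x" using tendsto_add[OF tendsto_const z, of x] by simp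
        then have "\<forall>\<^sub>F n in sequentially. x + z n \<in> G" by (rule topological_tendstoD[OF _ G(1) True])
        then have "\<forall>\<^sub>F n in sequentially. r n x = 0"
          by eventually_elim (auto simp: r_def I_def True)
        then show ?thesis by (rule tendsto_eventually)
      next
        case False
        then have "r n x = 0" for n by (simp add: r_def I_def)
        then show ?thesis by simp
      qed
    qed
    show "AE x in lborel. norm (r n x) \<le> I x" for n
      by (rule AE_I2) (auto simp: r_def I_def split: split_indicator)
  qed (auto simp: r_def)
  moreover have "(\<integral>x. \<bar>I (x + z n) - I x\<bar> \<partial>lborel) = 2 * (\<integral>x. r n x \<partial>lborel)" for n
  proof -
    have i: "integrable lborel (\<lambda>x. I (x + z n))" using I integrable_lborel_translate by auto
    have ri: "integrable lborel (r n)" unfolding r_def using i I by auto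
    have "(\<integral>x. \<bar>I (x + z n) - I x\<bar> \<partial>lborel) = (\<integral>x. (I (x + z n) - I x) + 2 * r n x \<partial>lborel)"
      by (intro Bochner_Integration.integral_cong) (auto simp: r_def max_def abs_if)
    also have "\<dots> = (\<integral>x. I (x + z n) \<partial>lborel) - (\<integral>x. I x \<partial>lborel) + 2 * (\<integral>x. r n x \<partial>lborel)"
      using i I ri by simp
    also have "(\<integral>x. I (x + z n) \<partial>lborel) = (\<integral>x. I x \<partial>lborel)"
      by (rule integral_lborel_translate) measurable
    finally show ?thesis by simp
  qed
  ultimately show "(\<lambda>n. \<integral>x. \<bar>I (x + z n) - I x\<bar> \<partial>lborel) \<longlonglongrightarrow> 0"
    using tendsto_mult_left[of _ 0 sequentially 2] by simp
qed

lemma translation_continuous_add: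
  fixes f g :: "'a::euclidean_space \<Rightarrow> real"
  assumes f: "integrable lborel f" "translation_continuous f"
    and g: "integrable lborel g" "translation_continuous g"
  shows "translation_continuous (\<lambda>x. f x + g x)"
  unfolding translation_continuous_def
proof (intro allI impI)
  fix z :: "nat \<Rightarrow> 'a" assume z: "z \<longlonglongrightarrow> 0"
  have i: "integrable lborel (\<lambda>x. f (x + c))" "integrable lborel (\<lambda>x. g (x + c))" for c
    using f g integrable_lborel_translate by auto
  have "(\<lambda>n. (\<integral>x. \<bar>f (x + z n) - f x\<bar> \<partial>lborel) + (\<integral>x. \<bar>g (x + z n) - g x\<bar> \<partial>lborel)) \<longlonglongrightarrow> 0 + 0"
    using f g z unfolding translation_continuous_def by (intro tendsto_add) auto
  then have "(\<lambda>n. (\<integral>x. \<bar>f (x + z n) - f x\<bar> \<partial>lborel) + (\<integral>x. \<bar>g (x + z n) - g x\<bar> \<partial>lborel)) \<longlonglongrightarrow> 0" by simp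
  then show "(\<lambda>n. \<integral>x. \<bar>f (x + z n) + g (x + z n) - (f x + g x)\<bar> \<partial>lborel) \<longlonglongrightarrow> 0"
  proof (rule Lim_null_comparison[rotated], intro always_eventually allI)
    fix n
    have "(\<integral>x. \<bar>f (x + z n) + g (x + z n) - (f x + g x)\<bar> \<partial>lborel)
        \<le> (\<integral>x. \<bar>f (x + z n) - f x\<bar> + \<bar>g (x + z n) - g x\<bar> \<partial>lborel)"
      using f g i by (intro integral_mono) auto
    then show "norm (\<integral>x. \<bar>f (x + z n) + g (x + z n) - (f x + g x)\<bar> \<partial>lborel)
        \<le> (\<integral>x. \<bar>f (x + z n) - f x\<bar> \<partial>lborel) + (\<integral>x. \<bar>g (x + z n) - g x\<bar> \<partial>lborel)"
      using f g i by simp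
  qed
qed

lemma translation_continuous_mult_right:
  "translation_continuous f \<Longrightarrow> translation_continuous (\<lambda>x. f x * c)"
  unfolding translation_continuous_def
proof (intro allI impI)
  fix z :: "nat \<Rightarrow> 'a"
  assume "\<forall>z. z \<longlonglongrightarrow> 0 \<longrightarrow> (\<lambda>n. \<integral>x. \<bar>f (x + z n) - f x\<bar> \<partial>lborel) \<longlonglongrightarrow> 0" "z \<longlonglongrightarrow> 0"
  then have "(\<lambda>n. (\<integral>x. \<bar>f (x + z n) - f x\<bar> \<partial>lborel) * \<bar>c\<bar>) \<longlonglongrightarrow> 0"
    by (intro tendsto_mult_left_zero) auto
  then show "(\<lambda>n. \<integral>x. \<bar>f (x + z n) * c - f x * c\<bar> \<partial>lborel) \<longlonglongrightarrow> 0"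
    by (simp add: abs_mult flip: left_diff_distrib)
qed

text \<open>Induction over integrable functions: outer regularity reduces indicators to open sets,
  and limits are handled by approximation in L^1.\<close>

lemma translation_continuous_integrable:
  fixes f :: "'a::euclidean_space \<Rightarrow> real"
  assumes "integrable lborel f"
  shows "translation_continuous f"
  using assms
proof (induction rule: integrable_induct)
  case (base A c)
  have [measurable]: "A \<in> sets borel" using base by simp
  have "translation_continuous (indicator A :: 'a \<Rightarrow> real)"
  proof (rule translation_continuous_approx)
    show "integrable lborel (indicator A :: 'a \<Rightarrow> real)" using base by simp
    fix e :: real assume e: "0 < e"
    obtain U where U: "open U" "A \<subseteq> U" "emeasure lborel (U - A) < ennreal e"
      using outer_regular_lborel[of A e] base e by auto
    have [measurable]: "U \<in> sets borel" using U by simp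
    have "emeasure lborel U = emeasure lborel A + emeasure lborel (U - A)"
      using U(2) by (subst plus_emeasure) (auto simp: Un_absorb1)
    also have "\<dots> < \<infinity>" using base U(3) by (simp add: less_trans[OF U(3)])
    finally have Ufin: "emeasure lborel U < \<infinity>" .
    have "(\<integral>x. \<bar>indicator A x - indicator U x\<bar> \<partial>lborel) = (\<integral>x. indicator (U - A) x \<partial>(lborel :: 'a measure) :: real)"
      using U(2) by (intro Bochner_Integration.integral_cong) (auto split: split_indicator)
    also have "\<dots> = measure lborel (U - A)" by simp
    also have "\<dots> \<le> e" using U(3) e unfolding measure_def by (intro enn2real_leI) auto
    finally show "\<exists>g. integrable lborel g \<and> translation_continuous g \<and> (\<integral>x. \<bar>indicator A x - g x\<bar> \<partial>lborel) \<le> e"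
      using Ufin U translation_continuous_open by (intro exI[of _ "indicator U"]) auto
  qed
  then show ?case by (simp add: translation_continuous_mult_right)
next
  case (add f g)
  then show ?case by (intro translation_continuous_add)
next
  case (lim f s)
  have [measurable]: "borel_fun f" "\<And>i. s i \<in> borel_measurable borel"
    using lim by (auto dest!: borel_measurable_integrable)
  show ?case
  proof (rule translation_continuous_approx[OF \<open>integrable lborel f\<close>])
    fix e :: real assume e: "0 < e"
    have "(\<lambda>i. \<integral>x. \<bar>f x - s i x\<bar> \<partial>lborel) \<longlonglongrightarrow> (\<integral>x. 0 \<partial>(lborel :: 'a measure))"
    proof (rule integral_dominated_convergence)
      show "integrable lborel (\<lambda>x. 3 * \<bar>f x\<bar>)" using lim by simp
      show "AE x in lborel. (\<lambda>i. \<bar>f x - s i x\<bar>) \<longlonglongrightarrow> 0"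
        using lim by (intro AE_I2 tendsto_rabs_zero) (auto intro!: tendsto_eq_intros)
      show "AE x in lborel. norm \<bar>f x - s i x\<bar> \<le> 3 * \<bar>f x\<bar>" for i
      proof (rule AE_I2)
        fix x
        have "norm (s i x) \<le> 2 * norm (f x)" using lim by simp
        then show "norm \<bar>f x - s i x\<bar> \<le> 3 * \<bar>f x\<bar>" by simp
      qed
    qed auto
    then have "\<forall>\<^sub>F i in sequentially. (\<integral>x. \<bar>f x - s i x\<bar> \<partial>lborel) < e"
      using e by (intro order_tendstoD) auto
    then obtain i where "(\<integral>x. \<bar>f x - s i x\<bar> \<partial>lborel) < e"
      using eventually_sequentially by auto
    then show "\<exists>g. integrable lborel g \<and> translation_continuous g \<and> (\<integral>x. \<bar>f x - g x\<bar> \<partial>lborel) \<le> e"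
      using lim by (intro exI[of _ "s i"]) auto
  qed
qed

section \<open>Calculus for \<open>Ck\<close> and a smooth bump\<close>

lemma Ck_SucI:
  assumes "\<And>x. (g has_derivative g' x) (at x)" "\<And>d. Ck k (\<lambda>x. g' x d)"
  shows "Ck (Suc k) g"
proof -
  have "frechet_derivative g (at x) = g' x" for x
    using assms(1) frechet_derivative_at by metis
  then show ?thesis
    using assms by (auto simp: differentiable_on_def differentiable_def)
qed

lemma Ck_Suc_has_derivative:
  assumes "Ck (Suc k) g"
  shows "(g has_derivative frechet_derivative g (at x)) (at x)"
  using assms by (simp add: differentiable_on_def frechet_derivative_works)

lemma Ck_mono: "Ck (Suc k) g \<Longrightarrow> Ck k g"
proof (induction k arbitrary: g)
  case 0
  then show ?case by (simp add: differentiable_imp_continuous_on)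
next
  case (Suc k)
  from Suc.prems have "g differentiable_on UNIV" "\<And>d. Ck (Suc k) (\<lambda>x. frechet_derivative g (at x) d)"
    by auto
  then show ?case using Suc.IH by simp
qed

lemma Ck_continuous: "Ck k g \<Longrightarrow> continuous_on UNIV g"
  by (cases k) (auto intro: differentiable_imp_continuous_on)

lemma Ck_const: "Ck k (\<lambda>x. c)"
proof (induction k arbitrary: c)
  case (Suc k)
  show ?case by (rule Ck_SucI[where g' = "\<lambda>x d. 0"]) (auto intro: Suc)
qed simp

lemma Ck_inner: "Ck k (\<lambda>x. x \<bullet> a)"
proof (cases k)
  case (Suc k')
  show ?thesis unfolding Suc
    by (rule Ck_SucI[where g' = "\<lambda>x d. d \<bullet> a"]) (auto intro: Ck_const derivative_eq_intros)
qed (simp add: continuous_intros)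

lemma Ck_add: "Ck k f \<Longrightarrow> Ck k g \<Longrightarrow> Ck k (\<lambda>x. f x + g x)"
proof (induction k arbitrary: f g)
  case (Suc k)
  show ?case
  proof (rule Ck_SucI)
    show "((\<lambda>x. f x + g x) has_derivative
        (\<lambda>d. frechet_derivative f (at x) d + frechet_derivative g (at x) d)) (at x)" for x
      by (intro has_derivative_add Ck_Suc_has_derivative[OF Suc.prems(1)] Ck_Suc_has_derivative[OF Suc.prems(2)])
    show "Ck k (\<lambda>x. frechet_derivative f (at x) d + frechet_derivative g (at x) d)" for d
      using Suc by simp
  qed
qed (simp add: continuous_on_add)

lemma Ck_mult: "Ck k f \<Longrightarrow> Ck k g \<Longrightarrow> Ck k (\<lambda>x. f x * g x)"
proof (induction k arbitrary: f g)
  case (Suc k)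
  show ?case
  proof (rule Ck_SucI)
    show "((\<lambda>x. f x * g x) has_derivative
        (\<lambda>d. f x * frechet_derivative g (at x) d + frechet_derivative f (at x) d * g x)) (at x)" for x
      by (intro has_derivative_mult Ck_Suc_has_derivative[OF Suc.prems(1)] Ck_Suc_has_derivative[OF Suc.prems(2)])
    show "Ck k (\<lambda>x. f x * frechet_derivative g (at x) d + frechet_derivative f (at x) d * g x)" for d
      using Suc.prems by (intro Ck_add Suc.IH Ck_mono[OF Suc.prems(1)] Ck_mono[OF Suc.prems(2)]) auto
  qed
qed (simp add: continuous_on_mult)

text \<open>The classical flat function exp(-1/t), with powers of 1/t attached so that the linear
  span of the family is closed under differentiation.\<close>

definition flat :: "nat \<Rightarrow> real \<Rightarrow> real" where
  "flat n t = (if 0 < t then (1 / t) ^ n * exp (- (1 / t)) else 0)"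

lemma flat_nonneg: "0 \<le> flat n t" by (simp add: flat_def)

text \<open>The term of order n + 2 of the exponential series at u = 1/t gives u^(n+2)
  \<open>\<le>\<close> (n+2)! e^u. Quadratic decay makes the difference quotient at 0 vanish in the
  limit.\<close>

lemma flat_le: "flat n t \<le> fact (n + 2) * t\<^sup>2"
proof (cases "0 < t")
  case True
  define u where "u = 1 / t"
  have u: "0 < u" using True by (simp add: u_def)
  have "(\<Sum>i<Suc (n + 2). u ^ i / fact i) \<le> exp u"
    using u sum_le_suminf[OF summable_exp[of u], of "{..<Suc (n + 2)}"] by (simp add: exp_def divide_inverse mult.commute)
  moreover have "u ^ (n + 2) / fact (n + 2) \<le> (\<Sum>i<Suc (n + 2). u ^ i / fact i)"
    using u by (intro member_le_sum) auto
  ultimately have "u ^ (n + 2) / fact (n + 2) \<le> exp u" by (rule order_trans[rotated])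
  then have "u ^ (n + 2) \<le> fact (n + 2) * exp u"
    by (metis fact_gt_zero mult.commute pos_divide_le_eq)
  then have "u ^ (n + 2) * exp (- u) \<le> fact (n + 2) * exp u * exp (- u)"
    by (rule mult_right_mono) simp
  then have "u ^ n * u\<^sup>2 * exp (- u) \<le> fact (n + 2)"
    unfolding mult.assoc exp_minus_inverse by (simp add: power_add power2_eq_square mult_ac del: fact_Suc)
  then have "u ^ n * exp (- u) \<le> fact (n + 2) * (1 / u)\<^sup>2"
    using u by (simp add: field_simps)
  then show ?thesis using True by (simp add: flat_def u_def)
qed (simp add: flat_def)

lemma flat_has_derivative:
  "(flat n has_real_derivative (flat (n + 2) t - n * flat (n + 1) t)) (at t)"
proof -
  consider "0 < t" | "t < 0" | "t = 0" by linarith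
  then show ?thesis
  proof cases
    case 1
    have "((\<lambda>t. (1 / t) ^ n * exp (- (1 / t))) has_real_derivative (flat (n + 2) t - n * flat (n + 1) t)) (at t)"
    proof -
      have "((\<lambda>t. (1 / t) ^ n * exp (- (1 / t))) has_real_derivative
        (1 / t) ^ n * (exp (- (1 / t)) * (1 / t\<^sup>2)) + (of_nat n * (1 / t) ^ (n - 1) * (- 1 / t\<^sup>2)) * exp (- (1 / t))) (at t)"
        using 1 by (auto intro!: derivative_eq_intros simp: power2_eq_square)
      moreover have "of_nat n * (1 / t) ^ (n - 1) * (- 1 / t\<^sup>2) = - (of_nat n * (1 / t) ^ (n + 1))"
        using 1 by (cases n) (auto simp: power2_eq_square field_simps)
      moreover have "(1 / t) ^ n * (exp (- (1 / t)) * (1 / t\<^sup>2)) + - (of_nat n * (1 / t) ^ (n + 1)) * exp (- (1 / t))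
          = flat (n + 2) t - n * flat (n + 1) t"
        using 1 by (simp add: flat_def power_add power_divide power2_eq_square)
      ultimately show ?thesis by (simp only:)
    qed
    then show ?thesis
      by (rule has_field_derivative_transform_within_open[where S = "{0<..}"])
        (use 1 in \<open>auto simp: flat_def\<close>)
  next
    case 2
    have "((\<lambda>t. 0) has_real_derivative 0) (at t)" by simp
    then have "(flat n has_real_derivative 0) (at t)"
      by (rule has_field_derivative_transform_within_open[where S = "{..<0}"])
        (use 2 in \<open>auto simp: flat_def\<close>)
    then show ?thesis using 2 by (simp add: flat_def)
  next
    case 3
    have "((\<lambda>h. fact (n + 2) * \<bar>h\<bar>) \<longlongrightarrow> fact (n + 2) * \<bar>0\<bar>) (at (0::real))"
      by (intro tendsto_intros)
    then have lim: "((\<lambda>h. fact (n + 2) * \<bar>h\<bar>) \<longlongrightarrow> 0) (at (0::real))" by simp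
    have "\<bar>flat n h / h\<bar> \<le> fact (n + 2) * \<bar>h\<bar>" if "h \<noteq> 0" for h
    proof -
      have "\<bar>flat n h / h\<bar> = flat n h / \<bar>h\<bar>" using flat_nonneg[of n h] by simp
      also have "\<dots> \<le> fact (n + 2) * h\<^sup>2 / \<bar>h\<bar>" by (intro divide_right_mono flat_le) simp
      also have "\<dots> = fact (n + 2) * \<bar>h\<bar>" using that by (simp add: power2_eq_square abs_if)
      finally show ?thesis .
    qed
    then have "\<forall>\<^sub>F h in at 0. norm ((flat n (0 + h) - flat n 0) / h) \<le> fact (n + 2) * \<bar>h\<bar>"
      by (auto simp: eventually_at_filter flat_def)
    from Lim_null_comparison[OF this lim]
    have "((\<lambda>h. (flat n (0 + h) - flat n 0) / h) \<longlongrightarrow> 0) (at 0)" .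
    then show ?thesis using 3 by (simp add: DERIV_def flat_def)
  qed
qed

text \<open>The induction covers all \<open>n\<close> at once, since the derivative involves
  \<open>n + 1\<close> and \<open>n + 2\<close>. The inner function is a quadratic polynomial, hence
  smooth also at the origin.\<close>

lemma Ck_flat: "Ck k (\<lambda>x :: 'a::euclidean_space. flat n (r - x \<bullet> x))"
proof (induction k arbitrary: n)
  case 0
  have "isCont (flat n) t" for t using flat_has_derivative[of n t] by (rule DERIV_isCont)
  then have "continuous_on UNIV (flat n)" by (simp add: continuous_at_imp_continuous_on)
  then show ?case
    by (auto intro!: continuous_on_compose2[of UNIV "flat n"] continuous_intros)
next
  case (Suc k)
  show ?case
  proof (rule Ck_SucI)
    fix x :: 'a
    have "((\<lambda>x. r - x \<bullet> x) has_derivative (\<lambda>d. - 2 * (x \<bullet> d))) (at x)"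
      by (auto intro!: derivative_eq_intros simp: inner_commute)
    from DERIV_compose_FDERIV[OF flat_has_derivative this]
    show "((\<lambda>x. flat n (r - x \<bullet> x)) has_derivative
      (\<lambda>d. (- 2 * (x \<bullet> d)) * (flat (n + 2) (r - x \<bullet> x) + (- real n) * flat (n + 1) (r - x \<bullet> x)))) (at x)"
      by simp
  next
    fix d :: 'a
    show "Ck k (\<lambda>x. (- 2 * (x \<bullet> d)) * (flat (n + 2) (r - x \<bullet> x) + (- real n) * flat (n + 1) (r - x \<bullet> x)))"
      by (intro Ck_mult Ck_add Ck_const Ck_inner Suc)
  qed
qed

section \<open>Convolution with a mollifier\<close>

definition conv :: "('a::euclidean_space \<Rightarrow> real) \<Rightarrow> ('a \<Rightarrow> real) \<Rightarrow> 'a \<Rightarrow> real" where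
  "conv \<eta> \<omega> x = (\<integral>y. \<eta> (x - y) * \<omega> y \<partial>lborel)"

lemma uniformly_continuous_compact_support:
  fixes g :: "'a::euclidean_space \<Rightarrow> 'b::real_normed_vector"
  assumes g: "continuous_on UNIV g" and supp: "\<And>x. R < norm x \<Longrightarrow> g x = 0" and e: "0 < e"
  obtains \<delta> where "0 < \<delta>" "\<And>x y. norm (y - x) < \<delta> \<Longrightarrow> norm (g y - g x) < e"
proof -
  have "uniformly_continuous_on (cball 0 (R + 1)) g"
    using g by (intro compact_uniformly_continuous continuous_on_subset[OF g]) auto
  then obtain \<delta> where \<delta>: "0 < \<delta>"
    "\<And>x y. x \<in> cball 0 (R + 1) \<Longrightarrow> y \<in> cball 0 (R + 1) \<Longrightarrow> dist y x < \<delta> \<Longrightarrow> dist (g y) (g x) < e"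
    using e unfolding uniformly_continuous_on_def by metis
  show ?thesis
  proof
    show "0 < min \<delta> 1" using \<delta> by simp
    fix x y :: 'a assume xy: "norm (y - x) < min \<delta> 1"
    have "\<bar>norm y - norm x\<bar> \<le> norm (y - x)" by (rule norm_triangle_ineq3)
    \<comment> \<open>The margin 1 in the radius: two points closer than 1 lie both in the larger
      ball or both off the support.\<close>
    then consider "norm x \<le> R + 1" "norm y \<le> R + 1" | "R < norm x" "R < norm y"
      using xy by linarith
    then show "norm (g y - g x) < e"
    proof cases
      case 1
      then show ?thesis using \<delta>(2)[of x y] xy by (simp add: dist_norm)
    qed (use supp e in auto)
  qed
qed

lemma bounded_compact_support:
  fixes g :: "'a::euclidean_space \<Rightarrow> 'b::real_normed_vector"
  assumes "continuous_on UNIV g" and "\<And>x. R < norm x \<Longrightarrow> g x = 0"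
  obtains B where "0 \<le> B" "\<And>x. norm (g x) \<le> B"
proof -
  have "compact (g ` cball 0 R)"
    using assms(1) by (intro compact_continuous_image continuous_on_subset[OF assms(1)]) auto
  then obtain B where "\<forall>x\<in>cball 0 R. norm (g x) \<le> B"
    by (auto dest!: compact_imp_bounded simp: bounded_iff)
  then have B: "norm (g x) \<le> B" if "norm x \<le> R" for x using that by simp
  show ?thesis
  proof
    show "0 \<le> max B 0" by simp
    show "norm (g x) \<le> max B 0" for x
      using B[of x] assms(2)[of x] by (cases "norm x \<le> R") auto
  qed
qed

lemma integrable_conv:
  fixes \<eta> \<omega> :: "'a::euclidean_space \<Rightarrow> real"
  assumes "continuous_on UNIV \<eta>" and "\<And>x. R < norm x \<Longrightarrow> \<eta> x = 0" and "integrable lborel \<omega>"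
  shows "integrable lborel (\<lambda>y. \<eta> (x - y) * \<omega> y)"
proof -
  obtain B where B: "0 \<le> B" "\<And>x. norm (\<eta> x) \<le> B" using bounded_compact_support[OF assms(1,2)] by blast
  have [measurable]: "borel_fun \<eta>" using assms(1) by (rule borel_measurable_continuous_onI)
  have [measurable]: "borel_fun \<omega>" using assms(3) by (auto dest: borel_measurable_integrable)
  show ?thesis
  proof (rule integrable_dominated)
    show "integrable lborel (\<lambda>y. B * \<bar>\<omega> y\<bar>)" using assms(3) by simp
    show "\<bar>\<eta> (x - y) * \<omega> y\<bar> \<le> B * \<bar>\<omega> y\<bar>" for y
      using B(2)[of "x - y"] by (simp add: abs_mult mult_right_mono)
  qed measurable
qed

lemma frechet_derivative_eq_0:
  fixes \<eta> :: "'a::euclidean_space \<Rightarrow> real"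
  assumes "\<And>x. R < norm x \<Longrightarrow> \<eta> x = 0" "R < norm x"
  shows "frechet_derivative \<eta> (at x) d = 0"
proof -
  have "((\<lambda>x. 0) has_derivative (\<lambda>d. 0)) (at x)" by simp
  then have "(\<eta> has_derivative (\<lambda>d. 0)) (at x)"
  proof (rule has_derivative_transform_within_open)
    show "open {x :: 'a. R < norm x}" by (intro open_Collect_less continuous_intros)
  qed (use assms in auto)
  then show ?thesis using frechet_derivative_at[of \<eta> "\<lambda>d. 0" x] by metis
qed

text \<open>The gradient \<open>G\<close> is uniformly continuous, so the linearization error of
  \<open>\<eta>\<close> is at most \<open>e' * norm h\<close> uniformly in the base point;
  integrating it against the modulus of \<open>\<omega>\<close> differentiates the
  convolution.\<close>

lemma conv_has_derivative:
  fixes \<eta> \<omega> :: "'a::euclidean_space \<Rightarrow> real"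
  assumes \<eta>: "Ck (Suc 0) \<eta>" and supp: "\<And>x. R < norm x \<Longrightarrow> \<eta> x = 0" and \<omega>: "integrable lborel \<omega>"
  shows "(conv \<eta> \<omega> has_derivative (\<lambda>d. conv (\<lambda>x. frechet_derivative \<eta> (at x) d) \<omega> x)) (at x)"
proof -
  define D where "D d x = frechet_derivative \<eta> (at x) d" for d x
  define G where "G x = (\<Sum>b\<in>Basis. D b x *\<^sub>R b)" for x :: 'a
  have der: "(\<eta> has_derivative (\<lambda>d. D d x)) (at x)" for x
    using Ck_Suc_has_derivative[OF \<eta>] by (simp add: D_def[abs_def])
  have Dcont: "continuous_on UNIV (D d)" for d using \<eta> by (simp add: D_def[abs_def])
  have D0: "D d x = 0" if "R < norm x" for d x
    unfolding D_def using frechet_derivative_eq_0[of R \<eta> x d] supp that by blast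
  have Dlin: "linear (\<lambda>d. D d x)" for x using der has_derivative_linear by blast
  have DG: "D d x = G x \<bullet> d" for d x
  proof -
    have "D d x = D (\<Sum>b\<in>Basis. (d \<bullet> b) *\<^sub>R b) x" by (simp add: euclidean_representation)
    also have "\<dots> = (\<Sum>b\<in>Basis. (d \<bullet> b) * D b x)"
      unfolding linear_sum[OF Dlin] linear_scale[OF Dlin] by simp
    also have "\<dots> = G x \<bullet> d"
      unfolding G_def inner_sum_left inner_scaleR_left by (simp add: inner_commute mult.commute)
    finally show ?thesis .
  qed
  have Gcont: "continuous_on UNIV G" unfolding G_def[abs_def] by (intro continuous_intros Dcont)
  have G0: "G x = 0" if "R < norm x" for x using D0[OF that] by (simp add: G_def)
  have \<eta>cont: "continuous_on UNIV \<eta>" using \<eta> by (rule Ck_continuous)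
  have Dint: "integrable lborel (\<lambda>y. D d (x - y) * \<omega> y)" for d x
    by (rule integrable_conv[OF Dcont D0 \<omega>])
  have \<eta>int: "integrable lborel (\<lambda>y. \<eta> (x - y) * \<omega> y)" for x
    by (rule integrable_conv[OF \<eta>cont supp \<omega>])
  have "linear (\<lambda>d. conv (D d) \<omega> x)"
  proof (rule linearI)
    fix c d :: 'a and r :: real
    show "conv (D (c + d)) \<omega> x = conv (D c) \<omega> x + conv (D d) \<omega> x"
      unfolding conv_def linear_add[OF Dlin] using Dint by (simp add: distrib_right)
    show "conv (D (r *\<^sub>R d)) \<omega> x = r *\<^sub>R conv (D d) \<omega> x"
      unfolding conv_def linear_scale[OF Dlin] by (simp add: mult.assoc)
  qed
  then have lin: "bounded_linear (\<lambda>d. conv (D d) \<omega> x)" by (simp add: linear_conv_bounded_linear)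
  have "\<exists>d>0. \<forall>y. norm (y - x) < d \<longrightarrow>
       norm (conv \<eta> \<omega> y - conv \<eta> \<omega> x - conv (D (y - x)) \<omega> x) \<le> e * norm (y - x)" if e: "0 < e" for e
  proof -
    define I where "I = (\<integral>y. \<bar>\<omega> y\<bar> \<partial>lborel)"
    have I: "0 \<le> I" by (simp add: I_def)
    define e' where "e' = e / (I + 1)"
    have e': "0 < e'" "e' * I \<le> e" using e I by (auto simp: e'_def field_simps)
    obtain \<delta> where \<delta>: "0 < \<delta>" "\<And>x y. norm (y - x) < \<delta> \<Longrightarrow> norm (G y - G x) < e'"
      using uniformly_continuous_compact_support[OF Gcont G0 e'(1)] by metis
    \<comment> \<open>Mean value inequality for \<open>\<eta>\<close> minus its linear part at
      \<open>a\<close>; on the ball the derivative of the difference has norm at most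
      \<open>e'\<close>.\<close>
    have lin_approx: "\<bar>\<eta> (a + h) - \<eta> a - D h a\<bar> \<le> e' * norm h" if h: "norm h < \<delta>" for a h
    proof -
      have "norm ((\<eta> (a + h) - G a \<bullet> (a + h)) - (\<eta> a - G a \<bullet> a)) \<le> e' * norm ((a + h) - a)"
      proof (rule differentiable_bound[where S = "ball a \<delta>" and f' = "\<lambda>x d. D d x - G a \<bullet> d"])
        fix z assume z: "z \<in> ball a \<delta>"
        show "((\<lambda>x. \<eta> x - G a \<bullet> x) has_derivative (\<lambda>d. D d z - G a \<bullet> d)) (at z within ball a \<delta>)"
          by (intro has_derivative_diff has_derivative_at_withinI[OF der] derivative_eq_intros) auto
        have "\<bar>D d z - G a \<bullet> d\<bar> \<le> e' * norm d" for d
        proof -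
          have "\<bar>D d z - G a \<bullet> d\<bar> = \<bar>(G z - G a) \<bullet> d\<bar>" by (simp add: DG inner_diff_left)
          also have "\<dots> \<le> norm (G z - G a) * norm d" by (rule Cauchy_Schwarz_ineq2)
          also have "\<dots> \<le> e' * norm d"
            using \<delta>(2)[of z a] z by (intro mult_right_mono) (auto simp: dist_norm norm_minus_commute)
          finally show ?thesis .
        qed
        then show "onorm (\<lambda>d. D d z - G a \<bullet> d) \<le> e'" by (intro onorm_le) simp
      qed (use h \<delta>(1) in \<open>auto simp: dist_norm\<close>)
      then show ?thesis by (simp add: DG inner_add_right algebra_simps)
    qed
    show ?thesis
    proof (intro exI conjI allI impI)
      fix y assume y: "norm (y - x) < \<delta>"
      have "conv \<eta> \<omega> y - conv \<eta> \<omega> x - conv (D (y - x)) \<omega> x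
          = (\<integral>z. (\<eta> (y - z) - \<eta> (x - z) - D (y - x) (x - z)) * \<omega> z \<partial>lborel)"
        unfolding conv_def using \<eta>int Dint by (simp add: left_diff_distrib)
      also have "norm \<dots> \<le> (\<integral>z. norm ((\<eta> (y - z) - \<eta> (x - z) - D (y - x) (x - z)) * \<omega> z) \<partial>lborel)"
        by (rule integral_norm_bound)
      also have "\<dots> \<le> (\<integral>z. (e' * norm (y - x)) * \<bar>\<omega> z\<bar> \<partial>lborel)"
      proof (rule integral_mono)
        show "integrable lborel (\<lambda>z. norm ((\<eta> (y - z) - \<eta> (x - z) - D (y - x) (x - z)) * \<omega> z))"
          using \<eta>int Dint by (intro integrable_norm) (simp add: left_diff_distrib)
        show "integrable lborel (\<lambda>z. (e' * norm (y - x)) * \<bar>\<omega> z\<bar>)" using \<omega> by simp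
        fix z
        have "\<bar>\<eta> (y - z) - \<eta> (x - z) - D (y - x) (x - z)\<bar> \<le> e' * norm (y - x)"
          using lin_approx[of "y - x" "x - z"] y by (simp add: algebra_simps)
        then show "norm ((\<eta> (y - z) - \<eta> (x - z) - D (y - x) (x - z)) * \<omega> z) \<le> (e' * norm (y - x)) * \<bar>\<omega> z\<bar>"
          unfolding real_norm_def abs_mult by (rule mult_right_mono) simp
      qed
      also have "\<dots> = e' * I * norm (y - x)" by (simp add: I_def)
      also have "\<dots> \<le> e * norm (y - x)" using e' by (intro mult_right_mono) auto
      finally show "norm (conv \<eta> \<omega> y - conv \<eta> \<omega> x - conv (D (y - x)) \<omega> x) \<le> e * norm (y - x)" .
    qed (use \<delta> in auto)
  qed
  then show ?thesis
    using lin unfolding has_derivative_at_alt D_def[abs_def] by simp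
qed

text \<open>Derivatives fall on \<open>\<eta>\<close>, whose directional derivatives are again
  smooth and vanish outside the same ball; the induction therefore generalizes over
  \<open>\<eta>\<close>.\<close>

lemma Ck_conv:
  fixes \<eta> \<omega> :: "'a::euclidean_space \<Rightarrow> real"
  assumes "smooth \<eta>" "\<And>x. R < norm x \<Longrightarrow> \<eta> x = 0" "integrable lborel \<omega>"
  shows "Ck k (conv \<eta> \<omega>)"
  using assms(1,2)
proof (induction k arbitrary: \<eta>)
  case 0
  have "Ck (Suc 0) \<eta>" using 0 unfolding smooth_def by blast
  from has_derivative_continuous[OF conv_has_derivative[OF this 0(2) assms(3)]]
  show ?case by (simp add: continuous_at_imp_continuous_on)
next
  case (Suc k)
  have "Ck (Suc 0) \<eta>" using Suc.prems unfolding smooth_def by blast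
  from conv_has_derivative[OF this Suc.prems(2) assms(3)]
  show ?case
  proof (rule Ck_SucI)
    fix d
    have "smooth (\<lambda>x. frechet_derivative \<eta> (at x) d)"
      using Suc.prems(1) unfolding smooth_def by (metis Ck.simps(2))
    then show "Ck k (\<lambda>x. conv (\<lambda>x. frechet_derivative \<eta> (at x) d) \<omega> x)"
      using Suc.IH[of "\<lambda>x. frechet_derivative \<eta> (at x) d"] frechet_derivative_eq_0[of R \<eta>] Suc.prems(2) by simp
  qed
qed

lemma integral_lborel_reflect:
  fixes f :: "'a::euclidean_space \<Rightarrow> real"
  assumes [measurable]: "borel_fun f"
  shows "(\<integral>y. f (x - y) \<partial>lborel) = (\<integral>y. f y \<partial>lborel)"
  by (subst (2) lborel_distr_reflect[of x, symmetric], subst integral_distr) auto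

lemma conv_reflect:
  fixes \<eta> \<omega> :: "'a::euclidean_space \<Rightarrow> real"
  assumes [measurable]: "borel_fun \<eta>" "borel_fun \<omega>"
  shows "conv \<eta> \<omega> x = (\<integral>z. \<eta> z * \<omega> (x - z) \<partial>lborel)"
  using integral_lborel_reflect[of "\<lambda>z. \<eta> z * \<omega> (x - z)" x] by (simp add: conv_def)

text \<open>The tangent inequality at the mean \<open>a\<close> is integrated against the
  probability density \<open>\<eta>\<close>; its linear term integrates to 0.\<close>

lemma jensen_powr:
  fixes \<eta> b :: "'a \<Rightarrow> real"
  assumes p: "1 < p" and \<eta>: "integrable M \<eta>" "\<And>z. 0 \<le> \<eta> z" "(\<integral>z. \<eta> z \<partial>M) = 1"
    and [measurable]: "b \<in> borel_measurable M" and B: "\<And>z. \<bar>b z\<bar> \<le> B"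
  shows "ennreal (\<bar>\<integral>z. \<eta> z * b z \<partial>M\<bar> powr p) \<le> (\<integral>\<^sup>+z. ennreal (\<eta> z * \<bar>b z\<bar> powr p) \<partial>M)"
proof -
  have [measurable]: "\<eta> \<in> borel_measurable M" using \<eta> by auto
  define a where "a = (\<integral>z. \<eta> z * b z \<partial>M)"
  have bi: "integrable M (\<lambda>z. \<eta> z * b z)"
    by (rule integrable_dominated[OF integrable_mult_right[OF \<eta>(1), of B]])
      (auto simp: abs_mult \<eta>(2) B mult.commute[of B] intro: mult_left_mono)
  have Bi: "integrable M (\<lambda>z. \<eta> z * \<bar>b z\<bar> powr p)"
  proof (rule integrable_dominated[OF integrable_mult_right[OF \<eta>(1), of "B powr p"]])
    fix z
    have "\<bar>b z\<bar> powr p \<le> B powr p" using p B by (intro powr_mono2) auto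
    then show "\<bar>\<eta> z * \<bar>b z\<bar> powr p\<bar> \<le> B powr p * \<eta> z"
      using \<eta>(2)[of z] by (simp add: abs_mult mult.commute[of _ "\<eta> z"] mult_left_mono)
  qed measurable
  have eq: "\<eta> z * (\<bar>a\<bar> powr p / p + pphi p a * (b z - a))
      = (\<bar>a\<bar> powr p / p - pphi p a * a) * \<eta> z + pphi p a * (\<eta> z * b z)" for z
    by (simp add: algebra_simps)
  have "(\<integral>z. \<eta> z * (\<bar>a\<bar> powr p / p + pphi p a * (b z - a)) \<partial>M) \<le> (\<integral>z. \<eta> z * (\<bar>b z\<bar> powr p / p) \<partial>M)"
  proof (rule integral_mono)
    show "integrable M (\<lambda>z. \<eta> z * (\<bar>a\<bar> powr p / p + pphi p a * (b z - a)))"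
      unfolding eq using bi \<eta>(1) by simp
    show "integrable M (\<lambda>z. \<eta> z * (\<bar>b z\<bar> powr p / p))" using Bi by simp
    show "\<eta> z * (\<bar>a\<bar> powr p / p + pphi p a * (b z - a)) \<le> \<eta> z * (\<bar>b z\<bar> powr p / p)" for z
      using \<eta>(2) p by (intro mult_left_mono pphi_tangent)
  qed
  also have "(\<integral>z. \<eta> z * (\<bar>a\<bar> powr p / p + pphi p a * (b z - a)) \<partial>M)
     = (\<integral>z. (\<bar>a\<bar> powr p / p - pphi p a * a) * \<eta> z + pphi p a * (\<eta> z * b z) \<partial>M)"
    unfolding eq ..
  also have "\<dots> = \<bar>a\<bar> powr p / p"
    using bi \<eta> by (simp add: a_def[symmetric])
  also have "(\<integral>z. \<eta> z * (\<bar>b z\<bar> powr p / p) \<partial>M) = (\<integral>z. \<eta> z * \<bar>b z\<bar> powr p \<partial>M) / p" by simp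
  finally have "\<bar>a\<bar> powr p \<le> (\<integral>z. \<eta> z * \<bar>b z\<bar> powr p \<partial>M)" using p by (simp add: divide_le_cancel)
  then show ?thesis
    using Bi \<eta>(2) by (simp add: a_def nn_integral_eq_integral ennreal_leI)
qed

text \<open>Shifts shorter than 1 / (n + 1) that violate the bound would form a null sequence
  contradicting the sequential definition.\<close>

lemma translation_continuous_uniform:
  fixes f :: "'a::euclidean_space \<Rightarrow> real"
  assumes "translation_continuous f" "0 < e"
  obtains d where "0 < d" "\<And>z. norm z < d \<Longrightarrow> (\<integral>x. \<bar>f (x + z) - f x\<bar> \<partial>lborel) < e"
proof (rule ccontr)
  assume "\<not> thesis"
  then have "\<exists>z. norm z < inverse (real (Suc n)) \<and> e \<le> (\<integral>x. \<bar>f (x + z) - f x\<bar> \<partial>lborel)" for n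
    using that[of "inverse (real (Suc n))"] by (metis inverse_positive_iff_positive not_le of_nat_0_less_iff zero_less_Suc)
  then obtain z where z: "\<And>n. norm (z n) < inverse (real (Suc n))"
    "\<And>n. e \<le> (\<integral>x. \<bar>f (x + z n) - f x\<bar> \<partial>lborel)" by metis
  have "z \<longlonglongrightarrow> 0"
    by (rule Lim_null_comparison[OF _ LIMSEQ_inverse_real_of_nat]) (rule always_eventually, use z(1) less_imp_le in blast)
  then have "(\<lambda>n. \<integral>x. \<bar>f (x + z n) - f x\<bar> \<partial>lborel) \<longlonglongrightarrow> 0"
    using assms(1) unfolding translation_continuous_def by blast
  from order_tendstoD(2)[OF this assms(2)] z(2) show False
    by (auto simp: eventually_sequentially not_less[symmetric])
qed

lemma nn_integral_lborel_mu_swap: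
  fixes h :: "'b::euclidean_space \<Rightarrow> 'a::euclidean_space \<times> 'a \<Rightarrow> ennreal"
  assumes [measurable]: "borel_fun (\<lambda>(z, w). h z w)"
  shows "(\<integral>\<^sup>+w. \<integral>\<^sup>+z. h z w \<partial>lborel \<partial>mu s p) = (\<integral>\<^sup>+z. \<integral>\<^sup>+w. h z w \<partial>mu s p \<partial>lborel)"
proof -
  have [measurable]: "(\<lambda>(z, w). h z w) \<in> borel_measurable (borel \<Otimes>\<^sub>M borel)"
    using assms by (simp add: borel_prod)
  have [measurable]: "borel_fun (h z)" for z
  proof -
    have "borel_fun (\<lambda>w. (\<lambda>(z, w). h z w) (z, w))" by measurable
    then show ?thesis by simp
  qed
  have "(\<integral>\<^sup>+w. \<integral>\<^sup>+z. h z w \<partial>lborel \<partial>mu s p) = (\<integral>\<^sup>+w. \<integral>\<^sup>+z. ennreal (kern s p w) * h z w \<partial>lborel \<partial>lborel)"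
    by (subst nn_integral_mu) (auto simp: nn_integral_cmult)
  also have "\<dots> = (\<integral>\<^sup>+z. \<integral>\<^sup>+w. ennreal (kern s p w) * h z w \<partial>lborel \<partial>lborel)"
    by (rule lborel_pair.Fubini') measurable
  also have "\<dots> = (\<integral>\<^sup>+z. \<integral>\<^sup>+w. h z w \<partial>mu s p \<partial>lborel)"
    by (simp add: nn_integral_mu)
  finally show ?thesis .
qed

text \<open>Jensen for each increment, Tonelli, and translation invariance of \<open>mu\<close>. As
  the constant is 1, all mollifications of \<open>\<omega>\<close> share the energy bound that
  \<open>form_tendsto\<close> requires.\<close>

lemma gag_conv_le:
  fixes \<eta> \<omega> :: "'a::euclidean_space \<Rightarrow> real"
  assumes p: "1 < p" and [measurable]: "borel_fun \<eta>" "borel_fun \<omega>"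
    and \<eta>: "integrable lborel \<eta>" "\<And>z. 0 \<le> \<eta> z" "(\<integral>z. \<eta> z \<partial>lborel) = 1"
    and M: "\<And>x. \<bar>\<omega> x\<bar> \<le> M"
  shows "gag s p (conv \<eta> \<omega>) \<le> gag s p \<omega>"
proof -
  have i: "integrable lborel (\<lambda>z. \<eta> z * \<omega> (x - z))" for x
    by (rule integrable_dominated[OF integrable_mult_right[OF \<eta>(1), of M]])
      (auto simp: abs_mult \<eta>(2) M mult.commute[of M] intro: mult_left_mono)
  have [measurable]: "borel_fun (\<lambda>u :: 'a \<times> ('a \<times> 'a). fst (snd u))"
      "borel_fun (\<lambda>u :: 'a \<times> ('a \<times> 'a). snd (snd u))"
      "borel_fun (\<lambda>u :: 'a \<times> ('a \<times> 'a). fst u)"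
    by (intro borel_measurable_continuous_onI continuous_intros)+
  have "gag s p (conv \<eta> \<omega>) \<le> (\<integral>\<^sup>+w. \<integral>\<^sup>+z. ennreal (\<eta> z * \<bar>\<omega> (fst w - z) - \<omega> (snd w - z)\<bar> powr p) \<partial>lborel \<partial>mu s p)"
    unfolding gag_def
  proof (rule nn_integral_mono)
    fix w :: "'a \<times> 'a"
    have "conv \<eta> \<omega> (fst w) - conv \<eta> \<omega> (snd w) = (\<integral>z. \<eta> z * (\<omega> (fst w - z) - \<omega> (snd w - z)) \<partial>lborel)"
      using i by (simp add: conv_reflect right_diff_distrib)
    moreover have "\<bar>\<omega> (fst w - z) - \<omega> (snd w - z)\<bar> \<le> 2 * M" for z
      using M[of "fst w - z"] M[of "snd w - z"] by linarith
    ultimately show "ennreal (\<bar>conv \<eta> \<omega> (fst w) - conv \<eta> \<omega> (snd w)\<bar> powr p)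
       \<le> (\<integral>\<^sup>+z. ennreal (\<eta> z * \<bar>\<omega> (fst w - z) - \<omega> (snd w - z)\<bar> powr p) \<partial>lborel)"
      using jensen_powr[OF p \<eta>, of "\<lambda>z. \<omega> (fst w - z) - \<omega> (snd w - z)" "2 * M"] by simp
  qed
  also have "(\<integral>\<^sup>+w. \<integral>\<^sup>+z. ennreal (\<eta> z * \<bar>\<omega> (fst w - z) - \<omega> (snd w - z)\<bar> powr p) \<partial>lborel \<partial>mu s p)
      = (\<integral>\<^sup>+z. \<integral>\<^sup>+w. ennreal (\<eta> z * \<bar>\<omega> (fst w - z) - \<omega> (snd w - z)\<bar> powr p) \<partial>mu s p \<partial>lborel)"
    by (rule nn_integral_lborel_mu_swap) (unfold case_prod_beta, measurable)
  also have "\<dots> = (\<integral>\<^sup>+z. ennreal (\<eta> z) * gag s p \<omega> \<partial>lborel)"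
  proof (rule nn_integral_cong)
    fix z
    have "(\<integral>\<^sup>+w. ennreal (\<eta> z * \<bar>\<omega> (fst w - z) - \<omega> (snd w - z)\<bar> powr p) \<partial>mu s p)
      = ennreal (\<eta> z) * Lp_int p (mu s p) (\<lambda>w. \<omega> (- z + fst w) - \<omega> (- z + snd w))"
      using \<eta>(2) by (simp add: ennreal_mult nn_integral_cmult)
    also have "Lp_int p (mu s p) (\<lambda>w. \<omega> (- z + fst w) - \<omega> (- z + snd w)) = gag s p \<omega>"
      unfolding gag_def
      using nn_integral_mu_translate[of "\<lambda>w. ennreal (\<bar>df \<omega> w\<bar> powr p)" s p "- z"] by simp
    finally show "(\<integral>\<^sup>+w. ennreal (\<eta> z * \<bar>\<omega> (fst w - z) - \<omega> (snd w - z)\<bar> powr p) \<partial>mu s p)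
      = ennreal (\<eta> z) * gag s p \<omega>" .
  qed
  also have "\<dots> = gag s p \<omega>"
    using \<eta> by (simp add: nn_integral_multc nn_integral_eq_integral)
  finally show ?thesis .
qed

text \<open>The error is an average of translation errors with weight \<open>\<eta>\<close>; Tonelli
  reduces its L^1 norm to shifts shorter than \<open>r\<close>.\<close>

lemma L1_conv_le:
  fixes \<eta> \<omega> :: "'a::euclidean_space \<Rightarrow> real"
  assumes [measurable]: "borel_fun \<eta>"
    and \<eta>: "integrable lborel \<eta>" "\<And>z. 0 \<le> \<eta> z" "(\<integral>z. \<eta> z \<partial>lborel) = 1"
    and supp: "\<And>z. r \<le> norm z \<Longrightarrow> \<eta> z = 0"
    and \<omega>: "integrable lborel \<omega>" "\<And>x. \<bar>\<omega> x\<bar> \<le> M"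
    and e: "\<And>z. norm z < r \<Longrightarrow> (\<integral>x. \<bar>\<omega> (x + z) - \<omega> x\<bar> \<partial>lborel) \<le> e"
  shows "(\<integral>\<^sup>+x. ennreal \<bar>conv \<eta> \<omega> x - \<omega> x\<bar> \<partial>lborel) \<le> ennreal e"
proof -
  have [measurable]: "borel_fun \<omega>" using \<omega>(1) by (auto dest: borel_measurable_integrable)
  have i: "integrable lborel (\<lambda>z. \<eta> z * \<omega> (x - z))" for x
    by (rule integrable_dominated[OF integrable_mult_right[OF \<eta>(1), of M]])
      (auto simp: abs_mult \<eta>(2) \<omega>(2) mult.commute[of M] intro: mult_left_mono)
  have "(\<integral>\<^sup>+x. ennreal \<bar>conv \<eta> \<omega> x - \<omega> x\<bar> \<partial>lborel) \<le> (\<integral>\<^sup>+x. \<integral>\<^sup>+z. ennreal (\<eta> z * \<bar>\<omega> (x - z) - \<omega> x\<bar>) \<partial>lborel \<partial>lborel)"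
  proof (rule nn_integral_mono)
    fix x
    have j: "integrable lborel (\<lambda>z. \<eta> z * (\<omega> (x - z) - \<omega> x))"
      using i[of x] \<eta>(1) by (simp add: right_diff_distrib)
    have "conv \<eta> \<omega> x - \<omega> x = (\<integral>z. \<eta> z * (\<omega> (x - z) - \<omega> x) \<partial>lborel)"
      using i \<eta> by (simp add: conv_reflect right_diff_distrib)
    then have "\<bar>conv \<eta> \<omega> x - \<omega> x\<bar> \<le> (\<integral>z. \<eta> z * \<bar>\<omega> (x - z) - \<omega> x\<bar> \<partial>lborel)"
      using integral_norm_bound[of lborel "\<lambda>z. \<eta> z * (\<omega> (x - z) - \<omega> x)"] \<eta>(2) by (simp add: abs_mult)
    moreover have "integrable lborel (\<lambda>z. \<eta> z * \<bar>\<omega> (x - z) - \<omega> x\<bar>)"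
      using integrable_norm[OF j] \<eta>(2) by (simp add: abs_mult)
    ultimately show "ennreal \<bar>conv \<eta> \<omega> x - \<omega> x\<bar> \<le> (\<integral>\<^sup>+z. ennreal (\<eta> z * \<bar>\<omega> (x - z) - \<omega> x\<bar>) \<partial>lborel)"
      using \<eta>(2) by (simp add: nn_integral_eq_integral ennreal_leI)
  qed
  also have "\<dots> = (\<integral>\<^sup>+z. \<integral>\<^sup>+x. ennreal (\<eta> z * \<bar>\<omega> (x - z) - \<omega> x\<bar>) \<partial>lborel \<partial>lborel)"
    by (rule lborel_pair.Fubini') (simp add: lborel_prod borel_prod case_prod_beta)
  also have "\<dots> \<le> (\<integral>\<^sup>+z. ennreal (\<eta> z) * ennreal e \<partial>lborel)"
  proof (rule nn_integral_mono)
    fix z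
    show "(\<integral>\<^sup>+x. ennreal (\<eta> z * \<bar>\<omega> (x - z) - \<omega> x\<bar>) \<partial>lborel) \<le> ennreal (\<eta> z) * ennreal e"
    proof (cases "norm z < r")
      case True
      have k: "integrable lborel (\<lambda>x. \<bar>\<omega> (x + - z) - \<omega> x\<bar>)"
        using integrable_lborel_translate[OF \<omega>(1), of "- z"] \<omega>(1)
        by (intro integrable_abs Bochner_Integration.integrable_diff) auto
      have "(\<integral>\<^sup>+x. ennreal (\<eta> z * \<bar>\<omega> (x - z) - \<omega> x\<bar>) \<partial>lborel)
          = ennreal (\<eta> z) * (\<integral>\<^sup>+x. ennreal \<bar>\<omega> (x + - z) - \<omega> x\<bar> \<partial>lborel)"
        using \<eta>(2) by (simp add: ennreal_mult nn_integral_cmult)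
      also have "(\<integral>\<^sup>+x. ennreal \<bar>\<omega> (x + - z) - \<omega> x\<bar> \<partial>lborel) \<le> ennreal e"
        using e[of "- z"] True k by (subst nn_integral_eq_integral) (auto intro: ennreal_leI)
      finally show ?thesis by (simp add: mult_left_mono)
    qed (use supp in auto)
  qed
  also have "\<dots> = ennreal e" using \<eta> by (simp add: nn_integral_multc nn_integral_eq_integral)
  finally show ?thesis .
qed

lemma mollifier_exists:
  assumes r: "0 < r"
  obtains \<eta> :: "'a::euclidean_space \<Rightarrow> real" where "smooth \<eta>" "integrable lborel \<eta>" "\<And>z. 0 \<le> \<eta> z"
    "(\<integral>z. \<eta> z \<partial>lborel) = 1" "\<And>z. r \<le> norm z \<Longrightarrow> \<eta> z = 0"
proof -
  define b where "b x = flat 0 (r\<^sup>2 - x \<bullet> x)" for x :: 'a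
  have b0: "b z = 0" if "r \<le> norm z" for z
  proof -
    have "r\<^sup>2 \<le> z \<bullet> z" using that r by (simp flip: power2_norm_eq_inner)
    then show ?thesis by (simp add: b_def flat_def)
  qed
  have bpos: "0 < b z" if "norm z < r" for z
  proof -
    have "z \<bullet> z < r\<^sup>2" using that r by (simp add: power_strict_mono flip: power2_norm_eq_inner)
    then show ?thesis by (simp add: b_def flat_def)
  qed
  have b1: "b z \<le> 1" "0 \<le> b z" for z by (auto simp: b_def flat_def)
  have sm: "Ck k b" for k unfolding b_def[abs_def] by (rule Ck_flat)
  have [measurable]: "borel_fun b"
    by (rule borel_measurable_continuous_onI[OF Ck_continuous[OF sm]])
  have bi: "integrable lborel b"
  proof (rule integrable_dominated)
    show "integrable lborel (indicator (cball 0 r) :: 'a \<Rightarrow> real)"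
      using emeasure_lborel_cball_finite[of "0::'a" r] by simp
    show "\<bar>b x\<bar> \<le> indicator (cball 0 r) x" for x
      using b1[of x] b0[of x] by (auto split: split_indicator)
  qed simp
  define c where "c = (\<integral>z. b z \<partial>lborel)"
  have "c \<noteq> 0"
  proof
    assume "c = 0"
    then have "AE z in lborel. b z = 0"
      using integral_nonneg_eq_0_iff_AE[OF bi] b1 by (simp add: c_def)
    then have "AE z in lborel. z \<notin> ball (0::'a) r"
      by eventually_elim (use bpos in force)
    then have "ball (0::'a) r \<in> null_sets lborel"
      by (subst AE_iff_null_sets) auto
    then have "emeasure lborel (ball (0::'a) r) = 0" by (rule null_setsD1)
    then show False using r unit_ball_vol_pos[of "real DIM('a)"] by (simp add: emeasure_ball)
  qed
  then have c: "0 < c" unfolding c_def using b1 by (simp add: less_le)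
  show ?thesis
  proof
    show "smooth (\<lambda>z. b z * (1 / c))" unfolding smooth_def by (intro allI Ck_mult sm Ck_const)
    show "integrable lborel (\<lambda>z. b z * (1 / c))" using bi by simp
    show "(\<integral>z. b z * (1 / c) \<partial>lborel) = 1" using c by (simp add: c_def[symmetric])
  qed (use b0 b1 c in auto)
qed

text \<open>One compact set \<open>K'\<close> serves all \<open>n\<close>, because the mollifier
  radii \<open>r n\<close> never exceed \<open>\<delta>\<close>. Convergence holds first in L^1, and
  a subsequence converges almost everywhere.\<close>

lemma mollification:
  fixes \<omega> :: "'a::euclidean_space \<Rightarrow> real"
  assumes p: "1 < p" and \<Omega>: "open \<Omega>" and K: "compact K" "K \<subseteq> \<Omega>"
    and \<omega>m [measurable]: "borel_fun \<omega>" and \<omega>: "\<And>x. 0 \<le> \<omega> x" "\<And>x. \<omega> x \<le> M" "\<And>x. x \<notin> K \<Longrightarrow> \<omega> x = 0"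
  obtains K' g where "compact K'" "K' \<subseteq> \<Omega>" "K \<subseteq> K'" "\<And>n::nat. test_function \<Omega> (g n)" "\<And>n x. 0 \<le> g n x" "\<And>n x. g n x \<le> M"
    "\<And>n x. x \<notin> K' \<Longrightarrow> g n x = 0" "\<And>n. gag s p (g n) \<le> gag s p \<omega>" "AE x in lborel. (\<lambda>n. g n x) \<longlonglongrightarrow> \<omega> x"
proof -
  obtain \<delta> K' where K': "0 < \<delta>" "compact K'" "K' \<subseteq> \<Omega>" "K \<subseteq> K'"
      "\<And>x y. x \<in> K \<Longrightarrow> norm (x - y) \<le> \<delta> \<Longrightarrow> y \<in> K'"
    using compact_neighbourhood[OF K(1) \<Omega> K(2)] by metis
  define r where "r n = \<delta> * inverse (real (Suc n))" for n
  have r: "0 < r n" "r n \<le> \<delta>" for n using K'(1) by (auto simp: r_def field_simps)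
  have "\<exists>\<eta> :: 'a \<Rightarrow> real. smooth \<eta> \<and> integrable lborel \<eta> \<and> (\<forall>z. 0 \<le> \<eta> z) \<and> (\<integral>z. \<eta> z \<partial>lborel) = 1
      \<and> (\<forall>z. r n \<le> norm z \<longrightarrow> \<eta> z = 0)" for n
    by (rule mollifier_exists[OF r(1)[of n]]) blast
  then obtain \<eta> :: "nat \<Rightarrow> 'a \<Rightarrow> real" where \<eta>: "\<And>n. smooth (\<eta> n)" "\<And>n. integrable lborel (\<eta> n)" "\<And>n z. 0 \<le> \<eta> n z"
      "\<And>n. (\<integral>z. \<eta> n z \<partial>lborel) = 1" "\<And>n z. r n \<le> norm z \<Longrightarrow> \<eta> n z = 0" by metis
  have [measurable]: "borel_fun (\<eta> n)" for n
    using \<eta>(2)[of n] by (auto dest: borel_measurable_integrable)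
  have M: "\<bar>\<omega> x\<bar> \<le> M" for x using \<omega> by (simp add: abs_of_nonneg)
  have Kfin: "emeasure lborel K < \<infinity>" "emeasure lborel K' < \<infinity>"
    using K(1) K'(2) emeasure_compact_finite by auto
  have [measurable]: "K \<in> sets borel" "K' \<in> sets borel" using K(1) K'(2) by (auto simp: compact_imp_closed)
  have \<omega>i: "integrable lborel \<omega>"
  proof (rule integrable_dominated)
    show "integrable lborel (\<lambda>x. M * indicator K x)" using Kfin by simp
    show "\<bar>\<omega> x\<bar> \<le> M * indicator K x" for x using M[of x] \<omega>(3)[of x] by (auto split: split_indicator)
  qed simp
  define G where "G n = conv (\<eta> n) \<omega>" for n
  have sm: "Ck k (G n)" for k n
    unfolding G_def by (rule Ck_conv[where R = "r n", OF \<eta>(1) _ \<omega>i]) (use \<eta>(5) in auto)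
  have [measurable]: "borel_fun (G n)" for n
    by (rule borel_measurable_continuous_onI[OF Ck_continuous[OF sm]])
  have G_nonneg: "0 \<le> G n x" for n x
    unfolding G_def conv_def using \<eta>(3) \<omega>(1) by (intro Bochner_Integration.integral_nonneg) auto
  have G_le: "G n x \<le> M" for n x
  proof -
    have "G n x = (\<integral>z. \<eta> n z * \<omega> (x - z) \<partial>lborel)" by (simp add: G_def conv_reflect)
    also have "\<dots> \<le> (\<integral>z. \<eta> n z * M \<partial>lborel)"
    proof (rule integral_mono)
      show "integrable lborel (\<lambda>z. \<eta> n z * \<omega> (x - z))"
        by (rule integrable_dominated[OF integrable_mult_right[OF \<eta>(2)[of n], of M]])
          (auto simp: abs_mult \<eta>(3) M mult.commute[of M] intro: mult_left_mono)
      show "integrable lborel (\<lambda>z. \<eta> n z * M)" using \<eta>(2) by simp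
    qed (use \<eta>(3) \<omega>(2) in \<open>auto intro: mult_left_mono\<close>)
    also have "\<dots> = M" using \<eta>(4) by simp
    finally show ?thesis .
  qed
  have G_supp: "G n x = 0" if "x \<notin> K'" for n x
  proof -
    have *: "\<eta> n (x - y) * \<omega> y = 0" for y
      using \<omega>(3)[of y] \<eta>(5)[of n "x - y"] K'(5)[of y x] r(2)[of n] that
      by (cases "r n \<le> norm (x - y)") (auto simp: norm_minus_commute)
    show ?thesis unfolding G_def conv_def * by simp
  qed
  have test: "test_function \<Omega> (G n)" for n
  proof -
    have "closure {x. G n x \<noteq> 0} \<subseteq> K'"
      using G_supp K'(2) by (intro closure_minimal) (auto intro: compact_imp_closed)
    moreover from this have "compact (closure {x. G n x \<noteq> 0})"
      using K'(2) by (meson bounded_subset closed_closure compact_eq_bounded_closed)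
    ultimately show ?thesis using sm K'(3) unfolding test_function_def smooth_def by blast
  qed
  have Ggag: "gag s p (G n) \<le> gag s p \<omega>" for n
    unfolding G_def using p \<eta> M by (intro gag_conv_le) auto
  have Gi: "integrable lborel (G n)" for n
  proof (rule integrable_dominated)
    show "integrable lborel (\<lambda>x. M * indicator K' x)" using Kfin by simp
    show "\<bar>G n x\<bar> \<le> M * indicator K' x" for x
      using G_le[of n x] G_nonneg[of n x] G_supp[of x n] by (auto split: split_indicator)
  qed simp
  have "(\<lambda>n. \<integral>x. norm (G n x - \<omega> x) \<partial>lborel) \<longlonglongrightarrow> 0"
  proof (rule LIMSEQ_I)
    fix e :: real assume e: "0 < e"
    obtain d where d: "0 < d" "\<And>z. norm z < d \<Longrightarrow> (\<integral>x. \<bar>\<omega> (x + z) - \<omega> x\<bar> \<partial>lborel) < e / 2"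
      using translation_continuous_uniform[OF translation_continuous_integrable[OF \<omega>i], of "e / 2"] e by auto
    have "r \<longlonglongrightarrow> 0"
      unfolding r_def[abs_def] using tendsto_mult_right_zero[OF LIMSEQ_inverse_real_of_nat] by blast
    from order_tendstoD(2)[OF this d(1)] obtain N where N: "\<And>n. N \<le> n \<Longrightarrow> r n < d"
      by (auto simp: eventually_sequentially)
    show "\<exists>n0. \<forall>n\<ge>n0. norm ((\<integral>x. norm (G n x - \<omega> x) \<partial>lborel) - 0) < e"
    proof (intro exI allI impI)
      fix n assume "N \<le> n"
      then have "(\<integral>x. \<bar>\<omega> (x + z) - \<omega> x\<bar> \<partial>lborel) \<le> e / 2" if "norm z < r n" for z
        using that N[of n] d(2)[of z] by simp
      then have "(\<integral>\<^sup>+x. ennreal \<bar>G n x - \<omega> x\<bar> \<partial>lborel) \<le> ennreal (e / 2)"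
        unfolding G_def using \<eta> \<omega>i M by (intro L1_conv_le[where r = "r n" and M = M]) auto
      then have "(\<integral>x. \<bar>G n x - \<omega> x\<bar> \<partial>lborel) \<le> e / 2"
        using e by (intro integrable_nn_bound(2)) auto
      then show "norm ((\<integral>x. norm (G n x - \<omega> x) \<partial>lborel) - 0) < e" using e by simp
    qed
  qed
  from tendsto_L1_AE_subseq[OF _ this] Gi \<omega>i
  obtain q where q: "strict_mono q" "AE x in lborel. (\<lambda>n. G (q n) x - \<omega> x) \<longlonglongrightarrow> 0" by auto
  show ?thesis
  proof (rule that[of K' "\<lambda>n. G (q n)"])
    show "AE x in lborel. (\<lambda>n. G (q n) x) \<longlonglongrightarrow> \<omega> x"
      using q(2) by eventually_elim (rule LIM_zero_cancel)
  qed (use K' test G_nonneg G_le G_supp Ggag in auto)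
qed

subsection \<open>Bounded test functions of finite energy\<close>

lemma loc_energyD:
  fixes z :: "'a::euclidean_space \<Rightarrow> real"
  assumes "loc_energy s p \<Omega> z" "compact K" "K \<subseteq> \<Omega>"
  shows "Lp_int p (mu s p) (\<lambda>w. indicator (K \<times> K) w * df z w) < \<infinity>"
proof -
  have "Lp_int p (mu s p) (\<lambda>w. indicator (K \<times> K) w * df z w)
      = (\<integral>\<^sup>+w. indicator (K \<times> K) w * ennreal (\<bar>df z w\<bar> powr p) \<partial>mu s p)"
    by (intro nn_integral_cong) (auto split: split_indicator)
  then show ?thesis using assms unfolding loc_energy_def by auto
qed

lemma loc_energy_measurable: "loc_energy s p \<Omega> z \<Longrightarrow> borel_fun z"
  by (simp add: loc_energy_def)

text \<open>Close pairs with nonzero increment lie in \<open>K' \<times> K'\<close>, where local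
  energy is assumed. Distant ones have increments at most \<open>2 * M\<close>, and the distant
  pairs with a point in \<open>K\<close> have finite \<open>mu\<close>-measure.\<close>

lemma gag_finite_local:
  fixes h :: "'a::euclidean_space \<Rightarrow> real"
  assumes p: "1 < p" "0 < s" and \<Omega>: "open \<Omega>" and K: "compact K" "K \<subseteq> \<Omega>"
    and [measurable]: "borel_fun h"
    and M: "\<And>x. \<bar>h x\<bar> \<le> M" and supp: "\<And>x. x \<notin> K \<Longrightarrow> h x = 0"
    and loc: "\<And>K'. compact K' \<Longrightarrow> K' \<subseteq> \<Omega> \<Longrightarrow>
      Lp_int p (mu s p) (\<lambda>w. indicator (K' \<times> K') w * df h w) < \<infinity>"
  shows "gag s p h < \<infinity>"
proof -
  obtain \<delta> K' where K': "0 < \<delta>" "compact K'" "K' \<subseteq> \<Omega>" "K \<subseteq> K'"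
      "\<And>x y. x \<in> K \<Longrightarrow> norm (x - y) \<le> \<delta> \<Longrightarrow> y \<in> K'"
    using compact_neighbourhood[OF K(1) \<Omega> K(2)] by metis
  have [measurable]: "K \<in> sets borel" using K by (simp add: compact_imp_closed)
  have [measurable]: "K' \<times> K' \<in> sets borel"
    using K' by (intro borel_closed closed_Times compact_imp_closed) auto
  define I where "I w = (if \<delta> \<le> norm (fst w - snd w) then ennreal ((2 * M) powr p) * indicator K (fst w) else 0)" for w :: "'a \<times> 'a"
  have [measurable]: "borel_fun I" unfolding I_def by measurable
  have Ifin: "(\<integral>\<^sup>+w. I w \<partial>mu s p) < \<infinity>"
    unfolding I_def using emeasure_compact_finite[OF K(1)] K'(1) p
    by (intro mu_far_finite) (auto simp: nn_integral_cmult ennreal_mult_less_top)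
  have "ennreal (\<bar>df h w\<bar> powr p)
      \<le> ennreal (\<bar>indicator (K' \<times> K') w * df h w\<bar> powr p) + (I w + I (snd w, fst w))" for w
  proof (cases "df h w = 0 \<or> w \<in> K' \<times> K'")
    case False
    then have in_K: "fst w \<in> K \<or> snd w \<in> K" using supp by (metis diff_self)
    have far: "\<delta> \<le> norm (fst w - snd w)"
    proof (rule ccontr)
      assume "\<not> ?thesis"
      then have "w \<in> K' \<times> K'"
        using in_K K'(4) K'(5)[of "fst w" "snd w"] K'(5)[of "snd w" "fst w"]
        by (auto simp: norm_minus_commute mem_Times_iff)
      then show False using False by blast
    qed
    have "\<bar>df h w\<bar> \<le> 2 * M" using M[of "fst w"] M[of "snd w"] by linarith
    then have "ennreal (\<bar>df h w\<bar> powr p) \<le> ennreal ((2 * M) powr p)"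
      using p by (intro ennreal_leI powr_mono2) auto
    also have "\<dots> \<le> I w + I (snd w, fst w)"
      using in_K far by (auto simp: I_def norm_minus_commute split: split_indicator)
    finally show ?thesis by (simp add: add_increasing)
  qed (use p in auto)
  then have "gag s p h \<le> (\<integral>\<^sup>+w. ennreal (\<bar>indicator (K' \<times> K') w * df h w\<bar> powr p) + (I w + I (snd w, fst w)) \<partial>mu s p)"
    unfolding gag_def by (intro nn_integral_mono) auto
  also have "\<dots> = Lp_int p (mu s p) (\<lambda>w. indicator (K' \<times> K') w * df h w)
      + ((\<integral>\<^sup>+w. I w \<partial>mu s p) + (\<integral>\<^sup>+w. I w \<partial>mu s p))"
    by (simp add: nn_integral_add nn_integral_mu_swap)
  also have "\<dots> < \<infinity>" using Ifin loc[OF K'(2,3)] by simp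
  finally show ?thesis .
qed

section \<open>Testing the weak inequalities with nonsmooth functions\<close>

abbreviation src :: "('a::euclidean_space \<Rightarrow> ennreal) \<Rightarrow> ('a \<Rightarrow> real) \<Rightarrow> ennreal" where
  "src Q \<phi> \<equiv> (\<integral>\<^sup>+x. Q x * ennreal (\<phi> x) \<partial>lborel)"

definition loc_source :: "'a::euclidean_space set \<Rightarrow> ('a \<Rightarrow> ennreal) \<Rightarrow> bool" where
  "loc_source \<Omega> Q \<longleftrightarrow> borel_fun Q \<and>
     (\<forall>K. compact K \<and> K \<subseteq> \<Omega> \<longrightarrow> (\<integral>\<^sup>+x. indicator K x * Q x \<partial>lborel) < \<infinity>)"

text \<open>The enlarged class of test functions. It admits the minima and positive parts that arise
  in the obstacle argument, where smoothness is lost but finite energy can be verified.\<close>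

definition bump_like :: "real \<Rightarrow> real \<Rightarrow> 'a::euclidean_space set \<Rightarrow> ('a \<Rightarrow> real) \<Rightarrow> bool" where
  "bump_like s p \<Omega> \<omega> \<longleftrightarrow> \<omega> \<in> borel_measurable borel \<and> (\<forall>x. 0 \<le> \<omega> x) \<and> (\<exists>M. \<forall>x. \<omega> x \<le> M) \<and>
     (\<exists>K. compact K \<and> K \<subseteq> \<Omega> \<and> (\<forall>x. x \<notin> K \<longrightarrow> \<omega> x = 0)) \<and> gag s p \<omega> < \<infinity>"

lemma form_integrable:
  fixes z \<omega> :: "'a::euclidean_space \<Rightarrow> real"
  assumes p: "1 < p" "0 < s" and \<Omega>: "open \<Omega>" and z: "loc_energy s p \<Omega> z" and \<omega>: "bump_like s p \<Omega> \<omega>"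
  shows "integrable (mu s p) (\<lambda>w. pphi p (df z w) * df \<omega> w)"
proof -
  obtain K M where K: "compact K" "K \<subseteq> \<Omega>" "\<And>x. x \<notin> K \<Longrightarrow> \<omega> x = 0" "\<And>x. \<omega> x \<le> M"
    using \<omega> unfolding bump_like_def by metis
  show ?thesis
    by (rule form_tendsto(1)[OF p \<Omega> z K(1,2), where g = "\<lambda>n. \<omega>" and M = M and C = "gag s p \<omega>"])
      (use \<omega> K in \<open>auto simp: bump_like_def\<close>)
qed

text \<open>A single mollifying sequence serves both sides of a weak inequality:
  \<open>form_tendsto\<close> for the form, and dominated convergence with a multiple of
  \<open>Q\<close> on \<open>K'\<close> for the source.\<close>

lemma form_approx:
  fixes z \<omega> :: "'a::euclidean_space \<Rightarrow> real" and Q :: "'a \<Rightarrow> ennreal"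
  assumes p: "1 < p" "0 < s" and \<Omega>: "open \<Omega>" and z: "loc_energy s p \<Omega> z" and \<omega>: "bump_like s p \<Omega> \<omega>"
    and Q: "loc_source \<Omega> Q"
  obtains g where "\<And>n::nat. test_function \<Omega> (g n)" "\<And>n x. 0 \<le> g n x"
    "(\<lambda>n. form s p z (g n)) \<longlonglongrightarrow> form s p z \<omega>"
    "(\<lambda>n. src Q (g n)) \<longlonglongrightarrow> (src Q \<omega>)"
proof -
  obtain K M where K: "compact K" "K \<subseteq> \<Omega>" "\<And>x. x \<notin> K \<Longrightarrow> \<omega> x = 0" "\<And>x. \<omega> x \<le> M"
    using \<omega> unfolding bump_like_def by metis
  have \<omega>': "borel_fun \<omega>" "\<And>x. 0 \<le> \<omega> x" "gag s p \<omega> < \<infinity>"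
    using \<omega> by (auto simp: bump_like_def)
  have Q': "borel_fun Q" "\<And>K. compact K \<Longrightarrow> K \<subseteq> \<Omega> \<Longrightarrow> (\<integral>\<^sup>+x. indicator K x * Q x \<partial>lborel) < \<infinity>"
    using Q by (auto simp: loc_source_def)
  note [measurable] = \<omega>'(1) Q'(1)
  obtain K' g where g: "compact K'" "K' \<subseteq> \<Omega>" "K \<subseteq> K'" "\<And>n::nat. test_function \<Omega> (g n)" "\<And>n x. 0 \<le> g n x" "\<And>n x. g n x \<le> M"
    "\<And>n x. x \<notin> K' \<Longrightarrow> g n x = 0" "\<And>n. gag s p (g n) \<le> gag s p \<omega>" "AE x in lborel. (\<lambda>n. g n x) \<longlonglongrightarrow> \<omega> x"
    by (rule mollification[OF p(1) \<Omega> K(1,2) \<omega>'(1,2) K(4,3), of s]) (assumption | (rule that; assumption))+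
  have gm [measurable]: "borel_fun (g n)" for n
    using g(4)[of n] unfolding test_function_def smooth_def
    by (intro borel_measurable_continuous_onI) (metis Ck.simps(1))
  have [measurable]: "K' \<in> sets borel" using g(1) by (simp add: compact_imp_closed)
  have supp': "\<omega> x = 0" if "x \<notin> K'" for x using that g(3) K(3) by blast
  have lim: "(\<lambda>n. form s p z (g n)) \<longlonglongrightarrow> form s p z \<omega>"
    by (rule form_tendsto(2)[OF p \<Omega> z g(1,2), where M = M and C = "gag s p \<omega>"])
      (use g K(4) supp' \<omega>' in auto)
  have M0: "0 \<le> M" using K(4) \<omega>'(2) order_trans by blast
  \<comment> \<open>\<open>Q\<close> may take the value \<open>\<infinity>\<close>, where
    multiplication by it is discontinuous at 0; local integrability makes it finite almost
    everywhere on \<open>K'\<close>.\<close>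
  have fin: "AE x in lborel. indicator K' x * Q x < \<infinity>"
    using nn_integral_PInf_AE[of "\<lambda>x. indicator K' x * Q x" lborel] Q'(2)[OF g(1,2)]
    by (auto simp: less_top)
  have "(\<lambda>n. src Q (g n)) \<longlonglongrightarrow> (src Q \<omega>)"
  proof (rule nn_integral_dominated_convergence[where w = "\<lambda>x. ennreal M * (indicator K' x * Q x)"])
    show "AE x in lborel. Q x * ennreal (g j x) \<le> ennreal M * (indicator K' x * Q x)" for j
    proof (rule AE_I2)
      fix x
      show "Q x * ennreal (g j x) \<le> ennreal M * (indicator K' x * Q x)"
        using g(6)[of j x] g(7)[of x j] 
        by (auto simp: mult.commute[of _ "Q x"] intro!: mult_left_mono ennreal_leI split: split_indicator)
    qed
    show "(\<integral>\<^sup>+x. ennreal M * (indicator K' x * Q x) \<partial>lborel) < \<infinity>"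
      using Q'(2)[OF g(1,2)] by (simp add: nn_integral_cmult ennreal_mult_less_top)
    show "AE x in lborel. (\<lambda>n. Q x * ennreal (g n x)) \<longlonglongrightarrow> Q x * ennreal (\<omega> x)"
      using fin g(9)
    proof eventually_elim
      fix x assume x: "indicator K' x * Q x < \<infinity>" "(\<lambda>n. g n x) \<longlonglongrightarrow> \<omega> x"
      show "(\<lambda>n. Q x * ennreal (g n x)) \<longlonglongrightarrow> Q x * ennreal (\<omega> x)"
      proof (cases "x \<in> K'")
        case True
        then show ?thesis using x by (intro ennreal_tendsto_cmult tendsto_ennrealI) auto
      next
        case False
        then show ?thesis using g(7) supp'[of x] by simp
      qed
    qed
  qed auto
  with lim g show ?thesis using that by blast
qed

text \<open>Since \<open>ennreal\<close> sends negative numbers to 0, the two conclusions only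
  together express the inequality between the source and the real value of the form.\<close>

lemma supersolution_bump_like:
  fixes z \<omega> :: "'a::euclidean_space \<Rightarrow> real" and Q :: "'a \<Rightarrow> ennreal"
  assumes p: "1 < p" "0 < s" and \<Omega>: "open \<Omega>" and z: "loc_energy s p \<Omega> z" and \<omega>: "bump_like s p \<Omega> \<omega>"
    and Q: "loc_source \<Omega> Q"
    and super: "\<And>\<phi>. test_function \<Omega> \<phi> \<Longrightarrow> (\<And>x. 0 \<le> \<phi> x) \<Longrightarrow>
      enn2ereal (src Q \<phi>) \<le> ereal (form s p z \<phi>)"
  shows "0 \<le> form s p z \<omega>" "(src Q \<omega>) \<le> ennreal (form s p z \<omega>)"
proof -
  obtain g where g: "\<And>n::nat. test_function \<Omega> (g n)" "\<And>n x. 0 \<le> g n x"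
    "(\<lambda>n. form s p z (g n)) \<longlonglongrightarrow> form s p z \<omega>"
    "(\<lambda>n. src Q (g n)) \<longlonglongrightarrow> (src Q \<omega>)"
    by (rule form_approx[OF p \<Omega> z \<omega> Q]) (rule that; assumption)
  have 0: "0 \<le> form s p z (g n)" for n
    using order_trans[OF enn2ereal_nonneg super[OF g(1,2), of n]] by simp
  then show "0 \<le> form s p z \<omega>" using g(3) by (intro LIMSEQ_le_const) auto
  have "(src Q (g n)) \<le> ennreal (form s p z (g n))" for n
    using super[OF g(1,2), of n] 0[of n] by (simp add: less_eq_ennreal.rep_eq)
  then show "(src Q \<omega>) \<le> ennreal (form s p z \<omega>)"
    by (intro LIMSEQ_le[OF g(4) tendsto_ennrealI[OF g(3)]]) auto
qed

lemma subsolution_bump_like: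
  fixes z \<omega> :: "'a::euclidean_space \<Rightarrow> real" and Q :: "'a \<Rightarrow> ennreal"
  assumes p: "1 < p" "0 < s" and \<Omega>: "open \<Omega>" and z: "loc_energy s p \<Omega> z" and \<omega>: "bump_like s p \<Omega> \<omega>"
    and Q: "loc_source \<Omega> Q"
    and sub: "\<And>\<phi>. test_function \<Omega> \<phi> \<Longrightarrow> (\<And>x. 0 \<le> \<phi> x) \<Longrightarrow>
      ereal (form s p z \<phi>) \<le> enn2ereal (src Q \<phi>)"
  shows "ennreal (form s p z \<omega>) \<le> (src Q \<omega>)"
proof -
  obtain g where g: "\<And>n::nat. test_function \<Omega> (g n)" "\<And>n x. 0 \<le> g n x"
    "(\<lambda>n. form s p z (g n)) \<longlonglongrightarrow> form s p z \<omega>"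
    "(\<lambda>n. src Q (g n)) \<longlonglongrightarrow> (src Q \<omega>)"
    by (rule form_approx[OF p \<Omega> z \<omega> Q]) (rule that; assumption)
  have "ennreal (form s p z (g n)) \<le> (src Q (g n))" for n
  proof (cases "0 \<le> form s p z (g n)")
    case True
    then show ?thesis using sub[OF g(1,2), of n] by (simp add: less_eq_ennreal.rep_eq)
  qed (simp add: ennreal_neg)
  then show ?thesis
    by (intro LIMSEQ_le[OF tendsto_ennrealI[OF g(3)] g(4)]) auto
qed

text \<open>Pointwise version of the fact that truncating a subsolution gives a subsolution. If both
  values exceed \<open>\<epsilon>\<close>, the increments agree. Otherwise truncation moves the
  increment against the sign of \<open>\<omega>1 - \<omega>2\<close>, which lowers the
  product.\<close>

lemma pphi_truncation_le:
  assumes p: "1 < p" and \<omega>: "0 \<le> \<omega>1" "0 \<le> \<omega>2" "\<omega>1 \<noteq> 0 \<Longrightarrow> \<epsilon> < u1" "\<omega>2 \<noteq> 0 \<Longrightarrow> \<epsilon> < u2"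
  shows "pphi p (max (u1 - \<epsilon>) 0 - max (u2 - \<epsilon>) 0) * (\<omega>1 - \<omega>2) \<le> pphi p (u1 - u2) * (\<omega>1 - \<omega>2)"
proof -
  have mono: "pphi p a * w \<le> pphi p b * w" if "a \<le> b" "0 \<le> w" for a b w
    using that p by (intro mult_right_mono pphi_mono)
  have mono': "pphi p a * w \<le> pphi p b * w" if "b \<le> a" "w \<le> 0" for a b w
    using that p by (intro mult_right_mono_neg pphi_mono)
  consider "\<epsilon> < u1" "\<epsilon> < u2" | "u1 \<le> \<epsilon>" "\<omega>1 = 0" | "u2 \<le> \<epsilon>" "\<omega>2 = 0" using \<omega> by fastforce
  then show ?thesis
  proof cases
    case 1
    then show ?thesis by (simp add: max_def)
  next
    case 2
    then show ?thesis using \<omega>(2) \<omega>(4) by (cases "\<omega>2 = 0") (auto intro!: mono' pphi_mono p simp: max_def)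
  next
    case 3
    then show ?thesis using \<omega>(1) \<omega>(3) by (cases "\<omega>1 = 0") (auto intro!: mono pphi_mono p simp: max_def)
  qed
qed

text \<open>At a zero of \<open>V\<close> the convention decides: the right side is
  \<open>\<infinity>\<close> if \<open>f x > 0\<close>, and both sides are 0 if
  \<open>f x = 0\<close>.\<close>

lemma sing_quot_mono:
  assumes "0 < \<gamma>" "0 \<le> f x" "0 \<le> V x" "V x < U x"
  shows "sing_quot \<gamma> f U x \<le> sing_quot \<gamma> f V x"
proof (cases "V x = 0")
  case True
  then show ?thesis using assms by (auto simp: sing_quot_def)
next
  case False
  have "f x / U x powr \<gamma> \<le> f x / V x powr \<gamma>"
    using assms False by (intro divide_left_mono powr_mono2 mult_pos_pos) auto
  then show ?thesis using assms False by (auto simp: sing_quot_def intro: ennreal_leI)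
qed

lemma sing_quot_measurable [measurable]:
  assumes [measurable]: "f \<in> borel_measurable M" "z \<in> borel_measurable M"
  shows "sing_quot \<gamma> f z \<in> borel_measurable M"
  unfolding sing_quot_def[abs_def] by measurable

text \<open>The hypotheses for Borel representatives whose sign and vanishing conditions hold at
  every point, so that the inequalities below can be pointwise.\<close>

locale sub_super =
  fixes s p \<gamma> :: real and \<Omega> :: "'a::euclidean_space set" and f U V :: "'a \<Rightarrow> real"
  assumes p: "1 < p" and s: "0 < s" "s < 1" and \<gamma>: "0 < \<gamma>" and \<Omega>: "open \<Omega>"
    and f_borel [measurable]: "borel_fun f" and f_nonneg: "\<And>x. 0 \<le> f x"
    and U: "loc_energy s p \<Omega> U" "\<And>x. 0 \<le> U x" "\<And>x. x \<notin> \<Omega> \<Longrightarrow> U x = 0"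
    and V: "loc_energy s p \<Omega> V" "\<And>x. 0 \<le> V x" "\<And>x. x \<notin> \<Omega> \<Longrightarrow> V x = 0"
    and QU: "loc_source \<Omega> (sing_quot \<gamma> f U)"
    and QV: "loc_source \<Omega> (sing_quot \<gamma> f V)"
    and sub: "\<And>\<phi>. test_function \<Omega> \<phi> \<Longrightarrow> (\<And>x. 0 \<le> \<phi> x) \<Longrightarrow>
      ereal (form s p U \<phi>) \<le> enn2ereal (src (sing_quot \<gamma> f U) \<phi>)"
    and super: "\<And>\<phi>. test_function \<Omega> \<phi> \<Longrightarrow> (\<And>x. 0 \<le> \<phi> x) \<Longrightarrow>
      enn2ereal (src (sing_quot \<gamma> f V) \<phi>) \<le> ereal (form s p V \<phi>)"
begin

lemma U_borel [measurable]: "borel_fun U" using U(1) by (rule loc_energy_measurable)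
lemma V_borel [measurable]: "borel_fun V" using V(1) by (rule loc_energy_measurable)

text \<open>The function \<open>\<omega>\<close> lives where \<open>V < U\<close> and
  \<open>\<epsilon> < U\<close>. There the chain is: truncation inequality, subsolution inequality
  for \<open>U\<close>, monotonicity of the source, supersolution inequality for
  \<open>V\<close>.\<close>

lemma form_truncation_le:
  assumes \<epsilon>: "0 < \<epsilon>" and E: "gag s p (\<lambda>x. max (U x - \<epsilon>) 0) < \<infinity>"
    and \<omega>: "bump_like s p \<Omega> \<omega>" and lt: "\<And>x. \<omega> x \<noteq> 0 \<Longrightarrow> V x < max (U x - \<epsilon>) 0"
  shows "form s p (\<lambda>x. max (U x - \<epsilon>) 0) \<omega> \<le> form s p V \<omega>"
proof -
  have [measurable]: "borel_fun \<omega>" and \<omega>': "\<And>x. 0 \<le> \<omega> x" "gag s p \<omega> < \<infinity>"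
    using \<omega> by (auto simp: bump_like_def)
  have lt': "\<epsilon> < U x" "V x < U x" if "\<omega> x \<noteq> 0" for x
    using lt[OF that] V(2)[of x] \<epsilon> by (auto simp: max_def split: if_splits)
  have "form s p (\<lambda>x. max (U x - \<epsilon>) 0) \<omega> \<le> form s p U \<omega>"
    unfolding form_def
  proof (rule integral_mono)
    show "integrable (mu s p) (\<lambda>w. pphi p (max (U (fst w) - \<epsilon>) 0 - max (U (snd w) - \<epsilon>) 0) * df \<omega> w)"
      using E \<omega>' p by (intro integrable_pphi_mult) (auto simp: gag_def)
    show "integrable (mu s p) (\<lambda>w. pphi p (df U w) * df \<omega> w)"
      by (rule form_integrable[OF p s(1) \<Omega> U(1) \<omega>])
  qed (use pphi_truncation_le p \<omega>' lt' in blast)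
  moreover have "ennreal (form s p U \<omega>) \<le> ennreal (form s p V \<omega>)"
  proof -
    have "ennreal (form s p U \<omega>) \<le> (src (sing_quot \<gamma> f U) \<omega>)"
      using p s \<Omega> U(1) \<omega> QU sub by (intro subsolution_bump_like) auto
    also have "\<dots> \<le> (src (sing_quot \<gamma> f V) \<omega>)"
    proof (rule nn_integral_mono)
      fix x
      show "sing_quot \<gamma> f U x * ennreal (\<omega> x) \<le> sing_quot \<gamma> f V x * ennreal (\<omega> x)"
      proof (cases "\<omega> x = 0")
        case False
        then show ?thesis using lt' \<gamma> f_nonneg V(2) by (intro mult_right_mono sing_quot_mono) auto
      qed simp
    qed
    also have "\<dots> \<le> ennreal (form s p V \<omega>)"
      using p s \<Omega> V(1) \<omega> QV super by (intro supersolution_bump_like(2)[of p s \<Omega>]) auto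
    finally show ?thesis .
  qed
  \<comment> \<open>Needed to read the preceding comparison of \<open>ennreal\<close> values as one
    of real numbers.\<close>
  moreover have "0 \<le> form s p V \<omega>"
    using p s \<Omega> V(1) \<omega> QV super by (intro supersolution_bump_like(1)[of p s \<Omega> V \<omega> "sing_quot \<gamma> f V"]) auto
  ultimately show ?thesis by simp
qed

end

subsection \<open>The obstacle problem\<close>

definition breg_energy :: "real \<Rightarrow> real \<Rightarrow> ('a::euclidean_space \<Rightarrow> real) \<Rightarrow> ('a \<Rightarrow> real) \<Rightarrow> ennreal" where
  "breg_energy s p e \<phi> = (\<integral>\<^sup>+w. ennreal (breg p (df e w) (df \<phi> w)) \<partial>mu s p)"

primrec run_max :: "(nat \<Rightarrow> 'a \<Rightarrow> real) \<Rightarrow> nat \<Rightarrow> 'a \<Rightarrow> real" where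
  "run_max \<phi> 0 = \<phi> 0"
| "run_max \<phi> (Suc j) = (\<lambda>x. max (run_max \<phi> j x) (\<phi> (Suc j) x))"

lemma run_max_le_iff: "run_max \<phi> j x \<le> c \<longleftrightarrow> (\<forall>i\<le>j. \<phi> i x \<le> c)"
  by (induction j) (auto simp: le_Suc_eq)

lemma le_run_max: "i \<le> j \<Longrightarrow> \<phi> i x \<le> run_max \<phi> j x"
  using run_max_le_iff[of \<phi> j x "run_max \<phi> j x"] by simp

lemma run_max_measurable [measurable]:
  "(\<And>i. \<phi> i \<in> borel_measurable M) \<Longrightarrow> run_max \<phi> j \<in> borel_measurable M"
proof (induction j)
  case (Suc j)
  have [measurable]: "run_max \<phi> j \<in> borel_measurable M" "\<phi> (Suc j) \<in> borel_measurable M" using Suc by auto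
  show ?case by simp
qed simp

text \<open>Fatou's lemma, available because the integrand is nonnegative. The bound may vary with
  \<open>n\<close>, as it does in the second of the two limits that build the minimizer.\<close>

lemma breg_energy_lsc:
  fixes \<phi> :: "'a::euclidean_space \<Rightarrow> real"
  assumes p: "1 < p" and [measurable]: "borel_fun e" "\<And>n::nat. g n \<in> borel_measurable borel"
    and lim: "\<And>x. (\<lambda>n. g n x) \<longlonglongrightarrow> \<phi> x"
    and le: "\<And>n. breg_energy s p e (g n) \<le> c n" and c: "c \<longlonglongrightarrow> c0"
  shows "breg_energy s p e \<phi> \<le> c0"
proof -
  have "breg_energy s p e \<phi> = (\<integral>\<^sup>+w. liminf (\<lambda>n. ennreal (breg p (df e w) (df (g n) w))) \<partial>mu s p)"
    unfolding breg_energy_def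
  proof (rule nn_integral_cong)
    fix w
    have "(\<lambda>n. ennreal (breg p (df e w) (df (g n) w))) \<longlonglongrightarrow> ennreal (breg p (df e w) (df \<phi> w))"
      using p lim by (intro tendsto_ennrealI tendsto_breg tendsto_diff) auto
    from lim_imp_Liminf[OF trivial_limit_sequentially this]
    show "ennreal (breg p (df e w) (df \<phi> w)) = liminf (\<lambda>n. ennreal (breg p (df e w) (df (g n) w)))"
      by (rule sym)
  qed
  also have "\<dots> \<le> liminf (\<lambda>n. breg_energy s p e (g n))"
    unfolding breg_energy_def by (rule nn_integral_liminf) measurable
  also have "\<dots> \<le> liminf c" by (rule Liminf_mono) (simp add: le)
  also have "\<dots> = c0" using c by (rule lim_imp_Liminf[OF trivial_limit_sequentially])
  finally show ?thesis .
qed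

lemma breg_energy_submodular:
  fixes \<phi> \<psi> :: "'a::euclidean_space \<Rightarrow> real"
  assumes p: "1 < p" and [measurable]: "borel_fun e" "borel_fun \<phi>" "borel_fun \<psi>"
  shows "breg_energy s p e (\<lambda>x. max (\<phi> x) (\<psi> x)) + breg_energy s p e (\<lambda>x. min (\<phi> x) (\<psi> x))
    \<le> breg_energy s p e \<phi> + breg_energy s p e \<psi>"
proof -
  have "breg_energy s p e (\<lambda>x. max (\<phi> x) (\<psi> x)) + breg_energy s p e (\<lambda>x. min (\<phi> x) (\<psi> x))
     = (\<integral>\<^sup>+w. ennreal (breg p (df e w) (df (\<lambda>x. max (\<phi> x) (\<psi> x)) w)) + ennreal (breg p (df e w) (df (\<lambda>x. min (\<phi> x) (\<psi> x)) w)) \<partial>mu s p)"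
    unfolding breg_energy_def by (rule nn_integral_add[symmetric]) measurable
  also have "\<dots> \<le> (\<integral>\<^sup>+w. ennreal (breg p (df e w) (df \<phi> w)) + ennreal (breg p (df e w) (df \<psi> w)) \<partial>mu s p)"
    by (intro nn_integral_mono)
      (simp add: breg_nonneg[OF p] breg_submodular[OF p] ennreal_leI flip: ennreal_plus)
  also have "\<dots> = breg_energy s p e \<phi> + breg_energy s p e \<psi>"
    unfolding breg_energy_def by (rule nn_integral_add) measurable
  finally show ?thesis .
qed

text \<open>
  Submodularity makes the running maxima of a minimizing sequence almost minimal, so their
  monotone limits can replace weak compactness.
\<close>

lemma obstacle_minimizer:
  fixes e m :: "'a::euclidean_space \<Rightarrow> real"
  assumes p: "1 < p" and [measurable]: "borel_fun e" and E: "gag s p e < \<infinity>"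
    and m: "\<And>x. 0 \<le> m x"
  obtains w where "borel_fun w" "\<And>x. 0 \<le> w x" "\<And>x. w x \<le> m x"
    "breg_energy s p e w < \<infinity>"
    "\<And>\<phi>. \<phi> \<in> borel_measurable borel \<Longrightarrow> (\<And>x. 0 \<le> \<phi> x) \<Longrightarrow> (\<And>x. \<phi> x \<le> m x) \<Longrightarrow>
       breg_energy s p e w \<le> breg_energy s p e \<phi>"
proof -
  define A where "A = {\<phi>. \<phi> \<in> borel_measurable borel \<and> (\<forall>x. 0 \<le> \<phi> x \<and> \<phi> x \<le> m x)}"
  define J where "J = (breg_energy s p e :: ('a \<Rightarrow> real) \<Rightarrow> ennreal)"
  define I where "I = (INF \<phi>\<in>A. J \<phi>)"
  have zero: "(\<lambda>x. 0) \<in> A" using m by (simp add: A_def)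
  have "J (\<lambda>x. 0) \<le> gag s p e"
    unfolding J_def breg_energy_def gag_def
  proof (intro nn_integral_mono ennreal_leI)
    fix w
    have "breg p (df e w) 0 = \<bar>df e w\<bar> powr p * (1 - 1 / p)"
      using pphi_mult_self[of p "df e w"] by (simp add: breg_def right_diff_distrib)
    also have "\<dots> \<le> \<bar>df e w\<bar> powr p"
      using p by (simp add: mult_left_le)
    finally show "breg p (df e w) (df (\<lambda>x. 0) w) \<le> \<bar>df e w\<bar> powr p" by simp
  qed
  then have I: "I < \<infinity>" unfolding I_def using zero E by (meson INF_lower le_less_trans)
  have I_le: "I \<le> J \<phi>" if "\<phi> \<in> A" for \<phi> unfolding I_def using that by (rule INF_lower)
  have "\<exists>\<phi>\<in>A. J \<phi> \<le> I + ennreal ((1/2) ^ n)" for n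
    using INF_approx_ennreal[OF _ I_def, of "(1/2) ^ n"] I by (auto simp: less_top intro: less_imp_le)
  then obtain \<phi> where \<phi>: "\<And>n. \<phi> n \<in> A" "\<And>n. J (\<phi> n) \<le> I + ennreal ((1/2) ^ n)" by metis
  have \<phi>m [measurable]: "borel_fun (\<phi> n)" for n using \<phi>(1) by (simp add: A_def)
  define R where "R n = run_max (\<lambda>i. \<phi> (n + i))" for n
  have Rm [measurable]: "borel_fun (R n j)" for n j unfolding R_def by measurable
  have R0: "0 \<le> R n j x" "R n j x \<le> m x" for n j x
  proof -
    have "0 \<le> \<phi> (n + 0) x" using \<phi>(1) by (simp add: A_def)
    also have "\<dots> \<le> R n j x" unfolding R_def by (rule le_run_max) simp
    finally show "0 \<le> R n j x" .
    show "R n j x \<le> m x" unfolding R_def run_max_le_iff using \<phi>(1) by (simp add: A_def)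
  qed
  have RA: "R n j \<in> A" for n j using R0 by (simp add: A_def)
  \<comment> \<open>The excesses (1/2)^(n+i) over the infimum add up for i from 0 to j; the
    difference in the bound is the sum of this geometric series.\<close>
  have RJ: "J (R n j) \<le> I + ennreal (2 * (1/2) ^ n - (1/2) ^ (n + j))" for n j
  proof (induction j)
    case 0
    then show ?case using \<phi>(2)[of n] by (simp add: R_def)
  next
    case (Suc j)
    let ?c = "2 * (1/2) ^ n - (1/2) ^ (n + j) :: real" and ?d = "(1/2) ^ (n + Suc j) :: real"
    have c: "0 \<le> ?c"
    proof -
      have "(1/2) ^ (n + j) \<le> (1/2 :: real) ^ n" by (intro power_decreasing) auto
      moreover have "0 \<le> (1/2 :: real) ^ n" by simp
      ultimately show ?thesis by linarith
    qed
    have min_A: "(\<lambda>x. min (R n j x) (\<phi> (n + Suc j) x)) \<in> A"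
      using RA[of n j] \<phi>(1)[of "n + Suc j"] by (auto simp: A_def min_le_iff_disj)
    \<comment> \<open>The minimum is itself admissible and so costs at least \<open>I\<close>; by
      submodularity the maximum then exceeds \<open>I\<close> by no more than both excesses
      together. Cancelling \<open>I\<close> at the end uses that it is finite.\<close>
    have "I + J (R n (Suc j)) \<le> J (\<lambda>x. max (R n j x) (\<phi> (n + Suc j) x)) + J (\<lambda>x. min (R n j x) (\<phi> (n + Suc j) x))"
      using I_le[OF min_A] by (simp add: R_def add.commute add_left_mono)
    also have "\<dots> \<le> J (R n j) + J (\<phi> (n + Suc j))"
      unfolding J_def by (rule breg_energy_submodular[OF p]) measurable
    also have "\<dots> \<le> (I + ennreal ?c) + (I + ennreal ?d)"
      using Suc \<phi>(2)[of "n + Suc j"] by (rule add_mono)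
    also have "\<dots> = I + (I + (ennreal ?c + ennreal ?d))" by (simp only: add_ac)
    also have "ennreal ?c + ennreal ?d = ennreal (?c + ?d)" by (rule ennreal_plus[OF c, symmetric]) simp
    also have "?c + ?d = 2 * (1/2) ^ n - (1/2) ^ (n + Suc j)" by simp
    finally show ?case using I by (auto simp: ennreal_add_left_cancel_le)
  qed
  define S where "S n x = (SUP j. R n j x)" for n x
  have bdd: "bdd_above (range (\<lambda>j. R n j x))" for n x using R0(2) by (intro bdd_aboveI2)
  have Rlim: "(\<lambda>j. R n j x) \<longlonglongrightarrow> S n x" for n x
    unfolding S_def using bdd by (intro LIMSEQ_incseq_SUP incseq_SucI) (auto simp: R_def)
  have Sm [measurable]: "borel_fun (S n)" for n
    by (rule borel_measurable_LIMSEQ_real[OF Rlim]) measurable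
  have S0: "0 \<le> S n x" "S n x \<le> m x" for n x
    using LIMSEQ_le_const[OF Rlim] LIMSEQ_le_const2[OF Rlim] R0 by blast+
  have S_anti: "S (Suc n) x \<le> S n x" for n x
  proof -
    have "R (Suc n) j x \<le> S n x" for j
    proof -
      have "R (Suc n) j x \<le> R n (Suc j) x"
        unfolding R_def run_max_le_iff
        using le_run_max[of "Suc i" "Suc j" "\<lambda>i. \<phi> (n + i)" x for i] by auto
      also have "\<dots> \<le> S n x" unfolding S_def by (rule cSUP_upper[OF _ bdd]) simp
      finally show ?thesis .
    qed
    then show ?thesis by (intro LIMSEQ_le_const2[OF Rlim]) blast
  qed
  have SJ: "J (S n) \<le> I + ennreal (2 * (1/2) ^ n)" for n
    unfolding J_def
  proof (rule breg_energy_lsc[OF p _ _ Rlim _ tendsto_const])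
    fix j
    have "J (R n j) \<le> I + ennreal (2 * (1/2) ^ n - (1/2) ^ (n + j))" by (rule RJ)
    also have "\<dots> \<le> I + ennreal (2 * (1/2) ^ n)" by (intro add_left_mono ennreal_leI) simp
    finally show "breg_energy s p e (R n j) \<le> I + ennreal (2 * (1/2) ^ n)" by (simp add: J_def)
  qed measurable
  \<comment> \<open>This is the pointwise limit superior of the minimizing sequence. The excess of
    \<open>S n\<close> is at most 2 (1/2)^n, which tends to 0, so \<open>w\<close> attains the
    infimum.\<close>
  define w where "w x = (INF n. S n x)" for x
  have Slim: "(\<lambda>n. S n x) \<longlonglongrightarrow> w x" for x
    unfolding w_def by (intro LIMSEQ_decseq_INF decseq_SucI S_anti bdd_belowI2[of _ 0] S0)
  have wm: "borel_fun w"
    by (rule borel_measurable_LIMSEQ_real[OF Slim]) measurable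
  have w0: "0 \<le> w x" "w x \<le> m x" for x
    using LIMSEQ_le_const[OF Slim] LIMSEQ_le_const2[OF Slim] S0 by blast+
  have wJ: "J w \<le> I"
    unfolding J_def
  proof (rule breg_energy_lsc[OF p _ _ Slim SJ[unfolded J_def]])
    have "(\<lambda>n. 2 * (1/2) ^ n :: real) \<longlonglongrightarrow> 2 * 0"
      by (intro tendsto_mult tendsto_const LIMSEQ_power_zero) simp
    from tendsto_add[OF tendsto_const tendsto_ennrealI[OF this], of I]
    show "(\<lambda>n. I + ennreal (2 * (1/2) ^ n)) \<longlonglongrightarrow> I" by simp
  qed measurable
  show ?thesis
  proof (rule that[OF wm w0])
    show "breg_energy s p e w < \<infinity>" using wJ I by (simp add: J_def)
    show "breg_energy s p e w \<le> breg_energy s p e \<phi>" if "borel_fun \<phi>" "\<And>x. 0 \<le> \<phi> x" "\<And>x. \<phi> x \<le> m x" for \<phi>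
      using order_trans[OF wJ I_le[of \<phi>]] that by (simp add: A_def J_def)
  qed
qed

lemma gag_finite_breg_energy:
  fixes e w :: "'a::euclidean_space \<Rightarrow> real"
  assumes p: "1 < p" and [measurable]: "borel_fun e" "borel_fun w"
    and E: "gag s p e < \<infinity>" "breg_energy s p e w < \<infinity>"
  shows "gag s p w < \<infinity>"
proof -
  obtain C where C: "0 \<le> C" "\<And>a b. \<bar>a\<bar> powr p \<le> C * (breg p b a + \<bar>b\<bar> powr p)"
    using powr_le_breg[OF p] by blast
  have "gag s p w \<le> (\<integral>\<^sup>+z. ennreal C * (ennreal (breg p (df e z) (df w z)) + ennreal (\<bar>df e z\<bar> powr p)) \<partial>mu s p)"
    unfolding gag_def using C breg_nonneg[OF p]
    by (intro nn_integral_mono) (simp add: ennreal_leI flip: ennreal_plus ennreal_mult)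
  also have "\<dots> = ennreal C * (breg_energy s p e w + gag s p e)"
    by (simp add: nn_integral_cmult nn_integral_add breg_energy_def gag_def)
  also have "\<dots> < \<infinity>" using E by (simp add: ennreal_mult_less_top)
  finally show ?thesis .
qed

text \<open>Formulated through increments so that one statement covers sums, differences and
  minima.\<close>

lemma gag_finite_add:
  fixes a b c :: "'a::euclidean_space \<Rightarrow> real"
  assumes p: "1 < p" and [measurable]: "borel_fun a" "borel_fun b" "borel_fun c"
    and "gag s p a < \<infinity>" "gag s p b < \<infinity>" and le: "\<And>w. \<bar>df c w\<bar> \<le> \<bar>df a w\<bar> + \<bar>df b w\<bar>"
  shows "gag s p c \<le> ennreal (2 powr p) * (gag s p a + gag s p b)" "gag s p c < \<infinity>"
proof -
  show *: "gag s p c \<le> ennreal (2 powr p) * (gag s p a + gag s p b)"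
    unfolding gag_def using p le by (intro nn_integral_powr_add_le) auto
  show "gag s p c < \<infinity>"
    using assms by (intro le_less_trans[OF *]) (simp add: ennreal_mult_less_top)
qed

lemma integrable_breg:
  fixes a b :: "'a::euclidean_space \<Rightarrow> real"
  assumes p: "1 < p" and [measurable]: "borel_fun a" "borel_fun b"
    and "gag s p a < \<infinity>" "gag s p b < \<infinity>"
  shows "integrable (mu s p) (\<lambda>w. breg p (df b w) (df a w))"
proof -
  have 1: "integrable (mu s p) (\<lambda>w. \<bar>df a w\<bar> powr p)" "integrable (mu s p) (\<lambda>w. \<bar>df b w\<bar> powr p)"
    using assms by (auto intro!: integrableI_nonneg simp: gag_def)
  have "integrable (mu s p) (\<lambda>w. pphi p (df b w) * df a w)"
    using assms by (intro integrable_pphi_mult) (auto simp: gag_def)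
  then have "integrable (mu s p) (\<lambda>w. \<bar>df a w\<bar> powr p / p - \<bar>df b w\<bar> powr p / p - (pphi p (df b w) * df a w - \<bar>df b w\<bar> powr p))"
    using 1 by (intro Bochner_Integration.integrable_diff integrable_divide_zero) auto
  moreover have "pphi p y * (x - y) = pphi p y * x - \<bar>y\<bar> powr p" for x y
    using pphi_mult_self[of p y] by (simp add: right_diff_distrib)
  ultimately show ?thesis by (simp only: breg_def)
qed

lemma integrable_gag_form:
  fixes a b :: "'a::euclidean_space \<Rightarrow> real"
  assumes "1 < p" "borel_fun a" "borel_fun b" "gag s p a < \<infinity>" "gag s p b < \<infinity>"
  shows "integrable (mu s p) (\<lambda>w. pphi p (df a w) * df b w)"
  using assms by (intro integrable_pphi_mult) (auto simp: gag_def intro!: borel_measurable_diff measurable_compose[OF borel_measurable_fst_snd(1)] measurable_compose[OF borel_measurable_fst_snd(2)])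

lemma abs_min_diff_le: "\<bar>min a b - min c d\<bar> \<le> \<bar>a - c\<bar> + \<bar>b - d\<bar>" for a b c d :: real
  by (auto simp: min_def abs_if)

lemma abs_max_diff_le: "\<bar>max a b - max c d\<bar> \<le> \<bar>a - c\<bar> + \<bar>b - d\<bar>" for a b c d :: real
  by (auto simp: max_def abs_if)

text \<open>
  Where both excesses \<open>(a\<^sub>i - v\<^sub>i)\<^sup>+\<close> are positive, both minima are \<open>v\<^sub>i\<close>; where only one is, the other
  minimum is at most \<open>v\<^sub>i\<close>.
\<close>

lemma pphi_obstacle_le:
  fixes a1 a2 v1 v2 :: real
  assumes p: "1 < p"
  shows "pphi p (v1 - v2) * (max (a1 - v1) 0 - max (a2 - v2) 0)
    \<le> pphi p (min a1 v1 - min a2 v2) * (max (a1 - v1) 0 - max (a2 - v2) 0)"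
proof -
  consider "a1 \<ge> v1" "a2 \<ge> v2" | "a1 \<ge> v1" "a2 \<le> v2" | "a1 \<le> v1" "a2 \<ge> v2" | "a1 \<le> v1" "a2 \<le> v2"
    by linarith
  then show ?thesis
  proof cases
    case 2
    then show ?thesis using p by (simp add: max_def min_def) (auto intro!: mult_right_mono pphi_mono)
  next
    case 3
    then show ?thesis using p by (simp add: max_def min_def) (auto intro!: mult_right_mono pphi_mono)
  qed (auto simp: max_def min_def)
qed

section \<open>The first-order inequality at the minimizer\<close>

locale truncated_minimizer = sub_super s p \<gamma> \<Omega> f U V
  for s p \<gamma> :: real and \<Omega> :: "'a::euclidean_space set" and f U V :: "'a \<Rightarrow> real" +
  fixes \<epsilon> :: real and e w :: "'a \<Rightarrow> real"
  assumes \<epsilon>: "0 < \<epsilon>" and e: "e = (\<lambda>x. max (U x - \<epsilon>) 0)" and E: "gag s p e < \<infinity>"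
    and w_borel [measurable]: "borel_fun w" and w: "\<And>x. 0 \<le> w x" "\<And>x. w x \<le> V x" "\<And>x. w x \<le> e x"
    and Ew: "breg_energy s p e w < \<infinity>"
    and min: "\<And>\<phi>. \<phi> \<in> borel_measurable borel \<Longrightarrow> (\<And>x. 0 \<le> \<phi> x) \<Longrightarrow> (\<And>x. \<phi> x \<le> V x) \<Longrightarrow> (\<And>x. \<phi> x \<le> e x) \<Longrightarrow>
       breg_energy s p e w \<le> breg_energy s p e \<phi>"
begin

lemma e_borel [measurable]: "borel_fun e" unfolding e by measurable

lemma gag_w: "gag s p w < \<infinity>" by (rule gag_finite_breg_energy[OF p e_borel w_borel E Ew])

text \<open>Minimality of \<open>w\<close> is combined with the tangent inequality at the competitor
  \<open>P\<close>, not at \<open>w\<close>; hence no difference quotient is taken and the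
  competitor appears in the conclusion. As \<open>P - w = t * \<psi> - R\<close>, the difference of
  the forms of \<open>P\<close> and \<open>e\<close> is nonnegative on
  \<open>t * \<psi> - R\<close>, and the term with \<open>R\<close> has a favourable sign.\<close>

lemma minimizer_step:
  assumes \<psi>: "bump_like s p \<Omega> \<psi>" "\<And>x. \<psi> x \<le> e x - w x" and t: "0 < t" "t \<le> 1"
  shows "form s p e \<psi> \<le> form s p (\<lambda>x. min (w x + t * \<psi> x) (V x)) \<psi>"
proof -
  have [measurable]: "borel_fun \<psi>" and \<psi>': "\<And>x. 0 \<le> \<psi> x" "gag s p \<psi> < \<infinity>"
    using \<psi> by (auto simp: bump_like_def)
  obtain K M where K: "compact K" "K \<subseteq> \<Omega>" "\<And>x. x \<notin> K \<Longrightarrow> \<psi> x = 0" "\<And>x. \<psi> x \<le> M"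
    using \<psi>(1) unfolding bump_like_def by metis
  define P where "P x = min (w x + t * \<psi> x) (V x)" for x
  define R where "R x = max (w x + t * \<psi> x - V x) 0" for x
  have [measurable]: "borel_fun P" "borel_fun R" unfolding P_def R_def by measurable
  have PR: "P x = w x + t * \<psi> x - R x" for x by (simp add: P_def R_def min_def max_def)
  have t\<psi>: "t * \<psi> x \<le> \<psi> x" "0 \<le> t * \<psi> x" for x using t \<psi>'(1)[of x] by (auto simp: mult_left_le_one_le)
  have R_le: "0 \<le> R x" "R x \<le> t * \<psi> x" for x using w(2)[of x] t\<psi>(2)[of x] by (auto simp: R_def)
  have R: "bump_like s p \<Omega> R"
  proof -
    have R0: "R x = 0" if "x \<notin> K" for x using R_le[of x] K(3)[OF that] by simp
    have RM: "R x \<le> M" for x using R_le[of x] t\<psi>[of x] K(4)[of x] by linarith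
    \<comment> \<open>\<open>V\<close> has only local energy, so the finite energy of
      \<open>R\<close> must come from its boundedness and compact support.\<close>
    have "gag s p R < \<infinity>"
    proof (rule gag_finite_local[OF p s(1) \<Omega> K(1,2), where M = M])
      fix K' assume K': "compact K'" "K' \<subseteq> \<Omega>"
      have [measurable]: "K' \<times> K' \<in> sets borel"
        using K' by (intro borel_closed closed_Times compact_imp_closed) auto
      let ?i = "\<lambda>z. indicator (K' \<times> K') z :: real"
      define a where "a z = \<bar>?i z * df w z\<bar> + \<bar>?i z * df \<psi> z\<bar>" for z
      have [measurable]: "borel_fun a" unfolding a_def by measurable
      have i_le: "Lp_int p (mu s p) (\<lambda>z. ?i z * df h z) < \<infinity>" if "gag s p h < \<infinity>" for h
      proof (rule le_less_trans[OF nn_integral_mono that[unfolded gag_def]])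
        show "ennreal (\<bar>?i z * df h z\<bar> powr p) \<le> ennreal (\<bar>df h z\<bar> powr p)" for z
          using p by (auto split: split_indicator)
      qed
      have "Lp_int p (mu s p) a \<le> ennreal (2 powr p) *
          (Lp_int p (mu s p) (\<lambda>z. ?i z * df w z) + Lp_int p (mu s p) (\<lambda>z. ?i z * df \<psi> z))"
        using p by (intro nn_integral_powr_add_le) (auto simp: a_def)
      also have "\<dots> < \<infinity>" using i_le[OF gag_w] i_le[OF \<psi>'(2)] by (simp add: ennreal_mult_less_top)
      finally have a: "Lp_int p (mu s p) a < \<infinity>" .
      have "Lp_int p (mu s p) (\<lambda>z. ?i z * df R z) \<le> ennreal (2 powr p) *
          (Lp_int p (mu s p) a + Lp_int p (mu s p) (\<lambda>z. ?i z * df V z))"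
      proof (rule nn_integral_powr_add_le)
        fix z :: "'a \<times> 'a"
        have "\<bar>t * df \<psi> z\<bar> \<le> \<bar>df \<psi> z\<bar>"
          unfolding abs_mult using t by (simp add: mult_left_le_one_le)
        moreover have "(w (fst z) + t * \<psi> (fst z) - V (fst z)) - (w (snd z) + t * \<psi> (snd z) - V (snd z))
            = df w z + t * df \<psi> z - df V z"
          by (simp add: algebra_simps)
        moreover note abs_max_diff_le[of "w (fst z) + t * \<psi> (fst z) - V (fst z)" 0 "w (snd z) + t * \<psi> (snd z) - V (snd z)" 0,
          folded R_def]
        ultimately have "\<bar>df R z\<bar> \<le> \<bar>df w z\<bar> + \<bar>df \<psi> z\<bar> + \<bar>df V z\<bar>" by linarith
        then show "\<bar>?i z * df R z\<bar> \<le> \<bar>a z\<bar> + \<bar>?i z * df V z\<bar>"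
          by (auto simp: a_def split: split_indicator)
      qed (use p in auto)
      also have "\<dots> < \<infinity>" using a loc_energyD[OF V(1) K'] by (simp add: ennreal_mult_less_top)
      finally show "Lp_int p (mu s p) (\<lambda>z. ?i z * df R z) < \<infinity>" .
    qed (use R_le RM R0 in \<open>auto simp: abs_of_nonneg\<close>)
    then show ?thesis unfolding bump_like_def using R_le(1) RM R0 K by auto
  qed
  then have gR: "gag s p R < \<infinity>" by (simp add: bump_like_def)
  have gt: "gag s p (\<lambda>x. t * \<psi> x - R x) < \<infinity>"
  proof (rule gag_finite_add(2)[OF p _ _ _ \<psi>'(2) gR])
    fix z
    have "\<bar>t * df \<psi> z\<bar> \<le> \<bar>df \<psi> z\<bar>"
      unfolding abs_mult using t by (simp add: mult_left_le_one_le)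
    then show "\<bar>df (\<lambda>x. t * \<psi> x - R x) z\<bar> \<le> \<bar>df \<psi> z\<bar> + \<bar>df R z\<bar>" by (simp add: algebra_simps)
  qed measurable
  have gP: "gag s p P < \<infinity>"
    by (rule gag_finite_add(2)[OF p _ _ _ gag_w gt]) (auto simp: PR)
  have eP: "P x \<le> e x" "P x \<le> V x" "0 \<le> P x" for x
    using \<psi>(2)[of x] t\<psi>[of x] w(1)[of x] V(2)[of x] by (auto simp: P_def min_def)
  have "breg_energy s p e w \<le> breg_energy s p e P" by (rule min) (use eP in auto)
  then have le1: "(\<integral>z. breg p (df e z) (df w z) \<partial>mu s p) \<le> (\<integral>z. breg p (df e z) (df P z) \<partial>mu s p)"
    unfolding breg_energy_def using integrable_breg[OF p _ _ gag_w E] integrable_breg[OF p _ _ gP E] breg_nonneg[OF p]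
    by (simp add: nn_integral_eq_integral)
  have i1: "integrable (mu s p) (\<lambda>z. pphi p (df P z) * df h z)" "integrable (mu s p) (\<lambda>z. pphi p (df e z) * df h z)"
    if "gag s p h < \<infinity>" "borel_fun h" for h
    using that gP E by (auto intro!: integrable_gag_form p)
  have tan: "breg p (df e z) (df P z) - (pphi p (df P z) - pphi p (df e z)) * (t * df \<psi> z - df R z) \<le> breg p (df e z) (df w z)" for z
  proof -
    have "df w z - df P z = - (t * df \<psi> z - df R z)" by (simp add: PR algebra_simps)
    then have "(pphi p (df P z) - pphi p (df e z)) * (df w z - df P z)
        = - ((pphi p (df P z) - pphi p (df e z)) * (t * df \<psi> z - df R z))"
      by (simp only: mult_minus_right)
    then show ?thesis using breg_tangent[OF p, of "df e z" "df P z" "df w z"] by linarith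
  qed
  have expand: "(pphi p (df P z) - pphi p (df e z)) * (t * df \<psi> z - df R z)
     = t * (pphi p (df P z) * df \<psi> z) - t * (pphi p (df e z) * df \<psi> z)
       - pphi p (df P z) * df R z + pphi p (df e z) * df R z" for z
    by (simp add: algebra_simps)
  have ib: "integrable (mu s p) (\<lambda>z. breg p (df e z) (df P z))" "integrable (mu s p) (\<lambda>z. breg p (df e z) (df w z))"
    using integrable_breg[OF p _ _ gP E] integrable_breg[OF p _ _ gag_w E] by auto
  have iprod: "integrable (mu s p) (\<lambda>z. (pphi p (df P z) - pphi p (df e z)) * (t * df \<psi> z - df R z))"
    unfolding expand using i1[OF \<psi>'(2)] i1[OF gR] by auto
  have "(\<integral>z. breg p (df e z) (df P z) - (pphi p (df P z) - pphi p (df e z)) * (t * df \<psi> z - df R z) \<partial>mu s p)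
      \<le> (\<integral>z. breg p (df e z) (df w z) \<partial>mu s p)"
    by (rule integral_mono[OF Bochner_Integration.integrable_diff[OF ib(1) iprod] ib(2) tan])
  with le1 have "0 \<le> (\<integral>z. (pphi p (df P z) - pphi p (df e z)) * (t * df \<psi> z - df R z) \<partial>mu s p)"
    using ib iprod by simp
  also have "\<dots> = t * form s p P \<psi> - t * form s p e \<psi> - form s p P R + form s p e R"
    unfolding expand form_def using i1[OF \<psi>'(2)] i1[OF gR] by simp
  finally have A: "0 \<le> t * form s p P \<psi> - t * form s p e \<psi> - form s p P R + form s p e R" .
  \<comment> \<open>On the support of \<open>R\<close> the obstacle \<open>V\<close> lies below
    \<open>e\<close>; here the two weak inequalities enter.\<close>
  have B: "form s p e R \<le> form s p V R"
    unfolding e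
  proof (rule form_truncation_le[OF \<epsilon> E[unfolded e] R])
    fix x assume "R x \<noteq> 0"
    then have "V x < w x + t * \<psi> x" using R_le(1)[of x] by (auto simp: R_def max_def split: if_splits)
    also have "\<dots> \<le> e x" using \<psi>(2)[of x] t\<psi>[of x] by simp
    finally show "V x < max (U x - \<epsilon>) 0" by (simp add: e)
  qed
  have C: "form s p V R \<le> form s p P R"
    unfolding form_def
  proof (rule integral_mono[OF form_integrable[OF p s(1) \<Omega> V(1) R] i1(1)[OF gR]])
    show "pphi p (df V z) * df R z \<le> pphi p (df P z) * df R z" for z
      unfolding P_def R_def by (rule pphi_obstacle_le[OF p])
  qed measurable
  from A B C have "t * form s p e \<psi> \<le> t * form s p P \<psi>" by linarith
  then show ?thesis using t by (simp add: P_def[abs_def])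
qed

text \<open>The limit t \<open>\<rightarrow>\<close> 0 of the preceding inequality. The test
  function stays fixed and only the first argument of the form moves, so dominated convergence
  suffices.\<close>

lemma minimizer_supersolution:
  assumes \<psi>: "bump_like s p \<Omega> \<psi>" "\<And>x. \<psi> x \<le> e x - w x"
  shows "form s p e \<psi> \<le> form s p w \<psi>"
proof -
  have [measurable]: "borel_fun \<psi>" and \<psi>': "\<And>x. 0 \<le> \<psi> x" "gag s p \<psi> < \<infinity>"
    using \<psi> by (auto simp: bump_like_def)
  define t where "t n = inverse (real (Suc n))" for n
  have t: "0 < t n" "t n \<le> 1" for n by (auto simp: t_def field_simps)
  have tlim: "t \<longlonglongrightarrow> 0" unfolding t_def[abs_def] by (rule LIMSEQ_inverse_real_of_nat)
  define P where "P n x = min (w x + t n * \<psi> x) (V x)" for n x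
  have [measurable]: "borel_fun (P n)" for n unfolding P_def by measurable
  have Plim: "(\<lambda>n. P n x) \<longlonglongrightarrow> w x" for x
  proof -
    have "(\<lambda>n. P n x) \<longlonglongrightarrow> min (w x + 0 * \<psi> x) (V x)"
      unfolding P_def by (intro tendsto_min tendsto_add tendsto_mult tlim tendsto_const)
    then show ?thesis using w(2)[of x] by (simp add: min_absorb1)
  qed
  define q where "q = p - 1"
  have q: "0 < q" using p by (simp add: q_def)
  \<comment> \<open>The majorant comes from |df (P n)| \<open>\<le>\<close> |df w| + |df
    \<open>\<psi>\<close>| + |df V| by using \<open>powr_add_le\<close> twice. Its term with
    \<open>V\<close> is integrable because \<open>\<psi>\<close> is
    \<open>bump_like\<close>.\<close>
  define G where "G z = 2 powr q * (2 powr q * (\<bar>pphi p (df w z) * df \<psi> z\<bar> + \<bar>pphi p (df \<psi> z) * df \<psi> z\<bar>) + \<bar>pphi p (df V z) * df \<psi> z\<bar>)" for z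
  have G: "integrable (mu s p) G"
    unfolding G_def using integrable_gag_form[OF p _ _ gag_w \<psi>'(2)] integrable_gag_form[OF p _ _ \<psi>'(2) \<psi>'(2)]
      form_integrable[OF p s(1) \<Omega> V(1) \<psi>(1)]
    by (intro integrable_mult_right Bochner_Integration.integrable_add integrable_abs) auto
  have "(\<lambda>n. form s p (P n) \<psi>) \<longlonglongrightarrow> form s p w \<psi>"
    unfolding form_def
  proof (rule integral_dominated_convergence[OF _ _ G])
    show "AE z in mu s p. (\<lambda>n. pphi p (df (P n) z) * df \<psi> z) \<longlonglongrightarrow> pphi p (df w z) * df \<psi> z"
      using p by (intro AE_I2 tendsto_mult tendsto_pphi tendsto_diff tendsto_const Plim)
    show "AE z in mu s p. norm (pphi p (df (P n) z) * df \<psi> z) \<le> G z" for n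
    proof (rule AE_I2)
      fix z :: "'a \<times> 'a"
      have "\<bar>t n * df \<psi> z\<bar> \<le> \<bar>df \<psi> z\<bar>"
        unfolding abs_mult using t[of n] by (simp add: mult_left_le_one_le)
      moreover have "(w (fst z) + t n * \<psi> (fst z)) - (w (snd z) + t n * \<psi> (snd z))
          = df w z + t n * df \<psi> z"
        by (simp add: algebra_simps)
      moreover note abs_min_diff_le[of "w (fst z) + t n * \<psi> (fst z)" "V (fst z)" "w (snd z) + t n * \<psi> (snd z)" "V (snd z)",
        folded P_def]
      ultimately have "\<bar>df (P n) z\<bar> \<le> \<bar>df w z\<bar> + \<bar>df \<psi> z\<bar> + \<bar>df V z\<bar>" by linarith
      then have "\<bar>df (P n) z\<bar> powr q \<le> (\<bar>df w z\<bar> + \<bar>df \<psi> z\<bar> + \<bar>df V z\<bar>) powr q"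
        using q by (intro powr_mono2) auto
      also have "\<dots> \<le> 2 powr q * ((\<bar>df w z\<bar> + \<bar>df \<psi> z\<bar>) powr q + \<bar>df V z\<bar> powr q)"
        using q by (intro powr_add_le) auto
      also have "\<dots> \<le> 2 powr q * (2 powr q * (\<bar>df w z\<bar> powr q + \<bar>df \<psi> z\<bar> powr q) + \<bar>df V z\<bar> powr q)"
        using q by (intro mult_left_mono add_right_mono powr_add_le) auto
      finally have "\<bar>df (P n) z\<bar> powr q * \<bar>df \<psi> z\<bar>
          \<le> 2 powr q * (2 powr q * (\<bar>df w z\<bar> powr q + \<bar>df \<psi> z\<bar> powr q) + \<bar>df V z\<bar> powr q) * \<bar>df \<psi> z\<bar>"
        by (rule mult_right_mono) simp
      then show "norm (pphi p (df (P n) z) * df \<psi> z) \<le> G z"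
        unfolding G_def real_norm_def abs_mult abs_pphi q_def[symmetric]
        by (simp only: distrib_left distrib_right mult.assoc)
    qed
  qed measurable
  moreover have "form s p e \<psi> \<le> form s p (P n) \<psi>" for n
    unfolding P_def by (rule minimizer_step[OF \<psi> t])
  ultimately show ?thesis by (intro LIMSEQ_le_const) auto
qed

end

subsection \<open>Approximation by functions of compact support\<close>

text \<open>The vector \<open>e\<close> points into the domain. A boundary point is on or below the
  graph, hence strictly below after lowering by \<open>\<tau>\<close>, and by continuity so are its
  neighbours. The bound \<open>\<tau> < r / 2\<close> keeps the lowered points in the ball where the
  graph describes \<open>\<Omega>\<close>.\<close>

lemma outward_translation:
  fixes \<Omega> :: "'a::euclidean_space set"
  assumes \<Omega>: "smooth_bounded_domain \<Omega>" and x0: "x0 \<in> frontier \<Omega>"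
  obtains r e where "0 < r" "\<And>\<tau> x. 0 < \<tau> \<Longrightarrow> \<tau> < r / 2 \<Longrightarrow> x \<in> frontier \<Omega> \<Longrightarrow> x \<in> ball x0 (r / 2) \<Longrightarrow>
     \<exists>N. open N \<and> x \<in> N \<and> N \<subseteq> ball x0 (r / 2) \<and> (\<forall>y\<in>N. y - \<tau> *\<^sub>R e \<notin> \<Omega>)"
proof -
  obtain r e g where r: "0 < r" and e: "norm e = 1" and g: "smooth g"
    and graph: "\<Omega> \<inter> ball x0 r = {x \<in> ball x0 r. x \<bullet> e > g (x - (x \<bullet> e) *\<^sub>R e)}"
    using \<Omega> x0 unfolding smooth_bounded_domain_def by blast
  have gc: "continuous_on UNIV g" using g unfolding smooth_def by (metis Ck.simps(1))
  have ee: "e \<bullet> e = 1" using e by (simp add: norm_eq_1)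
  have op: "open \<Omega>" using \<Omega> by (simp add: smooth_bounded_domain_def)
  show ?thesis
  proof (rule that[OF r, of e])
    fix \<tau> x assume \<tau>: "0 < \<tau>" "\<tau> < r / 2" and x: "x \<in> frontier \<Omega>" "x \<in> ball x0 (r / 2)"
    \<comment> \<open>The height of \<open>y - \<tau> *\<^sub>R e\<close> above the graph: lowering
      along \<open>e\<close> does not change the projection to the hyperplane.\<close>
    define F where "F y = y \<bullet> e - \<tau> - g (y - (y \<bullet> e) *\<^sub>R e)" for y
    have Fc: "continuous_on UNIV F" unfolding F_def
      by (intro continuous_intros continuous_on_compose2[OF gc]) auto
    define N where "N = ball x0 (r / 2) \<inter> {y. F y < 0}"
    have "open N" unfolding N_def by (intro open_Int open_ball open_Collect_less Fc continuous_on_const)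
    moreover have "x \<in> N"
    proof -
      have "x \<notin> \<Omega>" using x(1) op by (simp add: frontier_def interior_open)
      moreover have "x \<in> ball x0 r" using x(2) r by simp
      ultimately have "\<not> x \<bullet> e > g (x - (x \<bullet> e) *\<^sub>R e)" using graph by blast
      then show ?thesis using x(2) \<tau> by (simp add: N_def F_def)
    qed
    moreover have "y - \<tau> *\<^sub>R e \<notin> \<Omega>" if y: "y \<in> N" for y
    proof
      assume in\<Omega>: "y - \<tau> *\<^sub>R e \<in> \<Omega>"
      have "dist x0 (y - \<tau> *\<^sub>R e) \<le> dist x0 y + dist y (y - \<tau> *\<^sub>R e)" by (rule dist_triangle)
      also have "dist y (y - \<tau> *\<^sub>R e) = \<tau>" using e \<tau> by (simp add: dist_norm)
      finally have "y - \<tau> *\<^sub>R e \<in> ball x0 r" using y \<tau> by (simp add: N_def)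
      then have "(y - \<tau> *\<^sub>R e) \<bullet> e > g (y - \<tau> *\<^sub>R e - ((y - \<tau> *\<^sub>R e) \<bullet> e) *\<^sub>R e)"
        using graph in\<Omega> by blast
      moreover have eq: "(y - \<tau> *\<^sub>R e) \<bullet> e = y \<bullet> e - \<tau>" by (simp add: inner_diff_left ee)
      moreover have "y - \<tau> *\<^sub>R e - (y \<bullet> e - \<tau>) *\<^sub>R e = y - (y \<bullet> e) *\<^sub>R e" by (simp add: algebra_simps)
      ultimately have "F y > 0" by (simp only: F_def diff_gt_0_iff_gt)
      then show False using y by (simp add: N_def)
    qed
    ultimately show "\<exists>N. open N \<and> x \<in> N \<and> N \<subseteq> ball x0 (r / 2) \<and> (\<forall>y\<in>N. y - \<tau> *\<^sub>R e \<notin> \<Omega>)"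
      by (intro exI[of _ N]) (auto simp: N_def)
  qed
qed

text \<open>For r > 0 this is 1 on the ball of radius r / 2, 0 outside the one of radius r, and
  Lipschitz with constant 2 / r, hence of finite energy.\<close>

definition cutoff :: "'a::euclidean_space \<Rightarrow> real \<Rightarrow> 'a \<Rightarrow> real" where
  "cutoff x0 r x = max 0 (min 1 (2 - 2 / r * dist x0 x))"

lemma cutoff_measurable [measurable]: "borel_fun (cutoff x0 r)"
  unfolding cutoff_def by measurable

lemma cutoff_bounds: "0 \<le> cutoff x0 r x" "cutoff x0 r x \<le> 1"
  by (auto simp: cutoff_def)

lemma cutoff_eq_1: "0 < r \<Longrightarrow> x \<in> ball x0 (r / 2) \<Longrightarrow> cutoff x0 r x = 1"
  by (simp add: cutoff_def field_simps)

lemma gag_cutoff_finite: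
  fixes x0 :: "'a::euclidean_space"
  assumes "1 < p" "0 < s" "s < 1" and r: "0 < r"
  shows "gag s p (cutoff x0 r) < \<infinity>"
proof (rule gag_lipschitz_finite[OF assms(1-3), where L = "2 / r" and M = 1 and B = "ball x0 r"])
  fix x y :: 'a
  have "\<bar>cutoff x0 r x - cutoff x0 r y\<bar> \<le> \<bar>2 / r * dist x0 x - 2 / r * dist x0 y\<bar>"
    by (auto simp: cutoff_def max_def min_def)
  also have "\<dots> = 2 / r * \<bar>dist x0 x - dist x0 y\<bar>"
    unfolding right_diff_distrib[symmetric] abs_mult using r by simp
  also have "\<dots> \<le> 2 / r * norm (x - y)"
    using r abs_dist_diff_le[of x x0 y] by (intro mult_left_mono) (auto simp: dist_commute dist_norm)
  finally show "\<bar>cutoff x0 r x - cutoff x0 r y\<bar> \<le> 2 / r * norm (x - y)" .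
  show "\<bar>cutoff x0 r x\<bar> \<le> 1" using cutoff_bounds[of x0 r x] by simp
  show "cutoff x0 r x = 0" if "x \<notin> ball x0 r"
    using that r by (simp add: cutoff_def field_simps)
qed (use r emeasure_lborel_ball_finite[of x0 r] in auto)

text \<open>
  Shifting \<open>m\<close> outwards near each boundary point moves its support away from the boundary; the
  summand \<open>1 - cutoff\<close> makes each shifted copy irrelevant (for \<open>m \<le> 1\<close>) away from its chart.
\<close>

primrec shifted_min :: "('a::euclidean_space \<Rightarrow> real) \<Rightarrow> real \<Rightarrow> ('a \<times> real \<times> 'a) list \<Rightarrow> 'a \<Rightarrow> real" where
  "shifted_min m \<tau> [] = m"
| "shifted_min m \<tau> (c # L) = (\<lambda>x. min (m (x - \<tau> *\<^sub>R snd (snd c)) + (1 - cutoff (fst c) (fst (snd c)) x)) (shifted_min m \<tau> L x))"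

lemma shifted_min_measurable:
  "borel_fun m \<Longrightarrow> borel_fun (shifted_min m \<tau> L)"
proof (induction L)
  case (Cons c L)
  then have [measurable]: "borel_fun m" "borel_fun (shifted_min m \<tau> L)" by auto
  show ?case by simp
qed simp

lemma shifted_min_nonneg: "(\<And>x. 0 \<le> m x) \<Longrightarrow> 0 \<le> shifted_min m \<tau> L x"
  by (induction L) (auto simp: add_nonneg_nonneg cutoff_bounds)

lemma shifted_min_le: "shifted_min m \<tau> L x \<le> m x"
  by (induction L) (auto intro: min.coboundedI2)

text \<open>On the half ball the cutoff equals 1, so the entry of that chart is the bare shifted
  value, which is 0.\<close>

lemma shifted_min_eq_0:
  assumes "(x0, r, e) \<in> set L" "0 < r" "x \<in> ball x0 (r / 2)" "m (x - \<tau> *\<^sub>R e) = 0" "\<And>x. 0 \<le> m x"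
  shows "shifted_min m \<tau> L x = 0"
proof -
  have "shifted_min m \<tau> L x \<le> 0"
    using assms(1)
  proof (induction L)
    case (Cons c L)
    show ?case
    proof (cases "c = (x0, r, e)")
      case True
      then show ?thesis using assms cutoff_eq_1[of r x x0] by (simp add: min_le_iff_disj)
    next
      case False
      then show ?thesis using Cons by (simp add: min_le_iff_disj)
    qed
  qed simp
  then show ?thesis using shifted_min_nonneg[of m \<tau> L x] assms(5) by simp
qed

lemma gag_translate:
  fixes m :: "'a::euclidean_space \<Rightarrow> real"
  assumes [measurable]: "borel_fun m"
  shows "gag s p (\<lambda>x. m (x - c)) = gag s p m"
  unfolding gag_def
  using nn_integral_mu_translate[of "\<lambda>w. ennreal (\<bar>df m w\<bar> powr p)" s p "- c"] by simp

text \<open>The bound is uniform in \<open>\<tau>\<close>, because translations preserve the energy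
  and the cutoffs do not depend on \<open>\<tau>\<close>.\<close>

lemma gag_shifted_min_bounded:
  fixes m :: "'a::euclidean_space \<Rightarrow> real"
  assumes p: "1 < p" "0 < s" "s < 1" and m [measurable]: "borel_fun m" and g: "gag s p m < \<infinity>"
    and L: "\<And>x0 r e. (x0, r, e) \<in> set L \<Longrightarrow> 0 < r"
  shows "\<exists>C<\<infinity>. \<forall>\<tau>. gag s p (shifted_min m \<tau> L) \<le> C"
  using L
proof (induction L)
  case Nil
  then show ?case using g by auto
next
  case (Cons c L)
  obtain x0 r e where c: "c = (x0, r, e)" by (cases c) auto
  have r: "0 < r" using Cons.prems c by auto
  obtain C where C: "C < \<infinity>" "\<And>\<tau>. gag s p (shifted_min m \<tau> L) \<le> C" using Cons by auto
  define D where "D = ennreal (2 powr p) * (gag s p m + gag s p (cutoff x0 r))"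
  have D: "D < \<infinity>" unfolding D_def using g gag_cutoff_finite[OF p r, of x0] by (simp add: ennreal_mult_less_top)
  have "gag s p (shifted_min m \<tau> (c # L)) \<le> ennreal (2 powr p) * (D + C)" for \<tau>
  proof -
    note [measurable] = shifted_min_measurable[OF m, of \<tau> L]
    define a where "a x = m (x - \<tau> *\<^sub>R e) + (1 - cutoff x0 r x)" for x
    have [measurable]: "borel_fun a" unfolding a_def by measurable
    have a: "gag s p a \<le> D"
      unfolding D_def gag_translate[OF m, of s p "\<tau> *\<^sub>R e", symmetric]
      by (rule gag_finite_add(1)[OF p(1)])
        (use g gag_cutoff_finite[OF p r, of x0] in \<open>auto simp: gag_translate a_def\<close>)
    have "gag s p (shifted_min m \<tau> (c # L)) \<le> ennreal (2 powr p) * (gag s p a + gag s p (shifted_min m \<tau> L))"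
    proof (rule gag_finite_add(1)[OF p(1)])
      show "gag s p a < \<infinity>" "gag s p (shifted_min m \<tau> L) < \<infinity>"
        using a D C(1) C(2)[of \<tau>] by (auto intro: le_less_trans)
      show "shifted_min m \<tau> (c # L) \<in> borel_measurable borel" by (rule shifted_min_measurable) measurable
      show "\<bar>df (shifted_min m \<tau> (c # L)) w\<bar> \<le> \<bar>df a w\<bar> + \<bar>df (shifted_min m \<tau> L) w\<bar>" for w
        using abs_min_diff_le by (simp add: c a_def)
    qed measurable
    also have "\<dots> \<le> ennreal (2 powr p) * (D + C)"
      using a C(2) by (intro mult_left_mono add_mono) auto
    finally show ?thesis .
  qed
  moreover have "ennreal (2 powr p) * (D + C) < \<infinity>" using C D by (simp add: ennreal_mult_less_top)
  ultimately show ?case by blast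
qed

text \<open>In the limit every chart offers \<open>m x\<close> plus a nonnegative number, which does
  not lower the minimum.\<close>

lemma shifted_min_tendsto:
  assumes "\<And>x0 r e. (x0, r, e) \<in> set L \<Longrightarrow> (\<lambda>n. m (x - \<tau> n *\<^sub>R e)) \<longlonglongrightarrow> m x"
  shows "(\<lambda>n. shifted_min m (\<tau> n) L x) \<longlonglongrightarrow> m x"
  using assms
proof (induction L)
  case (Cons c L)
  obtain x0 r e where c: "c = (x0, r, e)" by (cases c) auto
  have "(\<lambda>n. shifted_min m (\<tau> n) (c # L) x) \<longlonglongrightarrow> min (m x + (1 - cutoff x0 r x)) (m x)"
    using Cons by (auto simp: c intro!: tendsto_min tendsto_add tendsto_const)
  moreover have "min (m x + (1 - cutoff x0 r x)) (m x) = m x"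
    using cutoff_bounds[of x0 r x] by (simp add: min_def)
  ultimately show ?case by simp
qed simp

text \<open>Finitely many half balls cover the boundary and one shift length fits all charts. Near
  each boundary point some shifted copy vanishes, so the minimum has compact support in
  \<open>\<Omega>\<close>.\<close>

lemma compact_support_approx:
  fixes \<Omega> :: "'a::euclidean_space set"
  assumes p: "1 < p" "0 < s" "s < 1" and \<Omega>: "smooth_bounded_domain \<Omega>"
    and mm [measurable]: "borel_fun m" and m: "\<And>x. 0 \<le> m x" "\<And>x. m x \<le> 1" "\<And>x. x \<notin> \<Omega> \<Longrightarrow> m x = 0"
    and g: "gag s p m < \<infinity>"
  obtains \<phi> C where "\<And>n::nat. bump_like s p \<Omega> (\<phi> n)" "\<And>n x. \<phi> n x \<le> m x" "\<And>n. gag s p (\<phi> n) \<le> C" "C < \<infinity>"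
    "AE x in lborel. (\<lambda>n. \<phi> n x) \<longlonglongrightarrow> m x"
proof -
  have \<Omega>': "open \<Omega>" "bounded \<Omega>" using \<Omega> by (auto simp: smooth_bounded_domain_def)
  have cl: "compact (closure \<Omega>)" using \<Omega>'(2) by (simp add: compact_closure)
  have fr: "compact (frontier \<Omega>)" using \<Omega>'(2) by (rule compact_frontier_bounded)
  have "\<forall>x0\<in>frontier \<Omega>. \<exists>r e. 0 < r \<and> (\<forall>\<tau> x. 0 < \<tau> \<longrightarrow> \<tau> < r / 2 \<longrightarrow> x \<in> frontier \<Omega> \<longrightarrow> x \<in> ball x0 (r / 2) \<longrightarrow>
     (\<exists>N. open N \<and> x \<in> N \<and> N \<subseteq> ball x0 (r / 2) \<and> (\<forall>y\<in>N. y - \<tau> *\<^sub>R e \<notin> \<Omega>)))"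
    using outward_translation[OF \<Omega>] by metis
  then obtain r e where re: "\<And>x0. x0 \<in> frontier \<Omega> \<Longrightarrow> 0 < r x0"
    "\<And>x0 \<tau> x. x0 \<in> frontier \<Omega> \<Longrightarrow> 0 < \<tau> \<Longrightarrow> \<tau> < r x0 / 2 \<Longrightarrow> x \<in> frontier \<Omega> \<Longrightarrow> x \<in> ball x0 (r x0 / 2) \<Longrightarrow>
     (\<exists>N. open N \<and> x \<in> N \<and> N \<subseteq> ball x0 (r x0 / 2) \<and> (\<forall>y\<in>N. y - \<tau> *\<^sub>R e x0 \<notin> \<Omega>))" by metis
  obtain T where T: "T \<subseteq> frontier \<Omega>" "finite T" "frontier \<Omega> \<subseteq> (\<Union>x0\<in>T. ball x0 (r x0 / 2))"
    by (rule compactE_image[OF fr, of "frontier \<Omega>" "\<lambda>x0. ball x0 (r x0 / 2)"]) (use re(1) in auto)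
  obtain xs where xs: "set xs = T" using finite_list[OF T(2)] by blast
  define L where "L = map (\<lambda>x0. (x0, r x0, e x0)) xs"
  have L: "(x0, r', e') \<in> set L \<longleftrightarrow> x0 \<in> T \<and> r' = r x0 \<and> e' = e x0" for x0 r' e'
    by (auto simp: L_def xs)
  obtain \<tau>0 where \<tau>0: "0 < \<tau>0" "\<And>x0. x0 \<in> T \<Longrightarrow> \<tau>0 < r x0 / 2"
  proof -
    \<comment> \<open>A quarter of each radius gives the strict bound by half of it; the entry 1
      keeps the minimum defined for an empty \<open>T\<close>.\<close>
    define \<tau>1 where "\<tau>1 = Min (insert 1 ((\<lambda>x0. r x0 / 4) ` T))"
    have pos: "0 < \<tau>1" unfolding \<tau>1_def using T re(1) by (subst Min_gr_iff) auto
    have "\<tau>1 \<le> r x0 / 4" if "x0 \<in> T" for x0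
      unfolding \<tau>1_def using T(2) that by (intro Min_le) auto
    then show ?thesis using that[of \<tau>1] pos T(1) re(1) by fastforce
  qed
  define t where "t n = \<tau>0 * inverse (real (Suc n))" for n
  have t: "0 < t n" "t n \<le> \<tau>0" for n using \<tau>0(1) by (auto simp: t_def field_simps)
  have tlim: "t \<longlonglongrightarrow> 0"
    unfolding t_def[abs_def] using tendsto_mult_right_zero[OF LIMSEQ_inverse_real_of_nat] by blast
  have mi: "integrable lborel m"
  proof (rule integrable_dominated)
    show "integrable lborel (indicator (closure \<Omega>) :: 'a \<Rightarrow> real)"
      using emeasure_compact_finite[OF cl] by simp
    show "\<bar>m x\<bar> \<le> indicator (closure \<Omega>) x" for x
      using m(1)[of x] m(2)[of x] m(3)[of x] closure_subset[of \<Omega>] by (auto split: split_indicator)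
  qed simp
  have mti: "integrable lborel (\<lambda>x. \<bar>m (x - c) - m x\<bar>)" for c
    using integrable_lborel_translate[OF mi, of "- c"] mi by auto
  \<comment> \<open>Summing the translation errors over the charts gives one subsequence that works
    for all charts at almost every point.\<close>
  have "(\<lambda>n. \<integral>x. norm (\<Sum>x0\<in>T. \<bar>m (x - t n *\<^sub>R e x0) - m x\<bar>) \<partial>lborel) \<longlonglongrightarrow> 0"
  proof -
    have "(\<lambda>n. \<integral>x. \<bar>m (x + - (t n *\<^sub>R e x0)) - m x\<bar> \<partial>lborel) \<longlonglongrightarrow> 0" for x0
    proof -
      have "(\<lambda>n. - (t n *\<^sub>R e x0)) \<longlonglongrightarrow> - (0 *\<^sub>R e x0)" by (intro tendsto_intros tlim)
      then have "(\<lambda>n. - (t n *\<^sub>R e x0)) \<longlonglongrightarrow> 0" by simp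
      then show ?thesis
        by (rule translation_continuous_integrable[OF mi, unfolded translation_continuous_def, rule_format])
    qed
    then have "(\<lambda>n. \<Sum>x0\<in>T. \<integral>x. \<bar>m (x + - (t n *\<^sub>R e x0)) - m x\<bar> \<partial>lborel) \<longlonglongrightarrow> (\<Sum>x0\<in>T. 0)"
      by (intro tendsto_sum)
    moreover have "(\<integral>x. norm (\<Sum>x0\<in>T. \<bar>m (x - t n *\<^sub>R e x0) - m x\<bar>) \<partial>lborel)
        = (\<Sum>x0\<in>T. \<integral>x. \<bar>m (x + - (t n *\<^sub>R e x0)) - m x\<bar> \<partial>lborel)" for n
      using mti by (simp add: sum_nonneg Bochner_Integration.integral_sum)
    ultimately show ?thesis by simp
  qed
  from tendsto_L1_AE_subseq[OF _ this] mti
  obtain q where q: "strict_mono q" "AE x in lborel. (\<lambda>n. \<Sum>x0\<in>T. \<bar>m (x - t (q n) *\<^sub>R e x0) - m x\<bar>) \<longlonglongrightarrow> 0"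
    by auto
  define \<phi> where "\<phi> n = shifted_min m (t (q n)) L" for n
  have ae: "AE x in lborel. (\<lambda>n. \<phi> n x) \<longlonglongrightarrow> m x"
    using q(2)
  proof eventually_elim
    fix x assume x: "(\<lambda>n. \<Sum>x0\<in>T. \<bar>m (x - t (q n) *\<^sub>R e x0) - m x\<bar>) \<longlonglongrightarrow> 0"
    show "(\<lambda>n. \<phi> n x) \<longlonglongrightarrow> m x"
      unfolding \<phi>_def
    proof (rule shifted_min_tendsto)
      fix x0 r' e' assume "(x0, r', e') \<in> set L"
      then have x0: "x0 \<in> T" "e' = e x0" by (auto simp: L)
      have "(\<lambda>n. m (x - t (q n) *\<^sub>R e x0) - m x) \<longlonglongrightarrow> 0"
      proof (rule Lim_null_comparison[OF _ x], intro always_eventually allI)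
        fix n
        show "norm (m (x - t (q n) *\<^sub>R e x0) - m x) \<le> (\<Sum>x0\<in>T. \<bar>m (x - t (q n) *\<^sub>R e x0) - m x\<bar>)"
          using member_le_sum[OF x0(1) _ T(2), of "\<lambda>x0. \<bar>m (x - t (q n) *\<^sub>R e x0) - m x\<bar>"] by simp
      qed
      then show "(\<lambda>n. m (x - t (q n) *\<^sub>R e')) \<longlonglongrightarrow> m x" unfolding x0(2) by (rule LIM_zero_cancel)
    qed
  qed
  have "\<exists>C<\<infinity>. \<forall>\<tau>. gag s p (shifted_min m \<tau> L) \<le> C"
    using T(1) re(1) by (intro gag_shifted_min_bounded[OF p mm g]) (auto simp: L)
  then obtain C where C: "C < \<infinity>" "\<And>\<tau>. gag s p (shifted_min m \<tau> L) \<le> C" by blast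
  have supp: "\<exists>K. compact K \<and> K \<subseteq> \<Omega> \<and> (\<forall>x. x \<notin> K \<longrightarrow> \<phi> n x = 0)" for n
  proof -
    define \<tau> where "\<tau> = t (q n)"
    \<comment> \<open>An open neighbourhood of the boundary on which \<open>\<phi> n\<close>
      vanishes: each of its points is moved out of \<open>\<Omega>\<close> by the chart of some half
      ball containing it.\<close>
    define W where "W = {y. \<exists>N. open N \<and> y \<in> N \<and> (\<exists>x0\<in>T. N \<subseteq> ball x0 (r x0 / 2) \<and> (\<forall>y\<in>N. y - \<tau> *\<^sub>R e x0 \<notin> \<Omega>))}"
    have "open W"
      unfolding W_def by (subst open_subopen) blast
    have frW: "frontier \<Omega> \<subseteq> W"
    proof
      fix x assume x: "x \<in> frontier \<Omega>"
      then obtain x0 where x0: "x0 \<in> T" "x \<in> ball x0 (r x0 / 2)" using T(3) by blast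
      have "\<tau> < r x0 / 2" using t(2)[of "q n"] \<tau>0(2)[OF x0(1)] by (simp add: \<tau>_def)
      then show "x \<in> W" using re(2)[of x0 \<tau> x] x x0 T(1) t(1) unfolding W_def \<tau>_def by blast
    qed
    have "compact (closure \<Omega> - W)" using cl \<open>open W\<close> by (rule compact_diff)
    moreover have "closure \<Omega> - W \<subseteq> \<Omega>"
      using frW \<Omega>'(1) by (auto simp: frontier_def interior_open)
    moreover have "\<phi> n x = 0" if "x \<notin> closure \<Omega> - W" for x
    proof (cases "x \<in> W")
      case True
      then obtain x0 where x0: "x0 \<in> T" "x \<in> ball x0 (r x0 / 2)" "x - \<tau> *\<^sub>R e x0 \<notin> \<Omega>" unfolding W_def by blast
      then show ?thesis unfolding \<phi>_def \<tau>_def[symmetric]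
        using T(1) re(1) m by (intro shifted_min_eq_0[of x0 "r x0" "e x0"]) (auto simp: L)
    next
      case False
      then have "x \<notin> \<Omega>" using that closure_subset by blast
      then have "m x = 0" by (rule m(3))
      then show ?thesis unfolding \<phi>_def
        using shifted_min_le[of m "t (q n)" L x] shifted_min_nonneg[of m "t (q n)" L x] m(1) by simp
    qed
    ultimately show ?thesis by blast
  qed
  show ?thesis
  proof (rule that[of \<phi> C])
    fix n
    have "\<phi> n x \<le> 1" for x unfolding \<phi>_def using shifted_min_le[of m "t (q n)" L x] m(2)[of x] by linarith
    moreover have "gag s p (\<phi> n) < \<infinity>" unfolding \<phi>_def using C by (auto intro: le_less_trans)
    moreover have "borel_fun (\<phi> n)" unfolding \<phi>_def by (rule shifted_min_measurable[OF mm])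
    moreover have "0 \<le> \<phi> n x" for x unfolding \<phi>_def using m(1) by (rule shifted_min_nonneg)
    ultimately show "bump_like s p \<Omega> (\<phi> n)" unfolding bump_like_def using supp[of n] by blast
  qed (use ae C shifted_min_le in \<open>auto simp: \<phi>_def\<close>)
qed

subsection \<open>Comparison\<close>

text \<open>The density \<open>kern\<close> is positive off the diagonal, so there
  \<open>mu\<close>-null sets are Lebesgue-null; the diagonal is supplied by the second
  assumption.\<close>

lemma AE_lborel_if_AE_mu: "AE z in mu s p. P z \<Longrightarrow> (\<And>z. fst z = snd z \<Longrightarrow> P z) \<Longrightarrow> AE z in lborel. P (z :: 'a::euclidean_space \<times> 'a)"
proof -
  assume P: "AE z in mu s p. P z" and diag: "\<And>z. fst z = snd z \<Longrightarrow> P z"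
  have "AE z in lborel. 0 < ennreal (kern s p z) \<longrightarrow> P z"
    using P unfolding mu_def by (subst (asm) AE_density) auto
  then show ?thesis
  proof eventually_elim
    fix z :: "'a \<times> 'a" assume "0 < ennreal (kern s p z) \<longrightarrow> P z"
    then show "P z" using diag[of z] by (cases "fst z = snd z") (auto simp: kern_def case_prod_beta)
  qed
qed

text \<open>By Fubini, \<open>T\<close> equals the constant \<open>T x\<close> almost everywhere for
  almost every \<open>x\<close>. The complement of a bounded set has infinite measure, so the
  constant is also taken outside \<open>\<Omega>\<close>.\<close>

lemma AE_const_imp_zero:
  fixes T :: "'a::euclidean_space \<Rightarrow> real"
  assumes T: "AE z in lborel. T (fst z) = T (snd z)" and \<Omega>: "bounded \<Omega>" "\<And>x. x \<notin> \<Omega> \<Longrightarrow> T x = 0"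
  shows "AE x in lborel. T x = 0"
proof -
  obtain R where R: "\<Omega> \<subseteq> cball 0 R" using \<Omega>(1) by (auto simp: bounded_iff subset_iff)
  have "AE z in lborel \<Otimes>\<^sub>M lborel. T (fst z) = T (snd z)" unfolding lborel_prod by (rule T)
  then have "AE x in lborel. AE y in lborel. T x = T y"
    using lborel_pair.AE_pair by fastforce
  then show ?thesis
  proof eventually_elim
    fix x assume x: "AE y in lborel. T x = T y"
    have "\<exists>y. T x = T y \<and> y \<notin> \<Omega>"
    proof (rule ccontr)
      assume neg: "\<not> ?thesis"
      from x have "AE y in lborel. y \<in> cball (0::'a) R"
        by (rule eventually_mono) (use neg R in blast)
      then have "emeasure lborel (UNIV :: 'a set) \<le> emeasure lborel (cball (0::'a) R)"
        by (intro emeasure_mono_AE) auto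
      also have "\<dots> < \<infinity>" by (rule emeasure_lborel_cball_finite)
      finally show False by simp
    qed
    then show "T x = 0" using \<Omega>(2) by auto
  qed
qed

context sub_super
begin

lemma comparison_truncated:
  assumes dom: "smooth_bounded_domain \<Omega>" and \<epsilon>: "0 < \<epsilon>" and E: "gag s p (\<lambda>x. max (U x - \<epsilon>) 0) < \<infinity>"
  shows "AE x in lborel. U x - \<epsilon> \<le> V x"
proof -
  define e where "e = (\<lambda>x. max (U x - \<epsilon>) 0)"
  have em [measurable]: "borel_fun e" unfolding e_def by measurable
  have ge: "gag s p e < \<infinity>" using E by (simp add: e_def)
  have e0: "0 \<le> e x" "x \<notin> \<Omega> \<Longrightarrow> e x = 0" for x using U(3)[of x] \<epsilon> by (auto simp: e_def)
  obtain w where w: "borel_fun w" "\<And>x. 0 \<le> w x" "\<And>x. w x \<le> min (V x) (e x)"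
    "breg_energy s p e w < \<infinity>"
    "\<And>\<phi>. \<phi> \<in> borel_measurable borel \<Longrightarrow> (\<And>x. 0 \<le> \<phi> x) \<Longrightarrow> (\<And>x. \<phi> x \<le> min (V x) (e x)) \<Longrightarrow>
       breg_energy s p e w \<le> breg_energy s p e \<phi>"
  proof (rule obstacle_minimizer[OF p em ge, of "\<lambda>x. min (V x) (e x)"])
    show "0 \<le> min (V x) (e x)" for x using V(2) e0(1) by simp
  qed (rule that; (assumption | blast))
  note [measurable] = w(1)
  have wV: "w x \<le> V x" and we: "w x \<le> e x" for x using w(3)[of x] by auto
  have gw: "gag s p w < \<infinity>" by (rule gag_finite_breg_energy[OF p em w(1) ge w(4)])
  define m where "m x = min (e x) 1" for x
  have mm [measurable]: "borel_fun m" unfolding m_def by measurable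
  have gm: "gag s p m < \<infinity>"
  proof (rule le_less_trans[OF _ ge])
    show "gag s p m \<le> gag s p e"
      unfolding gag_def m_def using p abs_min_diff_le[of _ 1 _ 1]
      by (intro nn_integral_mono ennreal_leI powr_mono2) auto
  qed
  obtain \<phi> C where \<phi>: "\<And>n::nat. bump_like s p \<Omega> (\<phi> n)" "\<And>n x. \<phi> n x \<le> m x" "\<And>n. gag s p (\<phi> n) \<le> C" "C < \<infinity>"
    "AE x in lborel. (\<lambda>n. \<phi> n x) \<longlonglongrightarrow> m x"
  proof (rule compact_support_approx[OF p s dom mm _ _ _ gm])
    show "0 \<le> m x" "m x \<le> 1" "x \<notin> \<Omega> \<Longrightarrow> m x = 0" for x using e0[of x] by (auto simp: m_def)
  qed (rule that; assumption)
  define D where "D x = e x - w x" for x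
  have [measurable]: "borel_fun D" unfolding D_def by measurable
  have gD: "gag s p D < \<infinity>" by (rule gag_finite_add(2)[OF p em w(1) _ ge gw]) (auto simp: D_def)
  have D0: "0 \<le> D x" for x using we[of x] by (simp add: D_def)
  \<comment> \<open>Below \<open>e - w\<close>, as \<open>minimizer_supersolution\<close> demands,
    and compactly supported thanks to \<open>\<phi> n\<close>.\<close>
  define \<psi> where "\<psi> n x = min (D x) (\<phi> n x)" for n x
  define T where "T x = min (D x) 1" for x
  have \<phi>m [measurable]: "borel_fun (\<phi> n)" for n using \<phi>(1) by (simp add: bump_like_def)
  have [measurable]: "borel_fun (\<psi> n)" "borel_fun T" for n
    unfolding \<psi>_def T_def by measurable
  have g\<psi>: "gag s p (\<psi> n) \<le> ennreal (2 powr p) * (gag s p D + C)" for n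
  proof -
    have "gag s p (\<psi> n) \<le> ennreal (2 powr p) * (gag s p D + gag s p (\<phi> n))"
      using \<phi>(1)[of n] by (intro gag_finite_add(1)[OF p _ _ _ gD])
        (auto simp: bump_like_def \<psi>_def intro: abs_min_diff_le)
    also have "\<dots> \<le> ennreal (2 powr p) * (gag s p D + C)" using \<phi>(3) by (intro mult_left_mono add_left_mono) auto
    finally show ?thesis .
  qed
  have C': "ennreal (2 powr p) * (gag s p D + C) < \<infinity>" using gD \<phi>(4) by (simp add: ennreal_mult_less_top)
  have \<psi>: "bump_like s p \<Omega> (\<psi> n)" for n
  proof -
    have b: "\<And>x. 0 \<le> \<phi> n x" "\<exists>M. \<forall>x. \<phi> n x \<le> M" "\<exists>K. compact K \<and> K \<subseteq> \<Omega> \<and> (\<forall>x. x \<notin> K \<longrightarrow> \<phi> n x = 0)"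
      using \<phi>(1)[of n] by (auto simp: bump_like_def)
    have "\<exists>M. \<forall>x. \<psi> n x \<le> M" using b(2) unfolding \<psi>_def by (meson min.cobounded2 order_trans)
    moreover have "\<exists>K. compact K \<and> K \<subseteq> \<Omega> \<and> (\<forall>x. x \<notin> K \<longrightarrow> \<psi> n x = 0)"
      using b(3) D0 unfolding \<psi>_def by (metis min.absorb2)
    ultimately show ?thesis
      unfolding bump_like_def using le_less_trans[OF g\<psi> C'] b(1) D0 by (auto simp: \<psi>_def)
  qed
  interpret M: truncated_minimizer s p \<gamma> \<Omega> f U V \<epsilon> e w
    by unfold_locales (use \<epsilon> e_def ge w wV we in auto)
  have le: "form s p e (\<psi> n) \<le> form s p w (\<psi> n)" for n
    by (rule M.minimizer_supersolution[OF \<psi>]) (simp add: \<psi>_def D_def)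
  have lim: "AE z in mu s p. (\<lambda>n. df (\<psi> n) z) \<longlonglongrightarrow> df T z"
  proof -
    have "AE x in lborel. (\<lambda>n. \<psi> n x) \<longlonglongrightarrow> T x"
      using \<phi>(5)
    proof eventually_elim
      fix x assume "(\<lambda>n. \<phi> n x) \<longlonglongrightarrow> m x"
      then have "(\<lambda>n. \<psi> n x) \<longlonglongrightarrow> min (D x) (m x)" unfolding \<psi>_def by (intro tendsto_min tendsto_const)
      \<comment> \<open>As \<open>w\<close> is nonnegative, \<open>D \<le> e\<close>; cutting
        \<open>D\<close> at \<open>min (e x) 1\<close> is therefore the same as cutting it at
        1.\<close>
      moreover have "min (D x) (m x) = T x" using w(2)[of x] by (auto simp: D_def m_def T_def min_def)
      ultimately show "(\<lambda>n. \<psi> n x) \<longlonglongrightarrow> T x" by simp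
    qed
    from AE_mu_fst_snd[OF this] show ?thesis
      by eventually_elim (auto intro: tendsto_diff)
  qed
  \<comment> \<open>Applied to \<open>e\<close> and \<open>w\<close>, which have finite global
    energy, so the limit is legitimate although \<open>T\<close> may fail to be compactly supported
    in \<open>\<Omega>\<close>.\<close>
  have conv: "(\<lambda>n. form s p h (\<psi> n)) \<longlonglongrightarrow> form s p h T"
    if "gag s p h < \<infinity>" and [measurable]: "borel_fun h" for h
    unfolding form_def
    by (rule tendsto_integral_pphi_mult(2)[OF p, where C = "ennreal (2 powr p) * (gag s p D + C)"])
      (use that g\<psi> C' lim in \<open>auto simp: gag_def\<close>)
  have leT: "form s p e T \<le> form s p w T"
    using conv[OF ge em] conv[OF gw w(1)] le by (intro LIMSEQ_le) auto
  have gT: "gag s p T < \<infinity>"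
    unfolding gag_def
    by (rule le_less_trans[OF tendsto_integral_pphi_mult(1)[OF p, where d = "\<lambda>z. 0" and g = "\<lambda>n. df (\<psi> n)"]])
      (use g\<psi> C' lim in \<open>auto simp: gag_def\<close>)
  have i: "integrable (mu s p) (\<lambda>z. pphi p (df e z) * df T z)" "integrable (mu s p) (\<lambda>z. pphi p (df w z) * df T z)"
    using integrable_gag_form[OF p _ _ ge gT] integrable_gag_form[OF p _ _ gw gT] by auto
  \<comment> \<open>\<open>T\<close> is a nondecreasing function of \<open>D = e - w\<close>, so its
    increments never oppose those of \<open>D\<close>. If the product vanishes, then
    \<open>df T z = 0\<close> or, by injectivity of \<open>pphi p\<close>,
    \<open>df D z = 0\<close>, which again forces \<open>df T z = 0\<close>.\<close>
  have pos: "0 \<le> (pphi p (df e z) - pphi p (df w z)) * df T z"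
    and strict: "(pphi p (df e z) - pphi p (df w z)) * df T z = 0 \<Longrightarrow> df T z = 0" for z
  proof -
    have eq: "df e z = df w z + df D z" by (simp add: D_def)
    consider "0 \<le> df D z" "0 \<le> df T z" | "df D z \<le> 0" "df T z \<le> 0"
      by (cases "0 \<le> df D z") (auto simp: T_def min_def)
    then show "0 \<le> (pphi p (df e z) - pphi p (df w z)) * df T z"
    proof cases
      case 1
      then show ?thesis using pphi_mono[OF p, of "df w z" "df e z"] eq by (intro mult_nonneg_nonneg) auto
    next
      case 2
      then show ?thesis using pphi_mono[OF p, of "df e z" "df w z"] eq by (intro mult_nonpos_nonpos) auto
    qed
    assume "(pphi p (df e z) - pphi p (df w z)) * df T z = 0"
    then have "df T z = 0 \<or> df e z = df w z" using pphi_inj[OF p, of "df e z" "df w z"] by auto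
    then show "df T z = 0" using eq by (auto simp: T_def)
  qed
  have "(\<integral>z. (pphi p (df e z) - pphi p (df w z)) * df T z \<partial>mu s p) = form s p e T - form s p w T"
    unfolding form_def left_diff_distrib by (rule Bochner_Integration.integral_diff[OF i])
  moreover have "0 \<le> (\<integral>z. (pphi p (df e z) - pphi p (df w z)) * df T z \<partial>mu s p)"
    by (rule Bochner_Integration.integral_nonneg) (rule pos)
  ultimately have "(\<integral>z. (pphi p (df e z) - pphi p (df w z)) * df T z \<partial>mu s p) = 0"
    using leT by simp
  moreover have "integrable (mu s p) (\<lambda>z. (pphi p (df e z) - pphi p (df w z)) * df T z)"
    unfolding left_diff_distrib using i by (rule Bochner_Integration.integrable_diff)
  ultimately have "AE z in mu s p. (pphi p (df e z) - pphi p (df w z)) * df T z = 0"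
    using integral_nonneg_eq_0_iff_AE pos by blast
  then have "AE z in mu s p. T (fst z) = T (snd z)"
    by eventually_elim (use strict in force)
  then have "AE z in lborel. T (fst z) = T (snd z)" by (rule AE_lborel_if_AE_mu) simp
  then have "AE x in lborel. T x = 0"
  proof (rule AE_const_imp_zero)
    show "bounded \<Omega>" using dom by (simp add: smooth_bounded_domain_def)
    show "T x = 0" if "x \<notin> \<Omega>" for x
      using e0(2)[OF that] w(2)[of x] we[of x] by (simp add: T_def D_def)
  qed
  then show ?thesis
  proof eventually_elim
    fix x assume "T x = 0"
    then have "e x \<le> V x" using wV[of x] by (auto simp: T_def D_def min_def split: if_splits)
    then show "U x - \<epsilon> \<le> V x" by (simp add: e_def)
  qed
qed

lemma comparison:
  assumes dom: "smooth_bounded_domain \<Omega>" and E: "\<And>\<epsilon>. 0 < \<epsilon> \<Longrightarrow> gag s p (\<lambda>x. max (U x - \<epsilon>) 0) < \<infinity>"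
  shows "AE x in lborel. U x \<le> V x"
proof -
  have "AE x in lborel. \<forall>n. U x - inverse (real (Suc n)) \<le> V x"
    unfolding AE_all_countable using comparison_truncated[OF dom _ E] by simp
  then show ?thesis
  proof eventually_elim
    fix x assume x: "\<forall>n. U x - inverse (real (Suc n)) \<le> V x"
    have "(\<lambda>n. U x - inverse (real (Suc n))) \<longlonglongrightarrow> U x - 0"
      by (intro tendsto_diff tendsto_const LIMSEQ_inverse_real_of_nat)
    then show "U x \<le> V x" using x by (intro LIMSEQ_le_const2[of _ "U x"]) auto
  qed
qed

end

subsection \<open>Borel representatives\<close>

lemma AE_lebesgue_iff: "(AE x in lebesgue. P x) \<longleftrightarrow> (AE x in lborel. P x)"
  by (rule AE_completion_iff)

lemma borel_representative:
  fixes u :: "'a::euclidean_space \<Rightarrow> real"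
  assumes \<Omega>: "\<Omega> \<in> sets borel" and u: "u \<in> borel_measurable (lebesgue_on \<Omega>)"
    and pos: "AE x in lborel. x \<in> \<Omega> \<longrightarrow> 0 \<le> u x"
  obtains U where "borel_fun U" "\<And>x. 0 \<le> U x" "\<And>x. x \<notin> \<Omega> \<Longrightarrow> U x = 0"
    "AE x in lborel. x \<in> \<Omega> \<longrightarrow> U x = u x"
proof -
  have "(\<lambda>x. if x \<in> \<Omega> then u x else 0) \<in> borel_measurable lebesgue"
    using u \<Omega> by (subst borel_measurable_if) auto
  from completion_ex_borel_measurable_real[OF this]
  obtain g where g [measurable]: "borel_fun g" and ae: "AE x in lborel. (if x \<in> \<Omega> then u x else 0) = g x"
    by auto
  have [measurable]: "\<Omega> \<in> sets borel" by (rule \<Omega>)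
  show ?thesis
  proof (rule that[of "\<lambda>x. if x \<in> \<Omega> then max (g x) 0 else 0"])
    show "AE x in lborel. x \<in> \<Omega> \<longrightarrow> (if x \<in> \<Omega> then max (g x) 0 else 0) = u x"
      using ae pos by eventually_elim auto
  qed auto
qed

text \<open>Completeness of Lebesgue measure: preimages under \<open>g\<close> and \<open>h\<close>
  differ only inside a null set.\<close>

lemma borel_measurable_lebesgue_AE:
  fixes g h :: "'a::euclidean_space \<Rightarrow> real"
  assumes g: "borel_fun g" and ae: "AE x in lborel. g x = h x"
  shows "h \<in> borel_measurable lebesgue"
proof -
  obtain N where N: "N \<in> null_sets lborel" "{x. g x \<noteq> h x} \<subseteq> N"
    using ae by (auto elim!: AE_E simp: null_sets_def)
  have N': "N \<in> null_sets lebesgue" using N(1) null_sets_completionI by blast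
  show ?thesis
  proof (rule borel_measurableI)
    fix A :: "real set" assume "open A"
    then have "g -` A \<in> sets lebesgue"
      using measurable_sets_borel[OF g, of A] by (simp add: borel_open)
    moreover have "h -` A \<inter> N \<in> null_sets lebesgue"
      by (rule null_sets_completion_subset[OF _ N']) auto
    moreover have "g x = h x" if "x \<notin> N" for x using N(2) that by auto
    then have "h -` A \<inter> space lebesgue = (g -` A - N) \<union> (h -` A \<inter> N)" by auto
    ultimately show "h -` A \<inter> space lebesgue \<in> sets lebesgue" using N' by (metis sets.Un sets.Diff null_setsD2)
  qed
qed

lemma gagliardo_eq:
  fixes u U :: "'a::euclidean_space \<Rightarrow> real"
  assumes K: "closed K" and [measurable]: "borel_fun U" and ae: "AE x in lborel. U x = u x"
  shows "gagliardo s p K u = (\<integral>\<^sup>+w. indicator (K \<times> K) w * ennreal (\<bar>df U w\<bar> powr p) \<partial>mu s p)"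
proof -
  have KK [measurable]: "K \<times> K \<in> sets borel" using K by (intro borel_closed closed_Times)
  then have "K \<times> K \<in> sets lebesgue" by simp
  then have "gagliardo s p K u = (\<integral>\<^sup>+z. (case z of (x, y) \<Rightarrow> ennreal (\<bar>u x - u y\<bar> powr p / norm (x - y) powr (real DIM('a) + s * p)))
      * indicator (K \<times> K) z \<partial>lborel)"
    unfolding gagliardo_def by (subst nn_integral_restrict_space) (auto simp: nn_integral_completion)
  also have "\<dots> = (\<integral>\<^sup>+z. ennreal (kern s p z) * (indicator (K \<times> K) z * ennreal (\<bar>df U z\<bar> powr p)) \<partial>lborel)"
  proof (rule nn_integral_cong_AE, use AE_lborel_fst_snd[OF ae] in eventually_elim)
    fix z :: "'a \<times> 'a" assume z: "U (fst z) = u (fst z) \<and> U (snd z) = u (snd z)"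
    have "ennreal (kern s p z) * ennreal (\<bar>df U z\<bar> powr p) = ennreal (kern s p z * \<bar>df U z\<bar> powr p)"
      by (simp add: ennreal_mult)
    then show "(case z of (x, y) \<Rightarrow> ennreal (\<bar>u x - u y\<bar> powr p / norm (x - y) powr (real DIM('a) + s * p)))
      * indicator (K \<times> K) z = ennreal (kern s p z) * (indicator (K \<times> K) z * ennreal (\<bar>df U z\<bar> powr p))"
      using z by (auto simp: kern_def case_prod_beta split: split_indicator)
  qed
  also have "\<dots> = (\<integral>\<^sup>+w. indicator (K \<times> K) w * ennreal (\<bar>df U w\<bar> powr p) \<partial>mu s p)"
    by (rule nn_integral_mu[symmetric]) measurable
  finally show ?thesis .
qed

text \<open>The integrand formed with \<open>u\<close> is only known to agree almost everywhere with
  a Borel function; completeness makes it measurable, and the Bochner integrals then coincide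
  whether or not they converge.\<close>

lemma frac_p_form_eq:
  fixes u U \<phi> :: "'a::euclidean_space \<Rightarrow> real"
  assumes [measurable]: "borel_fun U" "borel_fun \<phi>" and ae: "AE x in lborel. U x = u x"
  shows "frac_p_form s p u \<phi> = form s p U \<phi>"
proof -
  define g where "g z = kern s p z * (pphi p (df U z) * df \<phi> z)" for z
  define h where "h = (\<lambda>(x, y). \<bar>u x - u y\<bar> powr (p - 2) * (u x - u y) * (\<phi> x - \<phi> y)
          / norm (x - y) powr (real DIM('a) + s * p))"
  have gm [measurable]: "borel_fun g" unfolding g_def by measurable
  have gh: "AE z in lborel. g z = h z"
    using AE_lborel_fst_snd[OF ae]
    by eventually_elim (auto simp: g_def h_def kern_def pphi_def case_prod_beta)
  have "frac_p_form s p u \<phi> = (\<integral>z. h z \<partial>lebesgue)" by (simp add: frac_p_form_def h_def)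
  also have "\<dots> = (\<integral>z. g z \<partial>lebesgue)"
    using gh borel_measurable_lebesgue_AE[OF gm gh]
    by (intro integral_cong_AE) (auto simp: AE_lebesgue_iff measurable_completion elim: eventually_mono)
  also have "\<dots> = (\<integral>z. g z \<partial>lborel)" by (rule integral_completion) simp
  also have "\<dots> = form s p U \<phi>"
    unfolding form_def mu_def g_def by (subst integral_density) auto
  finally show ?thesis .
qed

lemma nn_integral_lebesgue_on:
  fixes g :: "'a::euclidean_space \<Rightarrow> ennreal"
  assumes "\<Omega> \<in> sets borel"
  shows "(\<integral>\<^sup>+x. g x \<partial>lebesgue_on \<Omega>) = (\<integral>\<^sup>+x. g x * indicator \<Omega> x \<partial>lborel)"
  using assms by (subst nn_integral_restrict_space) (auto simp: nn_integral_completion)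

lemma sing_quot_cong:
  "f x = f' x \<Longrightarrow> z x = z' x \<Longrightarrow> sing_quot \<gamma> f z x = sing_quot \<gamma> f' z' x"
  by (simp add: sing_quot_def)

text \<open>Gathers what the comparison uses about the Borel pair \<open>F\<close>,
  \<open>U\<close>, with both sides of the weak formulation transferred to integrals over
  \<open>mu\<close> and \<open>lborel\<close>.\<close>

definition represents :: "real \<Rightarrow> real \<Rightarrow> real \<Rightarrow> 'a::euclidean_space set \<Rightarrow> ('a \<Rightarrow> real) \<Rightarrow> ('a \<Rightarrow> real) \<Rightarrow>
    ('a \<Rightarrow> real) \<Rightarrow> ('a \<Rightarrow> real) \<Rightarrow> bool" where
  "represents s p \<gamma> \<Omega> f u F U \<longleftrightarrow> loc_energy s p \<Omega> U \<and> (\<forall>x. 0 \<le> U x) \<and> (\<forall>x. x \<notin> \<Omega> \<longrightarrow> U x = 0) \<and>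
     (AE x in lborel. U x = u x) \<and> loc_source \<Omega> (sing_quot \<gamma> F U) \<and>
     (\<forall>\<phi>. test_function \<Omega> \<phi> \<longrightarrow> frac_p_form s p u \<phi> = form s p U \<phi> \<and>
        (\<integral>\<^sup>+x. sing_quot \<gamma> f u x * ennreal (\<phi> x) \<partial>lebesgue_on \<Omega>) = src (sing_quot \<gamma> F U) \<phi>)"

lemma admissible_representative:
  fixes u :: "'a::euclidean_space \<Rightarrow> real"
  assumes \<Omega>: "open \<Omega>" and p: "1 < p" and u: "admissible s p \<gamma> \<Omega> f u"
    and F: "borel_fun F" "AE x in lborel. x \<in> \<Omega> \<longrightarrow> F x = f x"
  obtains U where "represents s p \<gamma> \<Omega> f u F U"
proof -
  have \<Omega>b: "\<Omega> \<in> sets borel" using \<Omega> by simp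
  have u': "in_Wsp_loc s p \<Omega> u" "in_Lp (p - 1) \<Omega> u" "AE x in lborel. 0 \<le> u x" "AE x in lborel. x \<notin> \<Omega> \<longrightarrow> u x = 0"
    and q: "\<And>K. compact K \<Longrightarrow> K \<subseteq> \<Omega> \<Longrightarrow> (\<integral>\<^sup>+x. sing_quot \<gamma> f u x \<partial>lebesgue_on K) < \<infinity>"
    using u by (auto simp: admissible_def AE_lebesgue_iff)
  have um: "u \<in> borel_measurable (lebesgue_on \<Omega>)" using u'(2) by (simp add: in_Lp_def)
  have "AE x in lborel. x \<in> \<Omega> \<longrightarrow> 0 \<le> u x" using u'(3) by eventually_elim simp
  from borel_representative[OF \<Omega>b um this]
  obtain U where U: "borel_fun U" "\<And>x. 0 \<le> U x" "\<And>x. x \<notin> \<Omega> \<Longrightarrow> U x = 0"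
    "AE x in lborel. x \<in> \<Omega> \<longrightarrow> U x = u x" by metis
  have ae: "AE x in lborel. U x = u x"
    using U(4) u'(4)
  proof eventually_elim
    fix x assume "x \<in> \<Omega> \<longrightarrow> U x = u x" "x \<notin> \<Omega> \<longrightarrow> u x = 0"
    then show "U x = u x" using U(3)[of x] by (cases "x \<in> \<Omega>") auto
  qed
  have test_borel: "borel_fun \<phi>" and test_0: "x \<notin> \<Omega> \<Longrightarrow> \<phi> x = 0" if "test_function \<Omega> \<phi>" for \<phi> x
  proof -
    show "borel_fun \<phi>"
      using that unfolding test_function_def smooth_def
      by (intro borel_measurable_continuous_onI) (metis Ck.simps(1))
    show "\<phi> x = 0" if "x \<notin> \<Omega>"
      using that \<open>test_function \<Omega> \<phi>\<close> closure_subset[of "{x. \<phi> x \<noteq> 0}"] unfolding test_function_def by blast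
  qed
  show ?thesis
  proof (rule that[of U], unfold represents_def loc_source_def, intro conjI allI impI)
    show "loc_energy s p \<Omega> U"
      unfolding loc_energy_def
    proof (intro conjI allI impI)
      fix K assume K: "compact K \<and> K \<subseteq> \<Omega>"
      then have "gagliardo s p K u < \<infinity>" using u'(1) by (simp add: in_Wsp_loc_def)
      then show "(\<integral>\<^sup>+w. indicator (K \<times> K) w * ennreal (\<bar>df U w\<bar> powr p) \<partial>mu s p) < \<infinity>"
        using gagliardo_eq[OF compact_imp_closed U(1) ae, of K s p] K by simp
    next
      have "Lp_int (p - 1) lborel U = (\<integral>\<^sup>+x. ennreal (\<bar>u x\<bar> powr (p - 1)) * indicator \<Omega> x \<partial>lborel)"
      proof (rule nn_integral_cong_AE, use ae in eventually_elim)
        fix x assume "U x = u x"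
        then show "ennreal (\<bar>U x\<bar> powr (p - 1)) = ennreal (\<bar>u x\<bar> powr (p - 1)) * indicator \<Omega> x"
          using U(3)[of x] by (cases "x \<in> \<Omega>") auto
      qed
      also have "\<dots> < \<infinity>" using u'(2) by (simp add: in_Lp_def nn_integral_lebesgue_on[OF \<Omega>b])
      finally show "Lp_int (p - 1) lborel U < \<infinity>" .
    qed (rule U)
    show "(\<integral>\<^sup>+x. indicator K x * sing_quot \<gamma> F U x \<partial>lborel) < \<infinity>" if K: "compact K \<and> K \<subseteq> \<Omega>" for K
    proof -
      have "(\<integral>\<^sup>+x. indicator K x * sing_quot \<gamma> F U x \<partial>lborel) = (\<integral>\<^sup>+x. sing_quot \<gamma> f u x * indicator K x \<partial>lborel)"
      proof (rule nn_integral_cong_AE, use ae F(2) in eventually_elim)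
        fix x assume "U x = u x" "x \<in> \<Omega> \<longrightarrow> F x = f x"
        then show "indicator K x * sing_quot \<gamma> F U x = sing_quot \<gamma> f u x * indicator K x"
          using sing_quot_cong[of F x f U u] K by (cases "x \<in> K") auto
      qed
      also have "\<dots> = (\<integral>\<^sup>+x. sing_quot \<gamma> f u x \<partial>lebesgue_on K)"
        using K by (intro nn_integral_lebesgue_on[symmetric]) (simp add: compact_imp_closed)
      finally show ?thesis using q K by simp
    qed
    show "frac_p_form s p u \<phi> = form s p U \<phi>" if "test_function \<Omega> \<phi>" for \<phi>
      by (rule frac_p_form_eq[OF U(1) test_borel[OF that] ae])
    show "(\<integral>\<^sup>+x. sing_quot \<gamma> f u x * ennreal (\<phi> x) \<partial>lebesgue_on \<Omega>)
        = (src (sing_quot \<gamma> F U) \<phi>)" if \<phi>: "test_function \<Omega> \<phi>" for \<phi>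
      unfolding nn_integral_lebesgue_on[OF \<Omega>b]
    proof (rule nn_integral_cong_AE, use ae F(2) in eventually_elim)
      fix x assume "U x = u x" "x \<in> \<Omega> \<longrightarrow> F x = f x"
      then show "sing_quot \<gamma> f u x * ennreal (\<phi> x) * indicator \<Omega> x = sing_quot \<gamma> F U x * ennreal (\<phi> x)"
        using sing_quot_cong[of F x f U u] test_0[OF \<phi>, of x] by (cases "x \<in> \<Omega>") auto
    qed
    note [measurable] = F(1) U(1)
    show "borel_fun (sing_quot \<gamma> F U)" by measurable
  qed (use U ae in auto)
qed

theorem theorem4p2:
  fixes p s \<gamma> :: real
    and \<Omega> :: "'a::euclidean_space set"
    and f u v :: "'a \<Rightarrow> real"
  assumes "1 < p" and "0 < s" and "s < 1"
    and "smooth_bounded_domain \<Omega>"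
    and "real DIM('a) > s * p"
    and "\<gamma> > 0"
    and "integrable (lebesgue_on \<Omega>) f"
    and "AE x in lebesgue_on \<Omega>. f x \<ge> 0"
    and "weak_subsolution s p \<gamma> \<Omega> f u"
    and "nonpos_on_boundary s p \<Omega> u"
    and "weak_supersolution s p \<gamma> \<Omega> f v"
  shows "AE x in lebesgue_on \<Omega>. u x \<le> v x"
proof -
  have \<Omega>: "open \<Omega>" and \<Omega>b: "\<Omega> \<in> sets borel" using assms(4) by (auto simp: smooth_bounded_domain_def)
  have restrict: "(AE x in lebesgue_on \<Omega>. P x) \<longleftrightarrow> (AE x in lborel. x \<in> \<Omega> \<longrightarrow> P x)" for P
    using \<Omega>b by (subst AE_restrict_space_iff) (auto simp: AE_lebesgue_iff)
  obtain F where F: "borel_fun F" "\<And>x. 0 \<le> F x" "\<And>x. x \<notin> \<Omega> \<Longrightarrow> F x = 0" "AE x in lborel. x \<in> \<Omega> \<longrightarrow> F x = f x"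
    by (rule borel_representative[OF \<Omega>b borel_measurable_integrable[OF assms(7)] assms(8)[unfolded restrict]])
      (rule that; assumption)
  have u: "admissible s p \<gamma> \<Omega> f u" and v: "admissible s p \<gamma> \<Omega> f v"
    using assms by (auto simp: weak_subsolution_def weak_supersolution_def)
  obtain U where U: "represents s p \<gamma> \<Omega> f u F U"
    by (rule admissible_representative[OF \<Omega> assms(1) u F(1,4)])
  obtain V where V: "represents s p \<gamma> \<Omega> f v F V"
    by (rule admissible_representative[OF \<Omega> assms(1) v F(1,4)])
  note rep = U[unfolded represents_def] V[unfolded represents_def]
  have Uu: "AE x in lborel. U x = u x" and Vv: "AE x in lborel. V x = v x" using rep by auto
  interpret S: sub_super s p \<gamma> \<Omega> F U V
  proof
    fix \<phi> :: "'a \<Rightarrow> real" assume \<phi>: "test_function \<Omega> \<phi>" "\<And>x. 0 \<le> \<phi> x"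
    show "ereal (form s p U \<phi>) \<le> enn2ereal (src (sing_quot \<gamma> F U) \<phi>)"
      using assms(9) rep(1) \<phi> by (simp add: weak_subsolution_def)
    show "enn2ereal (src (sing_quot \<gamma> F V) \<phi>) \<le> ereal (form s p V \<phi>)"
      using assms(11) rep(2) \<phi> by (simp add: weak_supersolution_def)
  qed (use assms(1-3,6) \<Omega> F(1,2) rep in auto)
  \<comment> \<open>The boundary condition enters here: it supplies the global energy of the
    truncations.\<close>
  have E: "gag s p (\<lambda>x. max (U x - \<epsilon>) 0) < \<infinity>" if "0 < \<epsilon>" for \<epsilon>
  proof -
    have "gagliardo s p UNIV (\<lambda>x. max (u x - \<epsilon>) 0) < \<infinity>"
      using assms(10) that by (simp add: nonpos_on_boundary_def in_Wsp0_def in_Wsp_def)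
    moreover have "AE x in lborel. max (U x - \<epsilon>) 0 = max (u x - \<epsilon>) 0"
      using Uu by eventually_elim simp
    moreover have "borel_fun U" by (rule S.U_borel)
    ultimately show ?thesis
      by (subst (asm) gagliardo_eq[where U = "\<lambda>x. max (U x - \<epsilon>) 0"]) (auto simp: gag_def)
  qed
  have "AE x in lborel. U x \<le> V x" by (rule S.comparison[OF assms(4)]) (rule E)
  then have "AE x in lborel. x \<in> \<Omega> \<longrightarrow> u x \<le> v x"
    using Uu Vv by eventually_elim simp
  then show ?thesis unfolding restrict .
qed

end
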